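(* Let $J\ge0$ be a radially symmetric function on $\mathbb{R}^n$ and assume there exists $\varepsilon_0>0$ such that $$J\in L^1_\infty(\mathbb{R}^n)\cap L^{1+\varepsilon_0}_\infty(\mathbb{R}^n),$$ i.e. $J\in L^1_\beta(\mathbb{R}^n)\cap L^{1+\varepsilon_0}_\beta(\mathbb{R}^n)$ for all $\beta>0$, and that there is $\sigma\ge0$ such that $a(x,t)\sim\langle x\rangle^\sigma$. Let $p>1+\frac{\sigma+2}{n}$. If $u_0\in C(\mathbb{R}^n)$, $u_0\ge0$, and $\|u_0\|_{L^1_{\sigma/(p-1)}}+\|u_0\|_{L^\infty_{\sigma/(p-1)}}$ is sufficiently small, then the Cauchy problem $$\partial_tu=\int_{\mathbb{R}^n}J(x-y)(u(y,t)-u(x,t))\,dy+a(x,t)u^p\quad(x\in\mathbb{R}^n,\ t>0),\qquad u(x,0)=u_0(x),$$ has a unique global solution $$u\in C\Big([0,\infty);C(\mathbb{R}^n)\cap L^1_{\sigma/(p-1)}(\mathbb{R}^n)\cap L^\infty_{\sigma/(p-1)}(\mathbb{R}^n)\Big).$$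
   Context: Notation: $\langle x\rangle=(1+|x|^2)^{1/2}$. For $1\le q\le\infty$, $b\in\mathbb{R}$, $L^q_b(\mathbb{R}^n)$ is the set of measurable $f$ with $\|f\|_{L^q_b}:=\|\langle\cdot\rangle^b f\|_{L^q}<\infty$; $L^q_\infty(\mathbb{R}^n)=\bigcap_{b\in\mathbb{R}}L^q_b(\mathbb{R}^n)$. The relation $a(x,t)\sim\langle x\rangle^\sigma$ means that there are constants $c,C>0$ with $c\langle x\rangle^\sigma\le a(x,t)\le C\langle x\rangle^\sigma$ for all $x\in\mathbb{R}^n$, $t>0$. Green operator: $\alpha_0=\|J\|_{L^1}$, $\mathcal{J}\varphi=J*\varphi$, $\mathcal{J}^0=\mathrm{id}$, and $\mathcal{G}(t)f=e^{-\alpha_0t}\sum_{k=0}^\infty\frac{t^k}{k!}\mathcal{J}^kf$. Solution: a "solution" means a mild solution, i.e. a function $u$ satisfying $$u(t)=\mathcal{G}(t)u_0+\int_0^t\mathcal{G}(t-\tau)\{a(\tau)u(\tau)^p\}\,d\tau$$ for all $x\in\mathbb{R}^n$ and all $t\ge0$, where $a(\tau)=a(\cdot,\tau)$. "Sufficiently small" means: there is a threshold $\epsilon>0$, independent of $u_0$, such that the conclusion holds whenever the quantity is at most $\epsilon$.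
   Formalization: Added: J is not zero almost everywhere (for J=0 every nonzero solution blows up), and a(x,t) is measurable in t and continuous in x (else the integral or the continuity of u can fail). Solutions, also in the uniqueness claim, are taken nonnegative. *)

theory Defs
  imports "HOL-Analysis.Analysis" "HOL-Probability.Essential_Supremum"
begin

definition japanese_bracket :: "real ^ 'n \<Rightarrow> real"
  where "japanese_bracket x = sqrt (1 + (norm x)\<^sup>2)"

text \<open>
  The norm of the weighted Lebesgue space \<open>L\<^sup>q\<^sub>b\<close>, as an extended nonnegative real, for
  \<open>1 \<le> q \<le> \<infinity>\<close>. It is intended for Lebesgue measurable functions only; measurability is part
  of membership in the space.
\<close>
definition weighted_Lnorm :: "ennreal \<Rightarrow> real \<Rightarrow> (real ^ 'n \<Rightarrow> real) \<Rightarrow> ennreal"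
  where "weighted_Lnorm q b f =
    (if q = \<infinity>
     then esssup lebesgue (\<lambda>x. ennreal \<bar>japanese_bracket x powr b * f x\<bar>)
     else let I = (\<integral>\<^sup>+ x. ennreal (\<bar>japanese_bracket x powr b * f x\<bar> powr enn2real q) \<partial>lebesgue)
          in if I = \<infinity> then \<infinity> else ennreal (enn2real I powr (1 / enn2real q)))"

definition weighted_L :: "ennreal \<Rightarrow> real \<Rightarrow> (real ^ 'n \<Rightarrow> real) set"
  where "weighted_L q b = {f \<in> borel_measurable lebesgue. weighted_Lnorm q b f < \<infinity>}"

definition weighted_L_inf :: "ennreal \<Rightarrow> (real ^ 'n \<Rightarrow> real) set"
  where "weighted_L_inf q = (\<Inter>b. weighted_L q b)"

definition radially_symmetric :: "(real ^ 'n \<Rightarrow> real) \<Rightarrow> bool"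
  where "radially_symmetric f \<longleftrightarrow> (\<forall>x y. norm x = norm y \<longrightarrow> f x = f y)"

definition comparable_to_weight :: "(real ^ 'n \<Rightarrow> real \<Rightarrow> real) \<Rightarrow> real \<Rightarrow> bool"
  where "comparable_to_weight a \<sigma> \<longleftrightarrow>
    (\<exists>c C. c > 0 \<and> C > 0 \<and>
      (\<forall>x. \<forall>t>0. c * japanese_bracket x powr \<sigma> \<le> a x t \<and> a x t \<le> C * japanese_bracket x powr \<sigma>))"

definition total_mass :: "(real ^ 'n \<Rightarrow> real) \<Rightarrow> real"
  where "total_mass J = (\<integral>x. \<bar>J x\<bar> \<partial>lebesgue)"

definition convolve :: "(real ^ 'n \<Rightarrow> real) \<Rightarrow> (real ^ 'n \<Rightarrow> real) \<Rightarrow> real ^ 'n \<Rightarrow> real"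
  where "convolve J f = (\<lambda>x. \<integral>y. J (x - y) * f y \<partial>lebesgue)"

definition green :: "(real ^ 'n \<Rightarrow> real) \<Rightarrow> real \<Rightarrow> (real ^ 'n \<Rightarrow> real) \<Rightarrow> real ^ 'n \<Rightarrow> real"
  where "green J t f = (\<lambda>x. exp (- total_mass J * t) *
    (\<Sum>k. t ^ k / fact k * (convolve J ^^ k) f x))"

text \<open>
  Mild solutions on \<open>[0, \<infinity>)\<close>, written \<open>u t x\<close>. Only the values at times \<open>t \<ge> 0\<close> are meaningful.
  Nonnegativity is required because the exponent \<open>p\<close> is an arbitrary real number, so that
  \<open>u\<^sup>p\<close> only makes sense for \<open>u \<ge> 0\<close>. The equation involves total integrals and sums; for \<open>u\<close>
  in \<open>solution_class (\<sigma> / (p - 1))\<close> below and \<open>a\<close> comparable to the weight \<open>\<langle>x\<rangle>\<^sup>\<sigma>\<close>, measurable in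
  time and continuous in space, all of them converge absolutely.
\<close>
definition mild_solution ::
    "(real ^ 'n \<Rightarrow> real) \<Rightarrow> (real ^ 'n \<Rightarrow> real \<Rightarrow> real) \<Rightarrow> real \<Rightarrow> (real ^ 'n \<Rightarrow> real) \<Rightarrow>
      (real \<Rightarrow> real ^ 'n \<Rightarrow> real) \<Rightarrow> bool"
  where "mild_solution J a p u0 u \<longleftrightarrow>
    (\<forall>t\<ge>0. \<forall>x. 0 \<le> u t x \<and>
      u t x = green J t u0 x +
        (LINT \<tau>:{0..t}|lebesgue. green J (t - \<tau>) (\<lambda>y. a y \<tau> * u \<tau> y powr p) x))"

text \<open>
  The space \<open>C([0, \<infinity>); C \<inter> L\<^sup>1\<^sub>b \<inter> L\<^sup>\<infinity>\<^sub>b)\<close>, with the norm \<open>\<parallel>f\<parallel> = \<parallel>f\<parallel>\<^bsub>1,b\<^esub> + \<parallel>f\<parallel>\<^bsub>\<infinity>,b\<^esub>\<close> on the target.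
\<close>
definition solution_class :: "real \<Rightarrow> (real \<Rightarrow> real ^ 'n \<Rightarrow> real) set"
  where "solution_class b = {u.
    (\<forall>t\<ge>0. continuous_on UNIV (u t) \<and> u t \<in> weighted_L 1 b \<and> u t \<in> weighted_L \<infinity> b) \<and>
    (\<forall>t0\<ge>0. ((\<lambda>t. weighted_Lnorm 1 b (\<lambda>x. u t x - u t0 x) +
                  weighted_Lnorm \<infinity> b (\<lambda>x. u t x - u t0 x)) \<longlongrightarrow> 0) (at t0 within {0..}))}"

end

theory Submission
  imports Defs
begin

text \<open>
  Put \<open>b = \<sigma> / (p - 1)\<close>. Since the weight \<open>\<langle>x\<rangle>\<^sup>\<sigma>\<close> is the \<open>(p - 1)\<close>-st power of \<open>\<langle>x\<rangle>\<^sup>b\<close>, the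
  nonlinearity acts on \<open>G(t) u\<^sub>0\<close> as a potential bounded by \<open>C (sup \<langle>x\<rangle>\<^sup>b G(t) u\<^sub>0)\<^bsup>p - 1\<^esup>\<close>. If the
  time integral of this potential is small, \<open>2 G(t) u\<^sub>0\<close> is a supersolution, and the Picard
  iteration below it converges geometrically in the norm \<open>sup e\<^bsup>-\<mu>t\<^esup> \<langle>x\<rangle>\<^sup>b |u|\<close>; the same contraction
  gives uniqueness. The condition on \<open>p\<close> says exactly that \<open>(n - b) (p - 1) / 2 > 1\<close>, so it is enough
  that \<open>sup \<langle>x\<rangle>\<^sup>b G(t) u\<^sub>0\<close> decays like \<open>t\<^bsup>-\<theta>\<^esup>\<close> for every \<open>\<theta> < (n - b) / 2\<close>.

  The decay of \<open>G(t)\<close> is obtained without Fourier analysis. By Steinhaus' argument \<open>J * J\<close> dominates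
  a multiple of the indicator of a small cube, which is a convolution product of a smaller cube with
  two-point measures in the coordinate directions. Powers of the latter are binomial, with largest
  weight of order \<open>k\<^bsup>-1/2\<^esup>\<close> in each direction, so the \<open>k\<close>-th convolution power gains \<open>k\<^bsup>-n/2\<^esup>\<close>. The weight
  is handled by the moments of \<open>G(t)\<close>, which are diffusive because \<open>J\<close> is even.

  All operators are positive, so the whole analysis takes place for \<open>[0, \<infinity>]\<close>-valued functions, where
  Tonelli's theorem needs no integrability.
\<close>

section \<open>Convolution of nonnegative functions\<close>

text \<open>Smallness and contraction do separate work. Smallness enters only through the invariance
  of the set u <= 2 G(t) u0: by the semigroup law the source at time \<tau>, carried on to time t,
  is again bounded by a multiple of G(t) u0, and only the time integral of the potential remains.
  Contraction and uniqueness need no smallness, because the exponential factor in the norm pays for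
  any Lipschitz constant; hence uniqueness holds against every solution of the class, however large.
  The exponent (n - b) / 2 originates on the diffusive scale: for |x| up to t^(1/2) the weight costs
  t^(b/2) against the sup decay t^(-n/2). The cut is made slightly further out, at t^(1/2 + \<eta>),
  which loses an arbitrarily small power; the condition on p is strict, so the loss is harmless. The
  obstacle in the decay of G(t) is that J need not be bounded below on any open set. Only J * J is,
  near the origin, and only a part P of it is of cube type. The remainder N contributes nothing but
  its mass, so the decay has to be extracted from the factors P in the powers of N + P.\<close>

definition nconv :: "('a::euclidean_space \<Rightarrow> ennreal) \<Rightarrow> ('a \<Rightarrow> ennreal) \<Rightarrow> 'a \<Rightarrow> ennreal"
  where "nconv g f x = (\<integral>\<^sup>+ y. g (x - y) * f y \<partial>lborel)"

lemma nconv_measurable [measurable]: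
  assumes [measurable]: "g \<in> borel_measurable borel" "f \<in> borel_measurable borel"
  shows "nconv g f \<in> borel_measurable borel"
  unfolding nconv_def by measurable

lemma nn_integral_lborel_reflect:
  fixes f :: "'a::euclidean_space \<Rightarrow> ennreal"
  assumes [measurable]: "f \<in> borel_measurable borel"
  shows "(\<integral>\<^sup>+ y. f (x - y) \<partial>lborel) = (\<integral>\<^sup>+ y. f y \<partial>lborel)"
proof -
  have "(\<integral>\<^sup>+ y. f y \<partial>lborel)
      = (\<integral>\<^sup>+ y. f y \<partial>(density (distr lborel borel (\<lambda>y. x + (-1) *\<^sub>R y)) (\<lambda>_. ennreal (\<bar>-1\<bar> ^ DIM('a)))))"
    by (subst lborel_affine[of "-1" x]) auto
  also have "\<dots> = (\<integral>\<^sup>+ y. f (x - y) \<partial>lborel)"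
    by (simp add: nn_integral_density nn_integral_distr)
  finally show ?thesis ..
qed

lemma nn_integral_lborel_translate:
  fixes f :: "'a::euclidean_space \<Rightarrow> ennreal"
  assumes [measurable]: "f \<in> borel_measurable borel"
  shows "(\<integral>\<^sup>+ y. f (y - x) \<partial>lborel) = (\<integral>\<^sup>+ y. f y \<partial>lborel)"
  using nn_integral_lborel_reflect[of "\<lambda>y. f (- y)" x] nn_integral_lborel_reflect[of f 0] by simp

lemma nconv_commute:
  assumes [measurable]: "g \<in> borel_measurable borel" "f \<in> borel_measurable borel"
  shows "nconv g f = nconv f g"
proof
  fix x
  have "nconv g f x = (\<integral>\<^sup>+ y. g (x - (x - y)) * f (x - y) \<partial>lborel)"
    unfolding nconv_def by (subst nn_integral_lborel_reflect) auto
  then show "nconv g f x = nconv f g x"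
    by (simp add: nconv_def mult.commute)
qed

lemma nconv_assoc:
  assumes [measurable]: "g \<in> borel_measurable borel" "h \<in> borel_measurable borel"
    "f \<in> borel_measurable borel"
  shows "nconv g (nconv h f) = nconv (nconv g h) f"
proof
  fix x
  have "nconv g (nconv h f) x = (\<integral>\<^sup>+ y. \<integral>\<^sup>+ z. g (x - y) * (h (y - z) * f z) \<partial>lborel \<partial>lborel)"
    unfolding nconv_def by (simp add: nn_integral_cmult)
  also have "\<dots> = (\<integral>\<^sup>+ z. \<integral>\<^sup>+ y. g (x - y) * (h (y - z) * f z) \<partial>lborel \<partial>lborel)"
    by (rule lborel_pair.Fubini') measurable
  also have "\<dots> = (\<integral>\<^sup>+ z. (\<integral>\<^sup>+ y. g (x - y) * h (y - z) \<partial>lborel) * f z \<partial>lborel)"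
    by (simp add: nn_integral_multc[symmetric] mult.assoc)
  also have "\<dots> = (\<integral>\<^sup>+ z. (\<integral>\<^sup>+ y. g (x - z - y) * h y \<partial>lborel) * f z \<partial>lborel)"
  proof -
    have "(\<integral>\<^sup>+ y. g (x - y) * h (y - z) \<partial>lborel) = (\<integral>\<^sup>+ y. g (x - z - y) * h y \<partial>lborel)" for z
      using nn_integral_lborel_translate[of "\<lambda>y. g (x - z - y) * h y" z] by simp
    then show ?thesis by simp
  qed
  finally show "nconv g (nconv h f) x = nconv (nconv g h) f x"
    by (simp add: nconv_def)
qed

lemma nconv_left_commute:
  assumes "g \<in> borel_measurable borel" "h \<in> borel_measurable borel" "f \<in> borel_measurable borel"
  shows "nconv g (nconv h f) = nconv h (nconv g f)"
  using assms by (simp add: nconv_assoc nconv_commute[of g h])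

lemma nconv_mono: "(\<And>y. f y \<le> f' y) \<Longrightarrow> nconv g f x \<le> nconv g f' x"
  unfolding nconv_def by (intro nn_integral_mono mult_left_mono) auto

lemma nconv_add_left:
  assumes [measurable]: "g \<in> borel_measurable borel" "g' \<in> borel_measurable borel" "f \<in> borel_measurable borel"
  shows "nconv (\<lambda>x. g x + g' x) f x = nconv g f x + nconv g' f x"
  unfolding nconv_def by (simp add: distrib_right nn_integral_add)

lemma nconv_add:
  assumes [measurable]: "g \<in> borel_measurable borel" "f' \<in> borel_measurable borel" "f \<in> borel_measurable borel"
  shows "nconv g (\<lambda>x. f x + f' x) x = nconv g f x + nconv g f' x"
  unfolding nconv_def by (simp add: distrib_left nn_integral_add)

lemma nconv_cmult:
  assumes [measurable]: "g \<in> borel_measurable borel" "f \<in> borel_measurable borel"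
  shows "nconv g (\<lambda>x. c * f x) x = c * nconv g f x"
  unfolding nconv_def by (simp add: nn_integral_cmult[symmetric] mult.left_commute)

lemma nconv_cmult_left:
  assumes [measurable]: "g \<in> borel_measurable borel" "f \<in> borel_measurable borel"
  shows "nconv (\<lambda>x. c * g x) f x = c * nconv g f x"
  unfolding nconv_def by (simp add: nn_integral_cmult[symmetric] mult.assoc)

lemma nconv_suminf:
  assumes [measurable]: "g \<in> borel_measurable borel" "\<And>i. f i \<in> borel_measurable borel"
  shows "nconv g (\<lambda>x. \<Sum>i. f i x) x = (\<Sum>i. nconv g (f i) x)"
  unfolding nconv_def by (simp add: nn_integral_suminf[symmetric] ennreal_suminf_cmult)

lemma nn_integral_nconv:
  assumes [measurable]: "g \<in> borel_measurable borel" "f \<in> borel_measurable borel"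
  shows "(\<integral>\<^sup>+ x. nconv g f x \<partial>lborel) = (\<integral>\<^sup>+ x. g x \<partial>lborel) * (\<integral>\<^sup>+ x. f x \<partial>lborel)"
proof -
  have "(\<integral>\<^sup>+ x. nconv g f x \<partial>lborel) = (\<integral>\<^sup>+ y. \<integral>\<^sup>+ x. g (x - y) * f y \<partial>lborel \<partial>lborel)"
    unfolding nconv_def by (rule lborel_pair.Fubini') measurable
  also have "\<dots> = (\<integral>\<^sup>+ y. (\<integral>\<^sup>+ x. g x \<partial>lborel) * f y \<partial>lborel)"
    by (simp add: nn_integral_multc nn_integral_lborel_translate)
  finally show ?thesis by (simp add: nn_integral_cmult)
qed

lemma nconv_const:
  assumes [measurable]: "g \<in> borel_measurable borel"
  shows "nconv g (\<lambda>_. c) x = (\<integral>\<^sup>+ x. g x \<partial>lborel) * c"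
  unfolding nconv_def by (simp add: nn_integral_multc nn_integral_lborel_reflect)

lemma nconv_bounded:
  assumes "g \<in> borel_measurable borel" "\<And>y. f y \<le> c"
  shows "nconv g f x \<le> (\<integral>\<^sup>+ x. g x \<partial>lborel) * c"
  using nconv_mono[of f "\<lambda>_. c" g x] assms by (simp add: nconv_const)

lemma nconv_funpow_measurable [measurable]:
  assumes [measurable]: "g \<in> borel_measurable borel" "f \<in> borel_measurable borel"
  shows "(nconv g ^^ k) f \<in> borel_measurable borel"
  by (induction k) auto

lemma nconv_funpow_bounded:
  assumes "g \<in> borel_measurable borel" "f \<in> borel_measurable borel" "\<And>y. f y \<le> c"
  shows "(nconv g ^^ k) f x \<le> (\<integral>\<^sup>+ x. g x \<partial>lborel) ^ k * c"
proof (induction k arbitrary: x)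
  case (Suc k)
  show ?case using nconv_bounded[OF assms(1) Suc.IH] by (simp add: mult.assoc)
qed (use assms in simp)

lemma nconv_funpow_commute:
  assumes [measurable]: "g \<in> borel_measurable borel" "h \<in> borel_measurable borel" "f \<in> borel_measurable borel"
  shows "(nconv g ^^ k) (nconv h f) = nconv h ((nconv g ^^ k) f)"
  by (induction k) (simp_all add: nconv_left_commute)

lemma nconv_funpow_mono: "(\<And>y. f y \<le> f' y) \<Longrightarrow> (nconv g ^^ k) f x \<le> (nconv g ^^ k) f' x"
  by (induction k arbitrary: x) (auto intro: nconv_mono)

lemma nconv_funpow_cmult:
  assumes [measurable]: "g \<in> borel_measurable borel" "f \<in> borel_measurable borel"
  shows "(nconv g ^^ k) (\<lambda>x. c * f x) = (\<lambda>x. c * (nconv g ^^ k) f x)"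
  by (induction k) (auto intro!: ext simp: nconv_cmult)

lemma nconv_funpow_add:
  assumes [measurable]: "g \<in> borel_measurable borel" "f \<in> borel_measurable borel" "f' \<in> borel_measurable borel"
  shows "(nconv g ^^ k) (\<lambda>x. f x + f' x) = (\<lambda>x. (nconv g ^^ k) f x + (nconv g ^^ k) f' x)"
  by (induction k) (auto intro!: ext simp: nconv_add)

lemma nconv_funpow_suminf:
  assumes [measurable]: "g \<in> borel_measurable borel" "\<And>i. f i \<in> borel_measurable borel"
  shows "(nconv g ^^ k) (\<lambda>x. \<Sum>i. f i x) = (\<lambda>x. \<Sum>i. (nconv g ^^ k) (f i) x)"
  by (induction k) (auto intro!: ext simp: nconv_suminf)

section \<open>Convolution powers of cubes\<close>

lemma central_binomial_le: "real ((2 * m) choose m) * sqrt (2 * real m + 1) \<le> 4 ^ m"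
proof (induction m)
  case (Suc m)
  have "real (Suc m) * real (2 * Suc m choose Suc m) = 2 * (2 * real m + 1) * real (2 * m choose m)"
  proof -
    have "Suc m * (Suc (Suc (2 * m)) choose Suc m) = Suc (Suc (2 * m)) * (Suc (2 * m) choose m)"
      by (rule Suc_times_binomial)
    also have "Suc (2 * m) choose m = Suc (2 * m) choose Suc m"
      using binomial_symmetric[of m "Suc (2 * m)"] by simp
    also have "Suc (Suc (2 * m)) * (Suc (2 * m) choose Suc m) = 2 * (Suc m * (Suc (2 * m) choose Suc m))"
      by (simp del: binomial_Suc_Suc)
    also have "Suc m * (Suc (2 * m) choose Suc m) = Suc (2 * m) * (2 * m choose m)"
      by (rule Suc_times_binomial)
    finally have "real (Suc m * (Suc (Suc (2 * m)) choose Suc m)) = real (2 * (Suc (2 * m) * (2 * m choose m)))"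
      by (simp only:)
    then show ?thesis by (simp add: algebra_simps del: binomial_Suc_Suc)
  qed
  then have eq: "real (2 * Suc m choose Suc m) = 2 * (2 * real m + 1) / (real m + 1) * real (2 * m choose m)"
    by (simp add: field_simps)
  \<comment> \<open>The square root is chosen so that the induction closes: consecutive central
    coefficients have the ratio 2 (2m + 1) / (m + 1), and the step becomes (2m + 1)(2m + 3) <= (2m +
    2)^2.\<close>
  have "sqrt (2 * real m + 1) * sqrt (2 * real m + 3) \<le> 2 * (real m + 1)"
    unfolding real_sqrt_mult[symmetric]
    by (rule real_le_lsqrt) (auto simp: power2_eq_square algebra_simps)
  then have "sqrt (2 * real m + 1) * sqrt (2 * real m + 3) * sqrt (2 * real m + 1)
      \<le> 2 * (real m + 1) * sqrt (2 * real m + 1)"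
    by (intro mult_right_mono) auto
  moreover have "sqrt (2 * real m + 1) * sqrt (2 * real m + 3) * sqrt (2 * real m + 1)
      = (sqrt (2 * real m + 1))\<^sup>2 * sqrt (2 * real m + 3)"
    by (simp only: power2_eq_square mult_ac)
  ultimately have "(sqrt (2 * real m + 1))\<^sup>2 * sqrt (2 * real m + 3) \<le> 2 * (real m + 1) * sqrt (2 * real m + 1)"
    by simp
  then have "(2 * real m + 1) * sqrt (2 * real m + 3) \<le> 2 * (real m + 1) * sqrt (2 * real m + 1)"
    by simp
  then have "2 * (2 * real m + 1) / (real m + 1) * sqrt (2 * real m + 3) \<le> 4 * sqrt (2 * real m + 1)"
    by (simp add: field_simps)
  then have "real (2 * m choose m) * (2 * (2 * real m + 1) / (real m + 1) * sqrt (2 * real m + 3))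
      \<le> real (2 * m choose m) * (4 * sqrt (2 * real m + 1))"
    by (intro mult_left_mono) auto
  also have "\<dots> \<le> 4 * 4 ^ m" using Suc by simp
  finally show ?case unfolding eq by (simp add: mult_ac add.commute)
qed simp

lemma binomial_le_sqrt: "real (n choose k) \<le> 2 ^ n / sqrt (real n + 1)"
proof -
  have "real (n choose (n div 2)) * sqrt (real n + 1) \<le> 2 ^ n"
  proof (cases "even n")
    case True
    then obtain m where "n = 2 * m" by blast
    then show ?thesis using central_binomial_le[of m] by (simp add: power_mult)
  next
    case False
    then obtain m where n: "n = 2 * m + 1" by (rule oddE)
    \<comment> \<open>An odd row has two equal maxima, which add up to the central coefficient of
      the next row, so the even case for m + 1 applies.\<close>
    have "2 * Suc m choose Suc m = (Suc (2 * m) choose m) + (Suc (2 * m) choose Suc m)"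
      using binomial_Suc_Suc[of "Suc (2 * m)" m] by (simp del: binomial_Suc_Suc)
    moreover have "Suc (2 * m) choose Suc m = Suc (2 * m) choose m"
      using binomial_symmetric[of m "Suc (2 * m)"] by simp
    ultimately have "2 * real (n choose m) = real (2 * Suc m choose Suc m)"
      by (simp add: n del: binomial_Suc_Suc)
    moreover have "real (2 * Suc m choose Suc m) * sqrt (2 * real m + 3) \<le> 4 * 4 ^ m"
      using central_binomial_le[of "Suc m"] by (simp add: add.commute del: binomial_Suc_Suc)
    ultimately have "2 * (real (n choose m) * sqrt (2 * real m + 3)) \<le> 4 * 4 ^ m"
      by (simp only: mult.assoc[symmetric])
    then have "real (n choose m) * sqrt (2 * real m + 3) \<le> 2 * 4 ^ m" by simp
    moreover have "real (n choose m) * sqrt (2 * real m + 2) \<le> real (n choose m) * sqrt (2 * real m + 3)"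
      by (intro mult_left_mono) auto
    ultimately have "real (n choose m) * sqrt (2 * real m + 2) \<le> 2 * 4 ^ m" by (rule order_trans[rotated])
    then show ?thesis by (simp add: n power_mult add_ac del: binomial_Suc_Suc)
  qed
  moreover have "real (n choose k) * sqrt (real n + 1) \<le> real (n choose (n div 2)) * sqrt (real n + 1)"
    using binomial_maximum[of n k] by (intro mult_right_mono) auto
  ultimately have "real (n choose k) * sqrt (real n + 1) \<le> 2 ^ n" by (rule order_trans[rotated])
  then show ?thesis by (simp add: pos_le_divide_eq)
qed

text \<open>Convolution with the product of the two-point measures delta_0 + delta_v, v in the
  list.\<close>

primrec pair_sum :: "'a::real_vector list \<Rightarrow> ('a \<Rightarrow> ennreal) \<Rightarrow> 'a \<Rightarrow> ennreal" where
  "pair_sum [] f = f"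
| "pair_sum (v # vs) f = (\<lambda>x. pair_sum vs f x + pair_sum vs f (x - v))"

text \<open>Convolution with the product of the counting measures on the rays 0, v, 2v, ...; this is
  what is left of a binomial sum once all coefficients are replaced by the largest one.\<close>

primrec ray_sum :: "'a::real_vector list \<Rightarrow> ('a \<Rightarrow> ennreal) \<Rightarrow> 'a \<Rightarrow> ennreal" where
  "ray_sum [] f = f"
| "ray_sum (v # vs) f = (\<lambda>x. \<Sum>l. ray_sum vs f (x - real l *\<^sub>R v))"

lemma pair_sum_shift: "pair_sum vs (\<lambda>x. f (x - v)) = (\<lambda>x. pair_sum vs f (x - v))"
  by (induction vs) (auto simp: fun_eq_iff algebra_simps)

lemma pair_sum_add: "pair_sum vs (\<lambda>x. f x + g x) = (\<lambda>x. pair_sum vs f x + pair_sum vs g x)"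
  by (induction vs) (auto simp: fun_eq_iff add_ac)

text \<open>Translations commute, so a power of the product splits into powers of its factors; this
  isolates the binomial sum in the direction v.\<close>

lemma pair_sum_Cons_funpow:
  "(pair_sum (v # vs) ^^ k) f = (pair_sum [v] ^^ k) ((pair_sum vs ^^ k) f)"
proof (induction k)
  case (Suc k)
  have comm: "pair_sum vs (pair_sum [v] g) = pair_sum [v] (pair_sum vs g)" for g
    by (simp add: pair_sum_add pair_sum_shift)
  have comm': "pair_sum vs ((pair_sum [v] ^^ i) g) = (pair_sum [v] ^^ i) (pair_sum vs g)" for i g
    by (induction i) (simp_all only: funpow.simps comp_def id_apply comm)
  have "pair_sum (v # vs) g = pair_sum [v] (pair_sum vs g)" for g by simp
  then show ?case using Suc by (simp only: funpow.simps comp_def comm')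
qed simp

lemma pair_sum_single_funpow:
  "(pair_sum [v] ^^ k) f x = (\<Sum>l\<le>k. of_nat (k choose l) * f (x - real l *\<^sub>R v))"
proof (induction k arbitrary: x)
  case (Suc k)
  let ?F = "\<lambda>l. f (x - real l *\<^sub>R v)"
  have "(pair_sum [v] ^^ Suc k) f x =
      (\<Sum>l\<le>k. of_nat (k choose l) * ?F l) + (\<Sum>l\<le>k. of_nat (k choose l) * ?F (Suc l))"
  proof -
    have "x - v - real l *\<^sub>R v = x - real (Suc l) *\<^sub>R v" for l by (simp add: algebra_simps)
    moreover have "(pair_sum [v] ^^ Suc k) f x = (pair_sum [v] ^^ k) f x + (pair_sum [v] ^^ k) f (x - v)"
      by simp
    ultimately show ?thesis by (simp only: Suc)
  qed
  also have "(\<Sum>l\<le>k. of_nat (k choose l) * ?F l) = of_nat (k choose 0) * ?F 0 + (\<Sum>l<k. of_nat (k choose Suc l) * ?F (Suc l))"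
    by (subst sum.atMost_shift) simp
  also have "(\<Sum>l<k. of_nat (k choose Suc l) * ?F (Suc l)) = (\<Sum>l\<le>k. of_nat (k choose Suc l) * ?F (Suc l))"
    by (simp add: lessThan_Suc_atMost[symmetric])
  finally have "(pair_sum [v] ^^ Suc k) f x =
      ?F 0 + (\<Sum>l\<le>k. of_nat (k choose l) * ?F (Suc l) + of_nat (k choose Suc l) * ?F (Suc l))"
    by (simp add: sum.distrib add_ac del: pair_sum.simps)
  then show ?case
    by (subst sum.atMost_Suc_shift) (simp add: distrib_right del: pair_sum.simps)
qed simp

text \<open>The directions are treated one after the other. Each contributes the largest entry of
  row k and lets its finite sum grow to the whole ray, whence one factor
  \<open>2 ^ k / sqrt (k + 1)\<close> per vector.\<close>

lemma pair_sum_funpow_le_ray_sum: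
  "(pair_sum vs ^^ k) f x \<le> ennreal (2 ^ k / sqrt (real k + 1)) ^ length vs * ray_sum vs f x"
proof (induction vs arbitrary: x)
  case Nil
  have "(pair_sum [] ^^ k) f = f" by (induction k) auto
  then show ?case by (simp del: pair_sum.simps)
next
  case (Cons v vs)
  let ?c = "ennreal (2 ^ k / sqrt (real k + 1))"
  let ?g = "\<lambda>x. ?c ^ length vs * ray_sum vs f x"
  have "(pair_sum (v # vs) ^^ k) f x = (\<Sum>l\<le>k. of_nat (k choose l) * (pair_sum vs ^^ k) f (x - real l *\<^sub>R v))"
    by (subst pair_sum_Cons_funpow, subst pair_sum_single_funpow) (rule refl)
  also have "\<dots> \<le> (\<Sum>l\<le>k. ?c * ?g (x - real l *\<^sub>R v))"
  proof (intro sum_mono mult_mono Cons)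
    show "of_nat (k choose l) \<le> ?c" for l
      using binomial_le_sqrt[of k l] by (simp add: ennreal_of_nat_eq_real_of_nat ennreal_leI)
  qed auto
  also have "\<dots> \<le> (\<Sum>l. ?c * ?g (x - real l *\<^sub>R v))"
    by (intro sum_le_suminf) auto
  finally show ?case by (simp add: mult.assoc del: pair_sum.simps)
qed

lemma pair_sum_measurable [measurable]:
  "f \<in> borel_measurable borel \<Longrightarrow> pair_sum vs f \<in> borel_measurable (borel :: 'a::euclidean_space measure)"
  by (induction vs) auto

lemma pair_sum_funpow_measurable [measurable]:
  "f \<in> borel_measurable borel \<Longrightarrow> (pair_sum vs ^^ k) f \<in> borel_measurable (borel :: 'a::euclidean_space measure)"
  by (induction k) auto

lemma ray_sum_measurable [measurable]:
  "f \<in> borel_measurable borel \<Longrightarrow> ray_sum vs f \<in> borel_measurable (borel :: 'a::euclidean_space measure)"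
  by (induction vs) auto

lemma nconv_translate_left: "nconv (\<lambda>x. g (x - v)) f x = nconv g f (x - v)"
  by (simp add: nconv_def algebra_simps)

lemma nconv_pair_sum_left:
  fixes g :: "'a::euclidean_space \<Rightarrow> ennreal"
  assumes [measurable]: "g \<in> borel_measurable borel" "f \<in> borel_measurable borel"
  shows "nconv (pair_sum vs g) f = pair_sum vs (nconv g f)"
proof (induction vs)
  case (Cons v vs)
  have "nconv (pair_sum (v # vs) g) f x = pair_sum (v # vs) (nconv g f) x" for x
  proof -
    have "nconv (pair_sum (v # vs) g) f x = nconv (pair_sum vs g) f x + nconv (\<lambda>x. pair_sum vs g (x - v)) f x"
      by (simp add: nconv_add_left)
    then show ?thesis by (simp add: nconv_translate_left Cons)
  qed
  then show ?case by blast
qed simp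

lemma nconv_pair_sum_right:
  fixes g :: "'a::euclidean_space \<Rightarrow> ennreal"
  assumes [measurable]: "g \<in> borel_measurable borel" "f \<in> borel_measurable borel"
  shows "nconv g (pair_sum vs f) = pair_sum vs (nconv g f)"
  using assms by (metis nconv_commute nconv_pair_sum_left pair_sum_measurable)

lemma nconv_ray_sum_left:
  fixes g :: "'a::euclidean_space \<Rightarrow> ennreal"
  assumes [measurable]: "g \<in> borel_measurable borel" "f \<in> borel_measurable borel"
  shows "nconv (ray_sum vs g) f = ray_sum vs (nconv g f)"
proof (induction vs)
  case (Cons v vs)
  have "nconv (ray_sum (v # vs) g) f x = ray_sum (v # vs) (nconv g f) x" for x
  proof -
    have "nconv (ray_sum (v # vs) g) f x = (\<integral>\<^sup>+ y. (\<Sum>l. ray_sum vs g (x - y - real l *\<^sub>R v) * f y) \<partial>lborel)"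
      by (simp add: nconv_def)
    also have "\<dots> = (\<Sum>l. nconv (\<lambda>x. ray_sum vs g (x - real l *\<^sub>R v)) f x)"
      unfolding nconv_def by (rule nn_integral_suminf) measurable
    finally show ?thesis by (simp add: nconv_translate_left Cons)
  qed
  then show ?case by blast
qed simp

lemma nconv_ray_sum_right:
  fixes g :: "'a::euclidean_space \<Rightarrow> ennreal"
  assumes [measurable]: "g \<in> borel_measurable borel" "f \<in> borel_measurable borel"
  shows "nconv g (ray_sum vs f) = nconv (ray_sum vs g) f"
  using assms by (metis nconv_commute nconv_ray_sum_left ray_sum_measurable)

lemma nconv_pair_sum_funpow:
  fixes g :: "'a::euclidean_space \<Rightarrow> ennreal"
  assumes [measurable]: "g \<in> borel_measurable borel" "f \<in> borel_measurable borel"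
  shows "(nconv (pair_sum vs g) ^^ k) f = (nconv g ^^ k) ((pair_sum vs ^^ k) f)"
proof (induction k)
  case (Suc k)
  have comm: "pair_sum vs ((nconv g ^^ i) f') = (nconv g ^^ i) (pair_sum vs f')"
    if [measurable]: "f' \<in> borel_measurable borel" for i f'
    by (induction i) (simp_all add: nconv_pair_sum_right[symmetric])
  show ?case
    by (simp add: Suc nconv_pair_sum_left comm nconv_pair_sum_right[symmetric])
qed simp

text \<open>A convolution power of a product of pair sums is a product of binomial sums; each of them is
  at most its largest coefficient times a sum over a whole ray, and the ray sums of a cube tile
  an orthant.\<close>
lemma nconv_pair_sum_funpow_le:
  fixes g :: "'a::euclidean_space \<Rightarrow> ennreal"
  assumes [measurable]: "g \<in> borel_measurable borel" "f \<in> borel_measurable borel"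
    and le1: "\<And>x. ray_sum vs g x \<le> 1"
  shows "(nconv (pair_sum vs g) ^^ Suc k) f x
    \<le> ennreal (2 ^ Suc k / sqrt (real k + 2)) ^ length vs * ((\<integral>\<^sup>+ x. g x \<partial>lborel) ^ k * (\<integral>\<^sup>+ x. f x \<partial>lborel))"
proof -
  define c where "c = ennreal (2 ^ Suc k / sqrt (real k + 2)) ^ length vs"
  have "(nconv (pair_sum vs g) ^^ Suc k) f x = (nconv g ^^ Suc k) ((pair_sum vs ^^ Suc k) f) x"
    by (simp only: nconv_pair_sum_funpow assms)
  also have "\<dots> \<le> (nconv g ^^ Suc k) (\<lambda>x. c * ray_sum vs f x) x"
    using pair_sum_funpow_le_ray_sum[of "Suc k" vs f]
    by (intro nconv_funpow_mono) (simp add: c_def add.commute del: funpow.simps)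
  also have "\<dots> = c * (nconv g ^^ k) (nconv g (ray_sum vs f)) x"
    by (subst nconv_funpow_cmult) (simp_all add: funpow_swap1)
  also have "\<dots> \<le> c * ((\<integral>\<^sup>+ x. g x \<partial>lborel) ^ k * (\<integral>\<^sup>+ x. f x \<partial>lborel))"
  proof (intro mult_left_mono nconv_funpow_bounded)
    fix y
    \<comment> \<open>The ray sum moves from f, for which it may diverge, to g, where
      \<open>le1\<close> bounds it. One convolution factor is spent on this, which is why the
      exponent is \<open>Suc k\<close> while the mass of g occurs only k times.\<close>
    have "nconv g (ray_sum vs f) y = nconv (ray_sum vs g) f y"
      by (simp add: nconv_ray_sum_right)
    also have "\<dots> \<le> (\<integral>\<^sup>+ x. 1 * f x \<partial>lborel)"
      unfolding nconv_def by (intro nn_integral_mono mult_right_mono le1) auto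
    finally show "nconv g (ray_sum vs f) y \<le> (\<integral>\<^sup>+ x. f x \<partial>lborel)" by simp
  qed auto
  finally show ?thesis by (simp add: c_def)
qed

text \<open>Half-open, so that the translates by multiples of h along an axis are disjoint; closed
  cubes would make the ray sum equal to 2 on common faces.\<close>

definition corner_cube :: "real \<Rightarrow> (real ^ 'n) set"
  where "corner_cube h = {x. \<forall>i. 0 \<le> x $ i \<and> x $ i < h}"

lemma corner_cube_measurable [measurable]: "corner_cube h \<in> sets borel"
proof -
  have "corner_cube h = (\<Inter>i. {x. 0 \<le> x $ i} \<inter> {x. x $ i < h})"
    by (auto simp: corner_cube_def)
  also have "\<dots> \<in> sets borel"
    by (intro sets.finite_INT sets.Int borel_closed borel_open closed_Collect_le open_Collect_less)
       (auto intro!: continuous_intros)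
  finally show ?thesis .
qed

text \<open>In coordinate i exactly one shift l brings a nonnegative entry back into [0, h), namely
  the floor of the entry divided by h, so every series has at most one nonzero term. The induction
  frees the listed coordinates upwards one at a time, while the others stay confined to [0,
  h).\<close>

lemma ray_sum_corner_cube:
  fixes x :: "real ^ 'n"
  assumes "0 < h" "distinct is"
  shows "ray_sum (map (\<lambda>i. h *\<^sub>R axis i 1) is) (indicator (corner_cube h)) x
    = indicator {x. (\<forall>i\<in>set is. 0 \<le> x $ i) \<and> (\<forall>i. i \<notin> set is \<longrightarrow> 0 \<le> x $ i \<and> x $ i < h)} x"
  using assms(2)
proof (induction "is" arbitrary: x)
  case Nil
  show ?case by (simp add: corner_cube_def)
next
  case (Cons i "is")
  let ?S = "\<lambda>is. {x :: real ^ 'n. (\<forall>i\<in>set is. 0 \<le> x $ i) \<and> (\<forall>i. i \<notin> set is \<longrightarrow> 0 \<le> x $ i \<and> x $ i < h)}"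
  define A where "A \<longleftrightarrow> (\<forall>k\<in>set is. 0 \<le> x $ k) \<and> (\<forall>k. k \<notin> set is \<and> k \<noteq> i \<longrightarrow> 0 \<le> x $ k \<and> x $ k < h)"
  have i: "i \<notin> set is" using Cons by simp
  have shift: "(x - (real l * h) *\<^sub>R axis i 1) $ k = (if k = i then x $ i - real l * h else x $ k)" for l k
    by (simp add: axis_def)
  have mem: "x - (real l * h) *\<^sub>R axis i 1 \<in> ?S is \<longleftrightarrow> A \<and> 0 \<le> x $ i - real l * h \<and> x $ i - real l * h < h" for l
    using i unfolding A_def mem_Collect_eq shift by auto
  have mem': "x \<in> ?S (i # is) \<longleftrightarrow> A \<and> 0 \<le> x $ i"
    using i unfolding A_def by auto
  have floor: "0 \<le> x $ i - real l * h \<and> x $ i - real l * h < h \<longleftrightarrow> 0 \<le> x $ i \<and> l = nat \<lfloor>x $ i / h\<rfloor>" for l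
  proof
    assume l: "0 \<le> x $ i - real l * h \<and> x $ i - real l * h < h"
    then have "\<lfloor>x $ i / h\<rfloor> = int l"
      using \<open>0 < h\<close> by (intro floor_unique) (auto simp: field_simps)
    moreover have "0 \<le> x $ i" using l \<open>0 < h\<close>
      by (meson diff_ge_0_iff_ge less_eq_real_def mult_nonneg_nonneg of_nat_0_le_iff order_trans)
    ultimately show "0 \<le> x $ i \<and> l = nat \<lfloor>x $ i / h\<rfloor>" by simp
  next
    assume l: "0 \<le> x $ i \<and> l = nat \<lfloor>x $ i / h\<rfloor>"
    then have "real l = of_int \<lfloor>x $ i / h\<rfloor>" using \<open>0 < h\<close> by simp
    then have "real l \<le> x $ i / h" "x $ i / h < real l + 1" by linarith+
    then show "0 \<le> x $ i - real l * h \<and> x $ i - real l * h < h"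
      using \<open>0 < h\<close> by (simp add: field_simps)
  qed
  have "ray_sum (map (\<lambda>i. h *\<^sub>R axis i 1) (i # is)) (indicator (corner_cube h)) x
      = (\<Sum>l. indicator (?S is) (x - (real l * h) *\<^sub>R axis i 1))"
    using Cons by simp
  also have "\<dots> = (\<Sum>l. if l = nat \<lfloor>x $ i / h\<rfloor> then indicator (?S (i # is)) x else 0)"
    using mem mem' floor by (intro arg_cong[where f = suminf] ext) (auto simp: indicator_def simp del: set_simps)
  also have "\<dots> = indicator (?S (i # is)) x"
    by (rule sums_unique[OF sums_single, symmetric])
  finally show ?case .
qed

section \<open>Decay of convolution powers\<close>

text \<open>Divide by x^(-s) and put y = 1/x. Then (1 + y)^(-s) <= (1 + y)^(-1/2) <= 1 - y/4 on (0,
  1], so the average on the left is at most 1 - \<theta> y / 4, and Bernoulli's inequality turns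
  this back into a power. The left side describes a step of length 1 taken with probability
  \<theta>; the shift \<theta> / (4 s) is the part of its mean that survives.\<close>

lemma powr_neg_step:
  fixes x s \<theta> :: real
  assumes x: "1 \<le> x" and s: "1/2 \<le> s" and \<theta>: "0 \<le> \<theta>" "\<theta> \<le> 1"
  shows "(1 - \<theta>) * x powr - s + \<theta> * (x + 1) powr - s \<le> (x + \<theta> / (4 * s)) powr - s"
proof -
  define y where "y = 1 / x"
  have y: "0 < y" "y \<le> 1" using x by (auto simp: y_def)
  have "(1 + y) powr - s \<le> (1 + y) powr - (1/2)"
    using powr_mono[of "- s" "- (1/2)" "1 + y"] s y by simp
  also have "\<dots> = 1 / sqrt (1 + y)"
    using y by (simp add: powr_minus powr_half_sqrt inverse_eq_divide)
  also have "\<dots> \<le> 1 - y / 4"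
  proof -
    have "y ^ 3 \<ge> 0" "y\<^sup>2 \<le> y" using y by (auto simp: power2_eq_square mult_left_le)
    moreover have "(1 - y / 4)\<^sup>2 * (1 + y) = 1 + y / 2 - 7 / 16 * y\<^sup>2 + y ^ 3 / 16"
      by (simp add: power2_eq_square power3_eq_cube field_simps)
    ultimately have "1 \<le> (1 - y / 4)\<^sup>2 * (1 + y)"
      using y by linarith
    also have "\<dots> = ((1 - y / 4) * sqrt (1 + y))\<^sup>2"
      using y by (simp add: power_mult_distrib)
    finally have "1\<^sup>2 \<le> ((1 - y / 4) * sqrt (1 + y))\<^sup>2" by simp
    then have "1 \<le> (1 - y / 4) * sqrt (1 + y)"
      by (rule power2_le_imp_le) (use y in auto)
    then show ?thesis using y by (simp add: field_simps)
  qed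
  finally have 1: "(1 + y) powr - s \<le> 1 - y / 4" .
  have "1 - s * (\<theta> / (4 * s) * y) \<le> (1 + \<theta> / (4 * s) * y) powr - s"
  proof -
    let ?z = "\<theta> / (4 * s) * y"
    have z: "0 \<le> ?z" using y \<theta> s by auto
    have "1 - s * ?z \<le> exp (- (s * ?z))"
      using exp_ge_add_one_self[of "- (s * ?z)"] by simp
    also have "\<dots> \<le> exp (- (s * ln (1 + ?z)))"
      using mult_left_mono[OF ln_add_one_self_le_self[OF z], of s] s by simp
    also have "\<dots> = (1 + ?z) powr - s" using z by (simp add: powr_def)
    finally show ?thesis .
  qed
  moreover have "s * (\<theta> / (4 * s) * y) = \<theta> * y / 4" using s by simp
  ultimately have 2: "1 - \<theta> * y / 4 \<le> (1 + \<theta> / (4 * s) * y) powr - s" by simp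
  have "(1 - \<theta>) + \<theta> * (1 + y) powr - s \<le> (1 - \<theta>) + \<theta> * (1 - y / 4)"
    using 1 \<theta> by (intro add_left_mono mult_left_mono) auto
  also have "\<dots> = 1 - \<theta> * y / 4" by (simp add: algebra_simps)
  also note 2
  finally have "((1 - \<theta>) + \<theta> * (1 + y) powr - s) * x powr - s \<le> (1 + \<theta> / (4 * s) * y) powr - s * x powr - s"
    by (intro mult_right_mono) auto
  moreover have "(1 + y) powr - s * x powr - s = (x + 1) powr - s"
    using x y by (simp add: powr_mult[symmetric] y_def distrib_right)
  moreover have "(1 + \<theta> / (4 * s) * y) powr - s * x powr - s = (x + \<theta> / (4 * s)) powr - s"
    using x y s \<theta> by (subst powr_mult[symmetric]) (simp_all add: y_def distrib_right)
  ultimately show ?thesis by (simp add: distrib_right mult.assoc)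
qed

lemma fact_add_le: "fact (k + m) \<le> (fact k * fact m * (1 + real k) ^ m :: real)"
proof (induction m)
  case (Suc m)
  have "fact (k + Suc m) = (1 + real k + real m) * fact (k + m)"
    by (simp add: add_ac)
  also have "\<dots> \<le> ((1 + real m) * (1 + real k)) * (fact k * fact m * (1 + real k) ^ m)"
    by (intro mult_mono Suc) (auto simp: algebra_simps)
  finally show ?case by (simp add: algebra_simps)
qed simp

text \<open>Negative moments of a Poisson variable of mean t. With y = (1 + t) / (1 + k) and an
  integer m >= s one has y^s <= 1 + y^m, and dividing t^k / k! by (1 + k)^m costs at most the factor
  m! when k! is replaced by (k + m)!. What results is again an exponential series, shifted by
  m.\<close>

lemma poisson_moment_neg:
  fixes s :: real
  assumes "0 \<le> s"
  obtains C :: real where "0 < C" "\<And>t :: real. 0 \<le> t \<Longrightarrow>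
    (\<Sum>k. ennreal (t ^ k / fact k * (1 + real k) powr - s)) \<le> ennreal (C * exp t * (1 + t) powr - s)"
proof -
  obtain m :: nat where m: "s \<le> real m" using real_arch_simple by blast
  define C :: real where "C = 1 + 2 * fact m * 2 ^ m"
  have "(\<Sum>k. ennreal (t ^ k / fact k * (1 + real k) powr - s)) \<le> ennreal (C * exp t * (1 + t) powr - s)"
    if t: "0 \<le> t" for t
  proof -
    define w where "w k = (1 + t) powr - s * (t ^ k / fact k
        + fact m * 2 ^ m * (t ^ k / fact k + t ^ (k + m) / fact (k + m)))" for k
    have term_le: "t ^ k / fact k * (1 + real k) powr - s \<le> w k" for k
    proof -
      define y where "y = (1 + t) / (1 + real k)"
      have y: "0 < y" using t by (auto simp: y_def)
      have "y powr s \<le> 1 + y ^ m"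
      proof (cases "y \<le> 1")
        case True
        then have "y powr s \<le> 1" using y assms by (simp add: powr_le1)
        then show ?thesis using y by (simp add: add_increasing2)
      next
        case False
        then have "y powr s \<le> y powr real m" using m by (intro powr_mono) auto
        then show ?thesis using y by (simp add: powr_realpow)
      qed
      moreover have "(1 + real k) powr - s = (1 + t) powr - s * y powr s"
        using t by (simp add: y_def powr_divide powr_minus field_simps)
      ultimately have "(1 + real k) powr - s \<le> (1 + t) powr - s * (1 + y ^ m)"
        by (simp add: mult_left_mono)
      then have "t ^ k / fact k * (1 + real k) powr - s \<le> t ^ k / fact k * ((1 + t) powr - s * (1 + y ^ m))"
        using t by (intro mult_left_mono) auto
      also have "\<dots> = (1 + t) powr - s * (t ^ k / fact k + t ^ k / fact k * y ^ m)"
        by (simp add: algebra_simps)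
      also have "\<dots> \<le> w k"
        unfolding w_def
      proof (intro mult_left_mono add_left_mono)
        have max: "(1 + t) ^ m \<le> 2 ^ m * (1 + t ^ m)"
        proof (cases "t \<le> 1")
          case True
          then have "(1 + t) ^ m \<le> 2 ^ m" using t by (intro power_mono) auto
          then show ?thesis using t by (simp add: distrib_left add_increasing2)
        next
          case False
          then have "(1 + t) ^ m \<le> (2 * t) ^ m" using t by (intro power_mono) auto
          then show ?thesis using t by (simp add: distrib_left power_mult_distrib add_increasing)
        qed
        have f: "1 / (1 + real k) ^ m / fact k \<le> fact m / fact (k + m)"
          using fact_add_le[of k m] by (simp add: field_simps)
        have "t ^ k / fact k * y ^ m = t ^ k * (1 + t) ^ m * (1 / (1 + real k) ^ m / fact k)"
          by (simp add: y_def power_divide field_simps)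
        also have "\<dots> \<le> t ^ k * (2 ^ m * (1 + t ^ m)) * (fact m / fact (k + m))"
          using t by (intro mult_mono max f mult_left_mono) auto
        also have "\<dots> = fact m * 2 ^ m * (t ^ k / fact (k + m) + t ^ (k + m) / fact (k + m))"
          by (simp add: power_add field_simps)
        also have "\<dots> \<le> fact m * 2 ^ m * (t ^ k / fact k + t ^ (k + m) / fact (k + m))"
          using t by (intro mult_left_mono add_right_mono divide_left_mono fact_mono) auto
        finally show "t ^ k / fact k * y ^ m \<le> fact m * 2 ^ m * (t ^ k / fact k + t ^ (k + m) / fact (k + m))" .
      qed auto
      finally show ?thesis .
    qed
    have e: "(\<lambda>k. t ^ k / fact k) sums exp t"
      using exp_converges[of t] by (simp add: divide_inverse mult.commute)
    then have e': "(\<lambda>k. t ^ (k + m) / fact (k + m)) sums (exp t - (\<Sum>i<m. t ^ i / fact i))"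
      by (rule sums_split_initial_segment)
    have w: "w sums ((1 + t) powr - s * (exp t + fact m * 2 ^ m * (exp t + (exp t - (\<Sum>i<m. t ^ i / fact i)))))"
      unfolding w_def by (intro sums_mult sums_add e e')
    have "(\<Sum>k. ennreal (t ^ k / fact k * (1 + real k) powr - s)) \<le> (\<Sum>k. ennreal (w k))"
      using term_le by (intro suminf_le ennreal_leI) auto
    also have "\<dots> = ennreal (\<Sum>k. w k)"
    proof (rule suminf_ennreal2)
      show "0 \<le> w k" for k using t by (simp add: w_def)
      show "summable w" using w by (simp add: sums_iff)
    qed
    also have "(\<Sum>k. w k) = (1 + t) powr - s * (exp t + fact m * 2 ^ m * (exp t + (exp t - (\<Sum>i<m. t ^ i / fact i))))"
      using w by (simp add: sums_iff)
    also have "\<dots> \<le> (1 + t) powr - s * (exp t + fact m * 2 ^ m * (exp t + exp t))"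
      using t by (intro mult_left_mono add_left_mono) (auto intro!: sum_nonneg)
    also have "\<dots> = C * exp t * (1 + t) powr - s"
      by (simp add: C_def algebra_simps)
    finally show ?thesis by (simp add: ennreal_leI)
  qed
  moreover have "0 < C" by (auto simp: C_def intro: add_pos_pos)
  ultimately show ?thesis using that by blast
qed

text \<open>\<open>(1 + i + c k) powr - s\<close> is a supersolution of the recursion that the sup bounds for
  \<open>(N + P)\<^sup>k P\<^sup>i f\<close> obey, so no binomial expansion is needed.\<close>
lemma nconv_funpow_decay:
  fixes N P f :: "'a::euclidean_space \<Rightarrow> ennreal" and \<nu> \<pi> s :: real
  assumes [measurable]: "N \<in> borel_measurable borel" "P \<in> borel_measurable borel" "f \<in> borel_measurable borel"
    and N: "(\<integral>\<^sup>+ x. N x \<partial>lborel) = ennreal \<nu>" and pos: "0 \<le> \<nu>" "0 < \<pi>" and s: "1/2 \<le> s"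
    and P: "\<And>i x. (nconv P ^^ i) f x \<le> M * ennreal (\<pi> ^ i * (1 + real i) powr - s)"
  shows "(nconv (\<lambda>x. N x + P x) ^^ k) f x
    \<le> M * ennreal ((\<nu> + \<pi>) ^ k * (1 + \<pi> / (\<nu> + \<pi>) / (4 * s) * real k) powr - s)"
proof -
  define \<theta> where "\<theta> = \<pi> / (\<nu> + \<pi>)"
  define c where "c = \<theta> / (4 * s)"
  have \<theta>: "0 \<le> \<theta>" "\<theta> \<le> 1" using pos by (auto simp: \<theta>_def)
  have c: "0 \<le> c" using \<theta> s by (auto simp: c_def)
  \<comment> \<open>The second index i makes the induction on k work: an outer factor P commutes
    inside and raises i by one, while an outer factor N only multiplies by its mass.\<close>
  have *: "(nconv (\<lambda>x. N x + P x) ^^ k) ((nconv P ^^ i) f) x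
    \<le> M * ennreal (\<pi> ^ i * (\<nu> + \<pi>) ^ k * (1 + real i + c * real k) powr - s)" for i
  proof (induction k arbitrary: i x)
    case 0
    show ?case using P[of i x] by simp
  next
    case (Suc k)
    let ?g = "\<lambda>x. N x + P x" and ?\<phi> = "\<lambda>k i. (1 + real i + c * real k) powr - s"
    define F where "F = (nconv ?g ^^ k) ((nconv P ^^ i) f)"
    have [measurable]: "F \<in> borel_measurable borel" by (simp add: F_def)
    have "nconv P F x = (nconv ?g ^^ k) ((nconv P ^^ Suc i) f) x"
      unfolding F_def by (simp add: nconv_funpow_commute)
    also have "\<dots> \<le> M * ennreal (\<pi> ^ Suc i * (\<nu> + \<pi>) ^ k * ?\<phi> k (Suc i))"
      by (rule Suc)
    finally have P': "nconv P F x \<le> M * ennreal (\<pi> ^ Suc i * (\<nu> + \<pi>) ^ k * ?\<phi> k (Suc i))" .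
    have "nconv N F x \<le> (\<integral>\<^sup>+ x. N x \<partial>lborel) * (M * ennreal (\<pi> ^ i * (\<nu> + \<pi>) ^ k * ?\<phi> k i))"
      unfolding F_def by (intro nconv_bounded Suc) simp
    then have N': "nconv N F x \<le> M * ennreal (\<nu> * (\<pi> ^ i * (\<nu> + \<pi>) ^ k * ?\<phi> k i))"
      using pos by (simp add: N ennreal_mult' mult.left_commute)
    have "(nconv ?g ^^ Suc k) ((nconv P ^^ i) f) x = nconv N F x + nconv P F x"
      by (simp add: F_def[symmetric] nconv_add_left)
    also have "\<dots> \<le> M * ennreal (\<nu> * (\<pi> ^ i * (\<nu> + \<pi>) ^ k * ?\<phi> k i)) + M * ennreal (\<pi> ^ Suc i * (\<nu> + \<pi>) ^ k * ?\<phi> k (Suc i))"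
      by (intro add_mono N' P')
    also have "\<dots> = M * ennreal (\<pi> ^ i * (\<nu> + \<pi>) ^ k * (\<nu> * ?\<phi> k i + \<pi> * ?\<phi> k (Suc i)))"
      using pos by (simp add: distrib_left[symmetric] ennreal_plus[symmetric] algebra_simps del: ennreal_plus)
    also have "\<dots> \<le> M * ennreal (\<pi> ^ i * (\<nu> + \<pi>) ^ k * ((\<nu> + \<pi>) * ?\<phi> (Suc k) i))"
    proof (intro mult_left_mono ennreal_leI)
      have "(1 - \<theta>) * ?\<phi> k i + \<theta> * ?\<phi> k (Suc i) \<le> ?\<phi> (Suc k) i"
      proof -
        have "1 + real i + c * real k + 1 = 1 + real (Suc i) + c * real k"
          "1 + real i + c * real k + c = 1 + real i + c * real (Suc k)"
          by (simp_all add: algebra_simps)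
        moreover have "1 \<le> 1 + real i + c * real k" using c by simp
        ultimately show ?thesis
          using powr_neg_step[of "1 + real i + c * real k" s \<theta>, folded c_def] s \<theta> by (simp only:)
      qed
      then have "(\<nu> + \<pi>) * ((1 - \<theta>) * ?\<phi> k i + \<theta> * ?\<phi> k (Suc i)) \<le> (\<nu> + \<pi>) * ?\<phi> (Suc k) i"
        using pos by (intro mult_left_mono) auto
      moreover have "(\<nu> + \<pi>) * \<theta> = \<pi>" "(\<nu> + \<pi>) * (1 - \<theta>) = \<nu>" using pos by (auto simp: \<theta>_def field_simps)
      ultimately show "\<nu> * ?\<phi> k i + \<pi> * ?\<phi> k (Suc i) \<le> (\<nu> + \<pi>) * ?\<phi> (Suc k) i"
        by (simp add: distrib_left mult.assoc[symmetric])
    qed (use pos in auto)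
    finally show ?case by (simp add: mult_ac)
  qed
  show ?thesis using *[of 0] by (simp add: c_def \<theta>_def)
qed

text \<open>Outer regularity encloses T, of measure m, in an open U of measure at most 3m/2. For
  small z the translate T + z still lies in U, so T and T + z, of total measure 2m, must overlap in
  measure at least m/2.\<close>

lemma steinhaus_overlap:
  fixes T :: "'a::euclidean_space set"
  assumes T: "compact T" and pos: "0 < emeasure lborel T"
  obtains r \<kappa> :: real where "0 < r" "0 < \<kappa>"
    "\<And>z. norm z < r \<Longrightarrow> ennreal \<kappa> \<le> (\<integral>\<^sup>+ y. indicator T (y - z) * indicator T y \<partial>lborel)"
proof -
  have [measurable]: "T \<in> sets borel" using T by (simp add: borel_compact)
  have fin: "emeasure lborel T < \<infinity>" using emeasure_compact_finite[OF T] by simp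
  obtain m where m: "emeasure lborel T = ennreal m" "0 < m"
    using fin pos by (cases "emeasure lborel T") auto
  have "T \<in> sets lebesgue" "0 < m / 2" using m by auto
  then obtain U where U: "open U" "T \<subseteq> U" "emeasure lebesgue (U - T) < ennreal (m / 2)"
    by (rule sets_lebesgue_outer_open)
  have [measurable]: "U \<in> sets borel" using U by simp
  obtain r where r: "0 < r" "(\<Union>x\<in>T. ball x r) \<subseteq> U"
    using compact_subset_open_imp_ball_epsilon_subset[OF T \<open>open U\<close> \<open>T \<subseteq> U\<close>] by blast
  have Ule: "emeasure lborel U \<le> ennreal m + ennreal (m / 2)"
  proof -
    have "emeasure lborel U \<le> emeasure lborel T + emeasure lborel (U - T)"
    proof -
      have "U = T \<union> (U - T)" using U by auto
      then show ?thesis using emeasure_subadditive[of T lborel "U - T"] by simp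
    qed
    also have "emeasure lborel (U - T) \<le> ennreal (m / 2)" using U by simp
    finally show ?thesis by (simp add: m)
  qed
  have "ennreal (m / 2) \<le> (\<integral>\<^sup>+ y. indicator T (y - z) * indicator T y \<partial>lborel)" (is "_ \<le> ?I")
    if z: "norm z < r" for z
  proof -
    have sub: "y \<in> U" if "y - z \<in> T" for y
    proof -
      have "y \<in> ball (y - z) r" using z by (simp add: dist_norm)
      then show ?thesis using r that by blast
    qed
    have "ennreal m + ennreal m = (\<integral>\<^sup>+ y. indicator T (y - z) + indicator T y \<partial>lborel)"
      using nn_integral_lborel_translate[of "indicator T" z] by (subst nn_integral_add) (auto simp: m)
    also have "\<dots> \<le> (\<integral>\<^sup>+ y. indicator U y + indicator T (y - z) * indicator T y \<partial>lborel)"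
      using sub U by (intro nn_integral_mono) (auto simp: indicator_def)
    also have "\<dots> = emeasure lborel U + ?I" by (subst nn_integral_add) auto
    also have "\<dots> \<le> ennreal m + ennreal (m / 2) + ?I" by (intro add_right_mono Ule)
    finally have le: "ennreal m + ennreal m \<le> ennreal m + ennreal (m / 2) + ?I" .
    show ?thesis
    proof (cases "?I")
      case (real i)
      then show ?thesis using le m by (simp add: ennreal_plus[symmetric] del: ennreal_plus)
    qed simp
  qed
  then show ?thesis using that[of r "m / 2"] r m by auto
qed

text \<open>Some set \<open>E i\<close>, a superlevel set of j inside a ball, has positive measure,
  as otherwise j would vanish almost everywhere. Inner regularity supplies a compact T inside it,
  and evenness turns \<open>nconv j j z\<close> into an integral that dominates a multiple of the
  overlap of T and T + z.\<close>

lemma nconv_self_bounded_below: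
  fixes j :: "'a::euclidean_space \<Rightarrow> ennreal"
  assumes [measurable]: "j \<in> borel_measurable borel" and even: "\<And>x. j (- x) = j x"
    and pos: "(\<integral>\<^sup>+ x. j x \<partial>lborel) \<noteq> 0"
  obtains r \<kappa> :: real where "0 < r" "0 < \<kappa>" "\<And>z. norm z < r \<Longrightarrow> ennreal \<kappa> \<le> nconv j j z"
proof -
  define E where "E i = {x \<in> cball 0 (real i). ennreal (1 / Suc i) \<le> j x}" for i
  have [measurable]: "E i \<in> sets borel" for i unfolding E_def by measurable
  obtain i where i: "emeasure lborel (E i) \<noteq> 0"
  proof (rule ccontr)
    assume "\<not> thesis"
    then have "E i \<in> null_sets lborel" for i using that by (auto simp: null_sets_def)
    then have "AE x in lborel. \<forall>i. x \<notin> E i" by (intro AE_all_countable[THEN iffD2] allI AE_not_in)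
    then have "AE x in lborel. j x = 0"
    proof eventually_elim
      case (elim x)
      show ?case
      proof (rule ccontr)
        assume "j x \<noteq> 0"
        then obtain e where e: "0 < e" "ennreal e \<le> j x"
        proof (cases "j x")
          case (real r)
          then show ?thesis using that[of r] \<open>j x \<noteq> 0\<close> by (simp add: less_le)
        qed (auto intro: that[of 1])
        obtain k where k: "1 / Suc k < e" using nat_approx_posE[OF e(1)] by blast
        obtain l :: nat where l: "norm x \<le> real l" using real_arch_simple by blast
        have "ennreal (1 / Suc (max k l)) \<le> ennreal e"
        proof (rule ennreal_leI)
          have "1 / real (Suc (max k l)) \<le> 1 / real (Suc k)" by (intro divide_left_mono) auto
          then show "1 / real (Suc (max k l)) \<le> e" using k by linarith
        qed
        then have "ennreal (1 / Suc (max k l)) \<le> j x" by (rule order_trans) (rule e)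
        then have "x \<in> E (max k l)" using l by (auto simp: E_def)
        then show False using elim by blast
      qed
    qed
    then show False using pos by (simp add: nn_integral_0_iff_AE)
  qed
  define d where "d = ennreal (1 / Suc i)"
  obtain m where m: "0 < m" "ennreal m \<le> emeasure lborel (E i)"
  proof (cases "emeasure lborel (E i)")
    case (real r)
    then show ?thesis using that[of r] i by (simp add: less_le)
  qed (auto intro: that[of 1])
  have "E i \<in> sets lebesgue" by simp
  then obtain T where T: "closed T" "T \<subseteq> E i" "emeasure lebesgue (E i - T) < ennreal m"
    using m(1) by (rule sets_lebesgue_inner_closed)
  have "bounded (E i)" by (rule bounded_subset[of "cball 0 (real i)"]) (auto simp: E_def)
  then have "compact T" using T bounded_subset compact_eq_bounded_closed by blast
  have [measurable]: "T \<in> sets borel" using T by simp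
  have "emeasure lborel T \<noteq> 0"
  proof
    assume "emeasure lborel T = 0"
    then have "emeasure lborel (E i) = emeasure lborel (E i - T)"
      by (subst emeasure_Diff_null_set) (auto simp: null_sets_def)
    then show False using T m by simp
  qed
  then have "0 < emeasure lborel T" by (simp add: zero_less_iff_neq_zero)
  then obtain r \<kappa> :: real where r: "0 < r" "0 < \<kappa>"
    "\<And>z. norm z < r \<Longrightarrow> ennreal \<kappa> \<le> (\<integral>\<^sup>+ y. indicator T (y - z) * indicator T y \<partial>lborel)"
    using steinhaus_overlap[OF \<open>compact T\<close>] by blast
  have d: "d * indicator T y \<le> j y" for y using T by (auto simp: d_def E_def indicator_def)
  have "ennreal ((1 / Suc i)\<^sup>2 * \<kappa>) \<le> nconv j j z" if "norm z < r" for z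
  proof -
    have "ennreal ((1 / Suc i)\<^sup>2 * \<kappa>) = d * d * ennreal \<kappa>"
      using r by (simp add: d_def ennreal_mult[symmetric] power2_eq_square)
    also have "\<dots> \<le> d * d * (\<integral>\<^sup>+ y. indicator T (y - z) * indicator T y \<partial>lborel)"
      by (intro mult_left_mono r that) auto
    also have "\<dots> = (\<integral>\<^sup>+ y. (d * indicator T (y - z)) * (d * indicator T y) \<partial>lborel)"
      by (subst nn_integral_cmult[symmetric]) (auto simp: mult_ac)
    also have "\<dots> \<le> (\<integral>\<^sup>+ y. j (y - z) * j y \<partial>lborel)"
      by (intro nn_integral_mono mult_mono d) auto
    also have "\<dots> = nconv j j z"
      using even[of "y - z" for y] by (simp add: nconv_def)
    finally show ?thesis .
  qed
  then show ?thesis using that[of r "(1 / Suc i)\<^sup>2 * \<kappa>"] r by auto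
qed

section \<open>Support, size and mass of the cube products\<close>

lemma pair_sum_eq_0:
  assumes "\<And>x. r < norm x \<Longrightarrow> f x = 0" "r + (\<Sum>v\<leftarrow>vs. norm v) < norm x"
  shows "pair_sum vs f x = 0"
  using assms(2)
proof (induction vs arbitrary: x)
  case (Cons v vs)
  have "0 \<le> norm v" "norm x \<le> norm (x - v) + norm v"
    using norm_triangle_ineq[of "x - v" v] by auto
  then have "r + (\<Sum>v\<leftarrow>vs. norm v) < norm x" "r + (\<Sum>v\<leftarrow>vs. norm v) < norm (x - v)"
    using Cons.prems by (auto simp del: norm_ge_zero)
  then show ?case using Cons.IH by simp
qed (use assms in simp)

lemma pair_sum_le: "(\<And>x. f x \<le> c) \<Longrightarrow> pair_sum vs f x \<le> 2 ^ length vs * c"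
proof (induction vs arbitrary: x)
  case (Cons v vs)
  have "pair_sum (v # vs) f x \<le> 2 ^ length vs * c + 2 ^ length vs * c"
    using Cons by (auto intro!: add_mono)
  then show ?case by (simp add: mult_2[symmetric] mult.assoc)
qed simp

lemma nn_integral_pair_sum:
  fixes f :: "'a::euclidean_space \<Rightarrow> ennreal"
  assumes [measurable]: "f \<in> borel_measurable borel"
  shows "(\<integral>\<^sup>+ x. pair_sum vs f x \<partial>lborel) = 2 ^ length vs * (\<integral>\<^sup>+ x. f x \<partial>lborel)"
  by (induction vs)
     (simp_all add: nn_integral_add nn_integral_lborel_translate mult_2[symmetric] mult.assoc)

lemma norm_corner_cube: "x \<in> corner_cube h \<Longrightarrow> norm (x :: real ^ 'n) \<le> real CARD('n) * h"
proof -
  assume x: "x \<in> corner_cube h"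
  have "norm x \<le> (\<Sum>i\<in>UNIV. \<bar>x $ i\<bar>)" by (rule norm_le_l1_cart)
  also have "\<dots> \<le> (\<Sum>i\<in>(UNIV :: 'n set). h)"
    using x by (intro sum_mono) (auto simp: corner_cube_def less_imp_le)
  finally show ?thesis by simp
qed

lemma emeasure_corner_cube:
  assumes "0 < h"
  obtains a where "0 < a" "emeasure lborel (corner_cube h :: (real ^ 'n) set) = ennreal a"
proof -
  let ?C = "corner_cube h :: (real ^ 'n) set"
  have "?C \<subseteq> cball 0 (real CARD('n) * h)" using norm_corner_cube by auto
  then have "emeasure lborel ?C \<le> emeasure lborel (cball (0 :: real ^ 'n) (real CARD('n) * h))"
    by (intro emeasure_mono) auto
  also have "\<dots> < \<infinity>" using emeasure_compact_finite[OF compact_cball] by simp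
  finally have fin: "emeasure lborel ?C < \<infinity>" .
  let ?B = "box (0 :: real ^ 'n) (\<chi> i. h)"
  have "emeasure lborel ?B = ennreal (\<Prod>b\<in>Basis. ((\<chi> i. h) - 0 :: real ^ 'n) \<bullet> b)"
    using assms by (intro emeasure_lborel_box) (auto simp: Basis_vec_def inner_axis)
  also have "\<dots> > 0"
    using assms by (auto simp: Basis_vec_def inner_axis intro!: prod_pos)
  finally have "0 < emeasure lborel ?B" .
  also have "\<dots> \<le> emeasure lborel ?C"
    by (intro emeasure_mono) (auto simp: corner_cube_def mem_box_cart less_imp_le)
  finally have "0 < emeasure lborel ?C" .
  with fin show ?thesis
    by (cases "emeasure lborel ?C") (auto intro: that)
qed

lemma japanese_bracket_ge_1: "1 \<le> japanese_bracket x"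
  by (simp add: japanese_bracket_def)

text \<open>\<open>j_finite\<close> is required at every point because limits are taken in the
  factor f of j(z) f(x - z), and multiplication by \<infinity> is not continuous on
  [0, \<infinity>].\<close>

locale dispersal_kernel =
  fixes j :: "real ^ 'n \<Rightarrow> ennreal"
  assumes j_measurable [measurable]: "j \<in> borel_measurable borel"
    and j_even: "j (- x) = j x"
    and j_finite: "j x < \<infinity>"
    and j_nonzero: "(\<integral>\<^sup>+ x. j x \<partial>lborel) \<noteq> 0"
    and j_moment: "(\<integral>\<^sup>+ x. j x * ennreal (japanese_bracket x powr b) \<partial>lborel) < \<infinity>"
begin

definition mass :: real where "mass = enn2real (\<integral>\<^sup>+ x. j x \<partial>lborel)"

lemma mass: "(\<integral>\<^sup>+ x. j x \<partial>lborel) = ennreal mass" and mass_pos: "0 < mass"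
proof -
  have "japanese_bracket x \<noteq> 0" for x :: "real ^ 'n"
    using japanese_bracket_ge_1[of x] by simp
  then have "(\<integral>\<^sup>+ x. j x \<partial>lborel) < \<infinity>"
    using j_moment[of 0] by simp
  with j_nonzero show "(\<integral>\<^sup>+ x. j x \<partial>lborel) = ennreal mass" "0 < mass"
    unfolding mass_def by (cases "\<integral>\<^sup>+ x. j x \<partial>lborel"; auto simp: less_le)+
qed

text \<open>Even powers of j are powers of j * j = N + P with P of cube type, and an odd power costs
  one more factor \<open>mass\<close>. M bounds both the supremum and the integral of f: the former
  serves the power 0, where nothing has been smoothed yet, the latter all positive powers of
  P.\<close>

lemma funpow_decay:
  obtains C :: real where "0 < C"
    "\<And>f M k x. f \<in> borel_measurable borel \<Longrightarrow> (\<And>x. f x \<le> M) \<Longrightarrow> (\<integral>\<^sup>+ x. f x \<partial>lborel) \<le> M \<Longrightarrow>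
      (nconv j ^^ k) f x \<le> M * ennreal (C * mass ^ k * (1 + real k) powr - (real CARD('n) / 2))"
proof -
  define n where "n = CARD('n)"
  define s where "s = real n / 2"
  have n: "1 \<le> real n" by (simp add: n_def Suc_le_eq)
  then have s: "1 / 2 \<le> s" by (simp add: s_def)
  obtain r \<kappa> where r: "0 < r" "0 < \<kappa>" and low: "\<And>z. norm z < r \<Longrightarrow> ennreal \<kappa> \<le> nconv j j z"
    using nconv_self_bounded_below[OF j_measurable j_even j_nonzero] by blast
  obtain "is" :: "'n list" where is_list: "distinct is" "set is = UNIV"
    using finite_distinct_list[of "UNIV :: 'n set"] by auto
  then have len: "length is = n" unfolding n_def by (metis distinct_card)
  \<comment> \<open>A point of the cube has norm at most n h and the n translation vectors have
    total length n h, so g vanishes outside a ball of radius r/2, well inside the region where j * j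
    is at least \<kappa>.\<close>
  define h where "h = r / (4 * real n)"
  have h: "0 < h" "real n * h + real n * h < r" using r n by (auto simp: h_def)
  define vs :: "(real ^ 'n) list" where "vs = map (\<lambda>i. h *\<^sub>R axis i 1) is"
  define q :: "real ^ 'n \<Rightarrow> ennreal" where "q = indicator (corner_cube h)"
  have [measurable]: "q \<in> borel_measurable borel" by (simp add: q_def)
  define g where "g = pair_sum vs q"
  have [measurable]: "g \<in> borel_measurable borel" by (simp add: g_def)
  obtain a where a: "0 < a" "(\<integral>\<^sup>+ x. q x \<partial>lborel) = ennreal a"
    using emeasure_corner_cube[OF h(1)] unfolding q_def by (metis nn_integral_indicator corner_cube_measurable sets_lborel)
  have lenvs: "length vs = n" by (simp add: vs_def len)
  have "q x \<le> 1" for x by (simp add: q_def indicator_def)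
  then have g_le: "g x \<le> 2 ^ n" for x
    using pair_sum_le[of q 1 vs x] by (simp add: g_def lenvs)
  have norm_vs: "(\<Sum>v\<leftarrow>vs. norm v) = real n * h"
    using h by (simp add: vs_def len[symmetric] comp_def sum_list_triv)
  have g_0: "g x = 0" if "r \<le> norm x" for x
    unfolding g_def
  proof (rule pair_sum_eq_0)
    show "q y = 0" if "real n * h < norm y" for y
      using norm_corner_cube[of y h] that by (auto simp: q_def n_def indicator_def)
    show "real n * h + (\<Sum>v\<leftarrow>vs. norm v) < norm x"
      using norm_vs h that by linarith
  qed
  have ray: "ray_sum vs q x \<le> 1" for x
    using ray_sum_corner_cube[OF h(1) is_list(1), of x] by (simp add: vs_def q_def indicator_def)
  have two: "(2 :: ennreal) ^ n = ennreal (2 ^ n)"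
    by (simp add: ennreal_power flip: ennreal_numeral)
  \<comment> \<open>g adds up 2^n translates of an indicator, so e g <= \<kappa>.\<close>
  define e where "e = \<kappa> / 2 ^ n"
  have e: "0 < e" using r by (simp add: e_def)
  define P where "P x = ennreal e * g x" for x
  have [measurable]: "P \<in> borel_measurable borel" unfolding P_def by measurable
  have P_le: "P x \<le> nconv j j x" for x
  proof (cases "norm x < r")
    case True
    have "P x \<le> ennreal e * 2 ^ n" unfolding P_def by (intro mult_left_mono g_le) auto
    also have "\<dots> = ennreal \<kappa>"
      using e by (simp add: two ennreal_mult'[symmetric] e_def)
    finally show ?thesis using low[OF True] by (rule order_trans)
  qed (simp add: P_def g_0)
  define N where "N x = nconv j j x - P x" for x
  have [measurable]: "N \<in> borel_measurable borel" unfolding N_def by measurable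
  have NP: "N x + P x = nconv j j x" for x
    unfolding N_def by (rule diff_add_cancel_ennreal[OF P_le])
  define \<rho> where "\<rho> = e * (2 ^ n * a)"
  have \<rho>: "0 < \<rho>" using e a by (simp add: \<rho>_def)
  have intP: "(\<integral>\<^sup>+ x. P x \<partial>lborel) = ennreal \<rho>"
    unfolding P_def using e a
    by (simp add: nn_integral_cmult g_def nn_integral_pair_sum lenvs \<rho>_def ennreal_mult' two)
  have "(\<integral>\<^sup>+ x. N x \<partial>lborel) + (\<integral>\<^sup>+ x. P x \<partial>lborel) = (\<integral>\<^sup>+ x. nconv j j x \<partial>lborel)"
    by (subst nn_integral_add[symmetric]) (auto simp: NP)
  also have "\<dots> = ennreal (mass\<^sup>2)"
    using mass_pos by (simp add: nn_integral_nconv mass ennreal_mult' power2_eq_square)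
  finally have sum: "(\<integral>\<^sup>+ x. N x \<partial>lborel) + ennreal \<rho> = ennreal (mass\<^sup>2)" by (simp add: intP)
  define \<nu> where "\<nu> = mass\<^sup>2 - \<rho>"
  have intN: "(\<integral>\<^sup>+ x. N x \<partial>lborel) = ennreal \<nu>" and \<nu>: "0 \<le> \<nu>"
    using sum \<rho> by (cases "\<integral>\<^sup>+ x. N x \<partial>lborel"; auto simp: \<nu>_def ennreal_plus[symmetric] simp del: ennreal_plus)+
  have \<nu>\<rho>: "\<nu> + \<rho> = mass\<^sup>2" by (simp add: \<nu>_def)
  define c where "c = \<rho> / (\<nu> + \<rho>) / (4 * s)"
  \<comment> \<open>The entry 1 serves the power 0. The entry 1/a serves the powers i >= 1, where
    the estimate yields only i - 1 of the i factors a that \<rho>^i contains.\<close>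
  define D where "D = max 1 (1 / a)"
  have D: "1 \<le> D" "1 / a \<le> D" by (auto simp: D_def)
  have c: "0 < c" "c \<le> 1"
  proof -
    show "0 < c" using \<rho> \<nu> s by (simp add: c_def)
    have "\<rho> / (\<nu> + \<rho>) \<le> 1" using \<rho> \<nu> by simp
    then have "\<rho> / (\<nu> + \<rho>) \<le> 4 * s" using s by linarith
    then show "c \<le> 1" unfolding c_def using s by (subst pos_divide_le_eq) auto
  qed
  show thesis
  proof (rule that)
    show "0 < D * (c / 2) powr - s" using c D by simp
    fix f :: "real ^ 'n \<Rightarrow> ennreal" and M k and x :: "real ^ 'n"
    assume [measurable]: "f \<in> borel_measurable borel" and f: "\<And>x. f x \<le> M" "(\<integral>\<^sup>+ x. f x \<partial>lborel) \<le> M"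
    have powP: "(nconv P ^^ i) f = (\<lambda>x. ennreal e ^ i * (nconv g ^^ i) f x)" for i
    proof (induction i)
      case (Suc i)
      have "nconv P F = (\<lambda>x. ennreal e * nconv g F x)" if "F \<in> borel_measurable borel" for F
        using that unfolding P_def by (intro ext nconv_cmult_left) auto
      then show ?case using Suc by (simp add: nconv_cmult mult.assoc)
    qed simp
    have P_pow: "(nconv P ^^ i) f x \<le> (M * ennreal D) * ennreal (\<rho> ^ i * (1 + real i) powr - s)" for i x
    proof (cases i)
      case 0
      have "M * 1 \<le> M * ennreal D" using D by (intro mult_left_mono) auto
      then show ?thesis using 0 f(1)[of x] by simp
    next
      case (Suc l)
      have "(nconv P ^^ i) f x \<le> ennreal e ^ i * (ennreal (2 ^ i / sqrt (real l + 2)) ^ n * ((\<integral>\<^sup>+ x. q x \<partial>lborel) ^ l * (\<integral>\<^sup>+ x. f x \<partial>lborel)))"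
        using nconv_pair_sum_funpow_le[of q f vs l x] ray
        unfolding powP Suc g_def by (intro mult_left_mono) (simp_all add: lenvs del: funpow.simps)
      also have "\<dots> \<le> ennreal e ^ i * (ennreal (2 ^ i / sqrt (real l + 2)) ^ n * (ennreal a ^ l * M))"
        unfolding a(2) using f by (intro mult_left_mono) auto
      also have "\<dots> = M * ennreal (e ^ i * (2 ^ i / sqrt (real l + 2)) ^ n * a ^ l)"
        using e a by (simp add: ennreal_power ennreal_mult mult_ac)
      also have "e ^ i * (2 ^ i / sqrt (real l + 2)) ^ n * a ^ l = 1 / a * (\<rho> ^ i * (1 + real i) powr - s)"
      proof -
        have "(1 + real i) powr - s = 1 / sqrt (real l + 2) ^ n"
        proof -
          have "sqrt (real l + 2) ^ n = ((real l + 2) powr (1 / 2)) powr real n"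
            by (simp add: powr_half_sqrt powr_realpow)
          also have "\<dots> = (real l + 2) powr s" by (simp only: powr_powr s_def) simp
          moreover have "1 + real i = real l + 2" using Suc by simp
          ultimately show ?thesis by (simp only: powr_minus inverse_eq_divide)
        qed
        moreover have "(2 ^ i) ^ n = ((2 ^ n) ^ i :: real)" by (simp add: power_mult[symmetric] mult.commute)
        ultimately show ?thesis
          using a by (simp add: \<rho>_def power_mult_distrib power_divide Suc)
      qed
      also have "M * ennreal (1 / a * (\<rho> ^ i * (1 + real i) powr - s)) \<le> M * ennreal (D * (\<rho> ^ i * (1 + real i) powr - s))"
        using D \<rho> by (intro mult_left_mono ennreal_leI mult_right_mono) auto
      finally show ?thesis using D by (simp add: ennreal_mult' mult.assoc)
    qed
    have even: "(nconv j ^^ (2 * l)) f x \<le> M * ennreal (D * mass ^ (2 * l) * (1 + c * real l) powr - s)" for l x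
    proof -
      have "(nconv j ^^ (2 * l)) f = (nconv (\<lambda>x. N x + P x) ^^ l) f"
        unfolding NP by (induction l) (simp_all add: nconv_assoc)
      then have "(nconv j ^^ (2 * l)) f x \<le> (M * ennreal D) * ennreal ((\<nu> + \<rho>) ^ l * (1 + c * real l) powr - s)"
        using nconv_funpow_decay[OF _ _ _ intN \<nu> \<rho> s P_pow, of l x] by (simp add: c_def)
      then show ?thesis
        using D by (simp add: \<nu>\<rho> power_mult ennreal_mult' mult.assoc)
    qed
    \<comment> \<open>Both parities at once: for k <= 2l + 1 one has c (1 + k) / 2 <= c l + c, and c
      <= 1.\<close>
    have cmp: "(1 + c * real l) powr - s \<le> (c / 2) powr - s * (1 + real k) powr - s" if "k \<le> 2 * l + 1" for l
    proof -
      have "(1 + c * real l) powr - s \<le> (c / 2 * (1 + real k)) powr - s"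
      proof (rule powr_mono2')
        have "c / 2 * (1 + real k) \<le> c / 2 * (1 + real (2 * l + 1))"
          using that c by (intro mult_left_mono add_left_mono of_nat_mono) auto
        then show "c / 2 * (1 + real k) \<le> 1 + c * real l"
          using c by (simp add: algebra_simps)
      qed (use s c in auto)
      also have "\<dots> = (c / 2) powr - s * (1 + real k) powr - s" by (rule powr_mult)
      finally show ?thesis .
    qed
    have "(nconv j ^^ k) f x \<le> M * ennreal (D * mass ^ k * ((c / 2) powr - s * (1 + real k) powr - s))"
    proof (cases "even k")
      case True
      then obtain l where l: "k = 2 * l" by blast
      have "(nconv j ^^ k) f x \<le> M * ennreal (D * mass ^ k * (1 + c * real l) powr - s)"
        using even[of l x] l by simp
      also have "\<dots> \<le> M * ennreal (D * mass ^ k * ((c / 2) powr - s * (1 + real k) powr - s))"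
        using cmp[of l] l D mass_pos by (intro mult_left_mono ennreal_leI) auto
      finally show ?thesis .
    next
      case False
      then obtain l where l: "k = 2 * l + 1" by (rule oddE)
      have "(nconv j ^^ k) f x = nconv j ((nconv j ^^ (2 * l)) f) x" by (simp add: l)
      also have "\<dots> \<le> ennreal mass * (M * ennreal (D * mass ^ (2 * l) * (1 + c * real l) powr - s))"
        using nconv_bounded[OF j_measurable even] by (simp add: mass)
      also have "\<dots> = M * ennreal (D * mass ^ k * (1 + c * real l) powr - s)"
        using mass_pos D by (simp add: l ennreal_mult' mult_ac)
      also have "\<dots> \<le> M * ennreal (D * mass ^ k * ((c / 2) powr - s * (1 + real k) powr - s))"
        using cmp[of l] l D mass_pos by (intro mult_left_mono ennreal_leI) auto
      finally show ?thesis .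
    qed
    then show "(nconv j ^^ k) f x \<le> M * ennreal (D * (c / 2) powr - s * mass ^ k * (1 + real k) powr - (real CARD('n) / 2))"
      by (simp add: s_def n_def mult_ac)
  qed
qed

end

section \<open>The Green operator\<close>

lemma nconv_measurable_param [measurable (raw)]:
  fixes F :: "'w \<Rightarrow> 'a::euclidean_space \<Rightarrow> ennreal"
  assumes [measurable]: "g \<in> borel_measurable borel"
    "(\<lambda>(w, y). F w y) \<in> borel_measurable (M \<Otimes>\<^sub>M borel)"
  shows "(\<lambda>(w, x). nconv g (F w) x) \<in> borel_measurable (M \<Otimes>\<^sub>M borel)"
  unfolding nconv_def by measurable

lemma nconv_funpow_measurable_param:
  fixes F :: "'w \<Rightarrow> 'a::euclidean_space \<Rightarrow> ennreal"
  assumes [measurable]: "g \<in> borel_measurable borel"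
    "(\<lambda>(w, y). F w y) \<in> borel_measurable (M \<Otimes>\<^sub>M borel)"
  shows "(\<lambda>(w, x). (nconv g ^^ k) (F w) x) \<in> borel_measurable (M \<Otimes>\<^sub>M borel)"
proof (induction k)
  case (Suc k)
  show ?case using nconv_measurable_param[OF assms(1) Suc] by simp
qed (use assms in simp)

lemma suminf_ennreal_swap: "(\<Sum>i. \<Sum>j. F i j) = (\<Sum>j. \<Sum>i. F i j :: ennreal)" for F :: "nat \<Rightarrow> nat \<Rightarrow> ennreal"
  using nn_integral_suminf[of F "count_space UNIV"] by (simp add: nn_integral_count_space_nat)

lemma suminf_ennreal_diagonal:
  fixes F :: "nat \<Rightarrow> nat \<Rightarrow> ennreal"
  shows "(\<Sum>i. \<Sum>j. F i j) = (\<Sum>m. \<Sum>i\<le>m. F i (m - i))"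
proof -
  have "(\<Sum>j. F i j) = (\<Sum>m. if i \<le> m then F i (m - i) else 0)" for i
    by (subst suminf_offset[of _ i]) auto
  then have "(\<Sum>i. \<Sum>j. F i j) = (\<Sum>i. \<Sum>m. if i \<le> m then F i (m - i) else 0)"
    by simp
  also have "\<dots> = (\<Sum>m. \<Sum>i. if i \<le> m then F i (m - i) else 0)"
    by (rule suminf_ennreal_swap)
  also have "\<dots> = (\<Sum>m. \<Sum>i\<le>m. F i (m - i))"
    by (intro arg_cong[where f = suminf] ext, subst suminf_finite[of "{.._}"]) auto
  finally show ?thesis .
qed

lemma suminf_ennreal_exp:
  assumes "0 \<le> t"
  shows "(\<Sum>k. ennreal (t ^ k / fact k)) = ennreal (exp t)"
  using exp_converges[of t] assms
  by (intro suminf_ennreal_eq) (auto simp: divide_inverse mult.commute)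

definition weight :: "real \<Rightarrow> real ^ 'n \<Rightarrow> ennreal"
  where "weight b x = ennreal (japanese_bracket x powr b)"

lemma japanese_bracket_measurable [measurable]: "japanese_bracket \<in> borel_measurable borel"
  unfolding japanese_bracket_def by measurable

lemma weight_measurable [measurable]: "weight b \<in> borel_measurable borel"
  unfolding weight_def by measurable

lemma japanese_bracket_add: "japanese_bracket (x + y) \<le> sqrt 2 * japanese_bracket x * japanese_bracket y"
proof -
  have "(norm (x + y))\<^sup>2 \<le> (norm x + norm y)\<^sup>2"
    by (intro power_mono norm_triangle_ineq) auto
  also have "\<dots> \<le> 2 * (norm x)\<^sup>2 + 2 * (norm y)\<^sup>2"
    using sum_squares_bound[of "norm x" "norm y"] by (simp add: power2_sum)
  finally have "(norm (x + y))\<^sup>2 \<le> 2 * (norm x)\<^sup>2 + 2 * (norm y)\<^sup>2" .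
  then have "(norm (x + y))\<^sup>2 \<le> 2 * (norm x)\<^sup>2 + 2 * (norm y)\<^sup>2 + 2 * ((norm x)\<^sup>2 * (norm y)\<^sup>2)"
    by (rule order_trans) simp
  then have "1 + (norm (x + y))\<^sup>2 \<le> 2 * (1 + (norm x)\<^sup>2) * (1 + (norm y)\<^sup>2)"
  proof -
    have "2 * (1 + (norm x)\<^sup>2) * (1 + (norm y)\<^sup>2)
        = 2 + 2 * (norm x)\<^sup>2 + 2 * (norm y)\<^sup>2 + 2 * ((norm x)\<^sup>2 * (norm y)\<^sup>2)"
      by (simp add: algebra_simps)
    then show ?thesis
      using \<open>_ \<le> _ + 2 * (_ * _)\<close> by linarith
  qed
  then show ?thesis
    unfolding japanese_bracket_def real_sqrt_mult[symmetric] by (rule real_sqrt_le_mono)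
qed

text \<open>Peetre's inequality. For negative b it is the case |b| for the decomposition x = (x - z)
  + z, multiplied by the negative powers of both brackets.\<close>

lemma japanese_bracket_powr_diff:
  "japanese_bracket (x - z) powr b \<le> 2 powr (\<bar>b\<bar> / 2) * japanese_bracket x powr b * japanese_bracket z powr \<bar>b\<bar>"
proof -
  have pos: "0 < japanese_bracket y" for y :: "real ^ 'n"
    using japanese_bracket_ge_1[of y] by linarith
  have neg: "japanese_bracket (- z) = japanese_bracket z" by (simp add: japanese_bracket_def)
  have sq: "sqrt 2 powr r = 2 powr (r / 2)" for r by (simp add: powr_half_sqrt[symmetric] powr_powr)
  show ?thesis
  proof (cases "0 \<le> b")
    case True
    have "japanese_bracket (x - z) powr b \<le> (sqrt 2 * japanese_bracket x * japanese_bracket z) powr b"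
      using japanese_bracket_add[of x "- z"] True pos[of "x - z"] by (intro powr_mono2) (auto simp: neg)
    also have "\<dots> = 2 powr (\<bar>b\<bar> / 2) * japanese_bracket x powr b * japanese_bracket z powr \<bar>b\<bar>"
      using True pos by (simp add: powr_mult less_imp_le sq)
    finally show ?thesis .
  next
    case False
    have "japanese_bracket x powr \<bar>b\<bar> \<le> (sqrt 2 * japanese_bracket (x - z) * japanese_bracket z) powr \<bar>b\<bar>"
      using japanese_bracket_add[of "x - z" z] pos[of x] by (intro powr_mono2) auto
    also have "\<dots> = 2 powr (\<bar>b\<bar> / 2) * japanese_bracket (x - z) powr \<bar>b\<bar> * japanese_bracket z powr \<bar>b\<bar>"
      using pos by (simp add: powr_mult less_imp_le sq)
    finally have "japanese_bracket x powr \<bar>b\<bar> * (japanese_bracket x powr b * japanese_bracket (x - z) powr b)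
        \<le> 2 powr (\<bar>b\<bar> / 2) * japanese_bracket (x - z) powr \<bar>b\<bar> * japanese_bracket z powr \<bar>b\<bar>
          * (japanese_bracket x powr b * japanese_bracket (x - z) powr b)" (is "?l \<le> ?r")
      by (intro mult_right_mono) auto
    moreover have one: "japanese_bracket y powr \<bar>b\<bar> * japanese_bracket y powr b = 1" for y :: "real ^ 'n"
      using False pos[of y] by (simp add: powr_add[symmetric])
    have "?l = (japanese_bracket x powr \<bar>b\<bar> * japanese_bracket x powr b) * japanese_bracket (x - z) powr b"
      by (simp only: mult.assoc)
    moreover have "?r = 2 powr (\<bar>b\<bar> / 2) * japanese_bracket x powr b * japanese_bracket z powr \<bar>b\<bar>
        * (japanese_bracket (x - z) powr \<bar>b\<bar> * japanese_bracket (x - z) powr b)"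
      by (simp only: mult_ac)
    ultimately show ?thesis by (simp only: one mult_1_left mult_1_right)
  qed
qed

text \<open>Both factors on the left vanish to first order at p = q, so their product is quadratic
  there. The assumption 1 <= B permits the exponent m in place of m - 1.\<close>

lemma power_diff_mult_le:
  fixes p q B :: real
  assumes "0 \<le> p" "p \<le> B" "0 \<le> q" "q \<le> B" "1 \<le> B"
  shows "(p - q) * (p ^ m - q ^ m) \<le> real m * B ^ m * (p - q)\<^sup>2"
proof (induction m)
  case (Suc m)
  have "(p - q) * (p ^ Suc m - q ^ Suc m) = p * ((p - q) * (p ^ m - q ^ m)) + q ^ m * (p - q)\<^sup>2"
    by (simp add: algebra_simps power2_eq_square)
  also have "\<dots> \<le> B * (real m * B ^ m * (p - q)\<^sup>2) + B ^ Suc m * (p - q)\<^sup>2"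
  proof (intro add_mono mult_right_mono)
    have "p * ((p - q) * (p ^ m - q ^ m)) \<le> p * (real m * B ^ m * (p - q)\<^sup>2)"
      using Suc assms by (intro mult_left_mono) auto
    also have "\<dots> \<le> B * (real m * B ^ m * (p - q)\<^sup>2)"
      using assms by (intro mult_right_mono) auto
    finally show "p * ((p - q) * (p ^ m - q ^ m)) \<le> B * (real m * B ^ m * (p - q)\<^sup>2)" .
    have "q ^ m \<le> B ^ m" using assms by (intro power_mono) auto
    also have "\<dots> \<le> B ^ Suc m" using assms by (intro power_increasing) auto
    finally show "q ^ m \<le> B ^ Suc m" .
  qed auto
  finally show ?case by (simp add: algebra_simps)
qed simp

text \<open>The terms of first order in E cancel. In the recursion p^(m+1) + q^(m+1) = (A + D)(p^m +
  q^m) + E (p^m - q^m), with p and q = A + D plus and minus E, the last term is quadratic in E and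
  hence of order A D. The constant only has to satisfy the resulting recursion in m.\<close>

lemma second_difference_power:
  fixes A D E :: real
  assumes A: "1 \<le> A" and D: "0 \<le> D" and E: "E\<^sup>2 \<le> 4 * A * D"
  shows "(A + D + E) ^ m + (A + D - E) ^ m \<le> 2 * A ^ m + real (2 + 8 * m * 2 ^ m) * real m * D * (1 + D) ^ m * A ^ m"
proof (induction m)
  case (Suc m)
  define C where "C m = real (2 + 8 * m * 2 ^ m) * real m" for m
  define p q where "p = A + D + E" and "q = A + D - E"
  define B where "B = 2 * (A * (1 + D))"
  have AD: "A + D \<le> A * (1 + D)" using A D by (simp add: distrib_left mult_le_cancel_right1)
  have "(A + D)\<^sup>2 - E\<^sup>2 \<ge> (A - D)\<^sup>2" using E by (simp add: power2_eq_square algebra_simps)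
  then have "E\<^sup>2 \<le> (A + D)\<^sup>2" by (smt (verit) zero_le_power2)
  then have "\<bar>E\<bar> \<le> A + D" using A D by (simp add: abs_le_square_iff[symmetric])
  then have pq: "0 \<le> p" "p \<le> B" "0 \<le> q" "q \<le> B" using AD by (auto simp: p_def q_def B_def)
  have "1 * 1 \<le> A * (1 + D)" using A D by (intro mult_mono) auto
  then have B: "1 \<le> B" by (simp add: B_def)
  have E2: "(p - q)\<^sup>2 = 4 * E\<^sup>2" by (simp add: p_def q_def power2_eq_square)
  have half: "E * (p ^ m - q ^ m) = ((p - q) * (p ^ m - q ^ m)) / 2" by (simp add: p_def q_def)
  have cross: "E * (p ^ m - q ^ m) \<le> 8 * real m * 2 ^ m * D * (1 + D) ^ Suc m * A ^ Suc m"
  proof -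
    have "E * (p ^ m - q ^ m) \<le> (real m * B ^ m * (4 * E\<^sup>2)) / 2"
      unfolding half using power_diff_mult_le[OF pq B, of m] by (simp add: E2)
    also have "\<dots> \<le> (real m * B ^ m * (4 * (4 * A * D))) / 2"
      using E B by (intro divide_right_mono mult_left_mono) auto
    also have "\<dots> = 8 * real m * 2 ^ m * D * (1 + D) ^ m * A ^ Suc m"
      by (simp add: B_def power_mult_distrib)
    also have "\<dots> \<le> 8 * real m * 2 ^ m * D * (1 + D) ^ Suc m * A ^ Suc m"
      using A D by (intro mult_right_mono mult_left_mono power_increasing) auto
    finally show ?thesis .
  qed
  have "p ^ Suc m + q ^ Suc m = (A + D) * (p ^ m + q ^ m) + E * (p ^ m - q ^ m)"
    by (simp add: p_def q_def algebra_simps)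
  also have "\<dots> \<le> (A * (1 + D)) * (2 * A ^ m + C m * D * (1 + D) ^ m * A ^ m) + 8 * real m * 2 ^ m * D * (1 + D) ^ Suc m * A ^ Suc m"
  proof (rule add_mono[OF mult_mono cross])
    show "p ^ m + q ^ m \<le> 2 * A ^ m + C m * D * (1 + D) ^ m * A ^ m"
      using Suc by (simp add: C_def p_def q_def)
  qed (use AD A D pq in auto)
  also have "\<dots> = 2 * A ^ Suc m + 2 * D * A ^ Suc m + (C m + 8 * real m * 2 ^ m) * D * (1 + D) ^ Suc m * A ^ Suc m"
    by (simp add: algebra_simps)
  also have "\<dots> \<le> 2 * A ^ Suc m + 2 * D * (1 + D) ^ Suc m * A ^ Suc m + (C m + 8 * real m * 2 ^ m) * D * (1 + D) ^ Suc m * A ^ Suc m"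
  proof -
    have "1 \<le> (1 + D) ^ Suc m" using D by (intro one_le_power) auto
    then have "2 * D * A ^ Suc m * 1 \<le> 2 * D * A ^ Suc m * (1 + D) ^ Suc m"
      using A D by (intro mult_left_mono) auto
    then show ?thesis by (simp add: mult_ac)
  qed
  also have "\<dots> = 2 * A ^ Suc m + (2 + C m + 8 * real m * 2 ^ m) * D * (1 + D) ^ Suc m * A ^ Suc m"
    by (simp add: algebra_simps)
  also have "\<dots> \<le> 2 * A ^ Suc m + C (Suc m) * D * (1 + D) ^ Suc m * A ^ Suc m"
  proof (intro add_left_mono mult_right_mono)
    have "real m * 2 ^ m * real m \<le> real (Suc m) * 2 ^ Suc m * real m"
      by (intro mult_mono) auto
    then show "2 + C m + 8 * real m * 2 ^ m \<le> C (Suc m)"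
      by (simp add: C_def algebra_simps)
  qed (use A D in auto)
  finally show ?case by (simp add: p_def q_def C_def)
qed simp

section \<open>The semigroup on nonnegative functions: positivity, increments, duality\<close>

context dispersal_kernel
begin

definition green_op :: "real \<Rightarrow> (real ^ 'n \<Rightarrow> ennreal) \<Rightarrow> real ^ 'n \<Rightarrow> ennreal"
  where "green_op t f x = ennreal (exp (- mass * t)) * (\<Sum>k. ennreal (t ^ k / fact k) * (nconv j ^^ k) f x)"

lemma green_op_measurable_param:
  assumes [measurable]: "t \<in> borel_measurable M" "(\<lambda>(w, y). F w y) \<in> borel_measurable (M \<Otimes>\<^sub>M borel)"
  shows "(\<lambda>(w, x). green_op (t w) (F w) x) \<in> borel_measurable (M \<Otimes>\<^sub>M borel)"
proof -
  have [measurable]: "(\<lambda>w. (nconv j ^^ k) (F (fst w)) (snd w)) \<in> borel_measurable (M \<Otimes>\<^sub>M borel)" for k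
    using nconv_funpow_measurable_param[OF j_measurable assms(2), of k] by (simp add: case_prod_beta')
  show ?thesis unfolding green_op_def case_prod_beta' by measurable
qed

lemma green_op_measurable [measurable]: "f \<in> borel_measurable borel \<Longrightarrow> green_op t f \<in> borel_measurable borel"
  unfolding green_op_def by measurable

lemma green_op_mono: "(\<And>y. f y \<le> f' y) \<Longrightarrow> green_op t f x \<le> green_op t f' x"
  unfolding green_op_def by (intro mult_left_mono suminf_le nconv_funpow_mono) auto

lemma green_op_cmult: "f \<in> borel_measurable borel \<Longrightarrow> green_op t (\<lambda>x. c * f x) x = c * green_op t f x"
  unfolding green_op_def by (simp add: nconv_funpow_cmult mult.left_commute)

lemma green_op_add:
  "f \<in> borel_measurable borel \<Longrightarrow> f' \<in> borel_measurable borel \<Longrightarrow>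
    green_op t (\<lambda>x. f x + f' x) x = green_op t f x + green_op t f' x"
  unfolding green_op_def by (simp add: nconv_funpow_add distrib_left suminf_add[symmetric])

lemma nconv_funpow_eigen:
  assumes [measurable]: "V \<in> borel_measurable borel" and V: "\<And>y. nconv j V y \<le> ennreal \<beta> * V y"
  shows "(nconv j ^^ k) V x \<le> ennreal \<beta> ^ k * V x"
proof (induction k arbitrary: x)
  case (Suc k)
  have "(nconv j ^^ Suc k) V x \<le> nconv j (\<lambda>y. ennreal \<beta> ^ k * V y) x"
    unfolding funpow.simps comp_def by (intro nconv_mono Suc)
  also have "\<dots> = ennreal \<beta> ^ k * nconv j V x" by (simp add: nconv_cmult)
  also have "\<dots> \<le> ennreal \<beta> ^ k * (ennreal \<beta> * V x)" by (intro mult_left_mono V) auto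
  finally show ?case by (simp add: mult_ac)
qed simp

text \<open>An eigenvalue inequality for j passes to all powers of j, and the exponential series
  sums them. It is applied with V constant, a weight, or a radial moment.\<close>

lemma green_op_eigen:
  assumes V: "V \<in> borel_measurable borel" "\<And>y. nconv j V y \<le> ennreal \<beta> * V y" and t: "0 \<le> t" and \<beta>: "0 \<le> \<beta>"
  shows "green_op t V x \<le> ennreal (exp ((\<beta> - mass) * t)) * V x"
proof -
  have "(\<Sum>k. ennreal (t ^ k / fact k) * (nconv j ^^ k) V x) \<le> (\<Sum>k. ennreal (t ^ k / fact k) * (ennreal \<beta> ^ k * V x))"
    by (intro suminf_le mult_left_mono nconv_funpow_eigen V) auto
  also have "\<dots> = (\<Sum>k. ennreal ((\<beta> * t) ^ k / fact k) * V x)"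
  proof -
    have "ennreal (t ^ k / fact k) * ennreal \<beta> ^ k = ennreal ((\<beta> * t) ^ k / fact k)" for k
      using t \<beta> by (simp add: ennreal_power ennreal_mult'[symmetric] power_mult_distrib mult.commute)
    then show ?thesis by (simp only: mult.assoc[symmetric])
  qed
  also have "\<dots> = ennreal (exp (\<beta> * t)) * V x"
    using t \<beta> by (simp only: ennreal_suminf_multc suminf_ennreal_exp mult_nonneg_nonneg)
  finally have "green_op t V x \<le> ennreal (exp (- mass * t)) * (ennreal (exp (\<beta> * t)) * V x)"
    unfolding green_op_def by (intro mult_left_mono) auto
  also have "ennreal (exp (- mass * t)) * (ennreal (exp (\<beta> * t)) * V x)
      = ennreal (exp (- mass * t) * exp (\<beta> * t)) * V x"
    by (simp add: ennreal_mult mult.assoc)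
  also have "exp (- mass * t) * exp (\<beta> * t) = exp ((\<beta> - mass) * t)"
    by (simp add: exp_add[symmetric] algebra_simps)
  finally show ?thesis .
qed

lemma green_op_bounded:
  assumes "\<And>y. f y \<le> c" "0 \<le> t"
  shows "green_op t f x \<le> c"
proof -
  have "green_op t f x \<le> green_op t (\<lambda>_. c) x" by (intro green_op_mono assms)
  also have "\<dots> \<le> ennreal (exp ((mass - mass) * t)) * c"
    using assms mass_pos by (intro green_op_eigen) (auto simp: nconv_const mass)
  finally show ?thesis by simp
qed

text \<open>The term k = 0 alone: the mass that has not jumped up to time t.\<close>

lemma green_op_ge: "0 \<le> t \<Longrightarrow> ennreal (exp (- mass * t)) * f x \<le> green_op t f x"
  unfolding green_op_def
  using sum_le_suminf[of "\<lambda>k. ennreal (t ^ k / fact k) * (nconv j ^^ k) f x" "{0}"]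
  by (intro mult_left_mono) auto

text \<open>The double series is summed along antidiagonals, where the binomial theorem
  applies.\<close>

lemma green_op_semigroup:
  assumes [measurable]: "f \<in> borel_measurable borel" and "0 \<le> s" "0 \<le> t"
  shows "green_op s (green_op t f) x = green_op (s + t) f x"
proof -
  let ?K = "\<lambda>k. (nconv j ^^ k)" and ?e = "\<lambda>t. ennreal (exp (- mass * t))"
  have 1: "?K k (green_op t f) x = ?e t * (\<Sum>l. ennreal (t ^ l / fact l) * ?K (k + l) f x)" for k
    unfolding green_op_def
    by (subst nconv_funpow_cmult) (simp_all add: nconv_funpow_suminf nconv_funpow_cmult funpow_add)
  have "green_op s (green_op t f) x
      = ?e s * (\<Sum>k. ennreal (s ^ k / fact k) * (?e t * (\<Sum>l. ennreal (t ^ l / fact l) * ?K (k + l) f x)))"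
    unfolding green_op_def[of s] 1 ..
  also have "\<dots> = ?e s * ?e t * (\<Sum>k. \<Sum>l. ennreal (s ^ k / fact k) * ennreal (t ^ l / fact l) * ?K (k + l) f x)"
    by (simp only: ennreal_suminf_cmult[symmetric] mult_ac)
  also have "(\<Sum>k. \<Sum>l. ennreal (s ^ k / fact k) * ennreal (t ^ l / fact l) * ?K (k + l) f x)
      = (\<Sum>m. \<Sum>k\<le>m. ennreal (s ^ k / fact k) * ennreal (t ^ (m - k) / fact (m - k)) * ?K (k + (m - k)) f x)"
    by (rule suminf_ennreal_diagonal)
  also have "\<dots> = (\<Sum>m. ennreal ((s + t) ^ m / fact m) * ?K m f x)"
  proof (intro arg_cong[where f = suminf] ext)
    fix m
    have "(\<Sum>k\<le>m. ennreal (s ^ k / fact k) * ennreal (t ^ (m - k) / fact (m - k)) * ?K (k + (m - k)) f x)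
        = (\<Sum>k\<le>m. ennreal (s ^ k / fact k * (t ^ (m - k) / fact (m - k)))) * ?K m f x"
      unfolding sum_distrib_right
    proof (rule sum.cong)
      fix k assume "k \<in> {..m}"
      then have "k + (m - k) = m" by simp
      moreover have "ennreal (s ^ k / fact k) * ennreal (t ^ (m - k) / fact (m - k)) = ennreal (s ^ k / fact k * (t ^ (m - k) / fact (m - k)))"
        using assms by (intro ennreal_mult[symmetric]) auto
      ultimately show "ennreal (s ^ k / fact k) * ennreal (t ^ (m - k) / fact (m - k)) * ?K (k + (m - k)) f x
          = ennreal (s ^ k / fact k * (t ^ (m - k) / fact (m - k))) * ?K m f x"
        by simp
    qed simp
    also have "(\<Sum>k\<le>m. ennreal (s ^ k / fact k * (t ^ (m - k) / fact (m - k)))) = ennreal ((s + t) ^ m / fact m)"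
      using assms by (subst sum_ennreal)
        (auto simp: binomial_ring sum_divide_distrib binomial_fact field_simps intro!: arg_cong[where f = ennreal] sum.cong)
    finally show "(\<Sum>k\<le>m. ennreal (s ^ k / fact k) * ennreal (t ^ (m - k) / fact (m - k)) * ?K (k + (m - k)) f x)
        = ennreal ((s + t) ^ m / fact m) * ?K m f x" .
  qed
  also have "?e s * ?e t = ?e (s + t)"
    by (simp add: ennreal_mult'[symmetric] exp_add[symmetric] distrib_left)
  finally show ?thesis by (simp add: green_op_def[of "s + t"])
qed

text \<open>Every term after the first contains at least one jump. Shifting the index and using
  1/(k+1)! <= 1/k! extracts the factor t; \<open>exp (mass * t)\<close> undoes the normalisation of
  \<open>green_op\<close>. The additive form stands in for the difference
  \<open>green_op t f x - f x\<close>.\<close>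

lemma green_op_le_increment:
  assumes [measurable]: "f \<in> borel_measurable borel" and t: "0 \<le> t"
  shows "green_op t f x \<le> f x + ennreal (t * exp (mass * t)) * green_op t (nconv j f) x"
proof -
  let ?a = "\<lambda>k. ennreal (t ^ k / fact k) * (nconv j ^^ k) f x"
  let ?S = "\<Sum>k. ennreal (t ^ k / fact k) * (nconv j ^^ k) (nconv j f) x"
  have "(\<Sum>k. ?a k) = (\<Sum>k. ?a (k + 1)) + (\<Sum>k<1. ?a k)"
    by (rule suminf_offset) simp
  also have "(\<Sum>k. ?a (k + 1)) \<le> (\<Sum>k. ennreal t * (ennreal (t ^ k / fact k) * (nconv j ^^ k) (nconv j f) x))"
  proof (intro suminf_le)
    fix k
    have "ennreal (t ^ (k + 1) / fact (k + 1)) \<le> ennreal (t * (t ^ k / fact k))"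
      using t by (intro ennreal_leI) (auto intro!: divide_left_mono mult_nonneg_nonneg simp: fact_mono)
    also have "\<dots> = ennreal t * ennreal (t ^ k / fact k)"
      using t by (intro ennreal_mult) auto
    finally have "ennreal (t ^ (k + 1) / fact (k + 1)) * (nconv j ^^ k) (nconv j f) x
        \<le> ennreal t * ennreal (t ^ k / fact k) * (nconv j ^^ k) (nconv j f) x"
      by (rule mult_right_mono) simp
    moreover have "(nconv j ^^ (k + 1)) f = (nconv j ^^ k) (nconv j f)"
      by (simp add: funpow_swap1)
    ultimately show "?a (k + 1) \<le> ennreal t * (ennreal (t ^ k / fact k) * (nconv j ^^ k) (nconv j f) x)"
      by (simp only: mult.assoc)
  qed auto
  also have "\<dots> = ennreal t * ?S" by simp
  finally have "(\<Sum>k. ?a k) \<le> f x + ennreal t * ?S"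
    by (simp add: add.commute)
  moreover have "ennreal (exp (- mass * t)) \<le> 1"
    using t mass_pos by (simp add: mult_nonneg_nonneg)
  ultimately have "green_op t f x \<le> 1 * (f x + ennreal t * ?S)"
    unfolding green_op_def by (intro mult_mono) auto
  also have "?S = ennreal (exp (mass * t)) * green_op t (nconv j f) x"
    by (simp add: green_op_def mult.assoc[symmetric] ennreal_mult'[symmetric] exp_add[symmetric])
  finally show ?thesis using t by (simp add: ennreal_mult mult.assoc)
qed

lemma nn_integral_nconv_dual:
  assumes [measurable]: "V \<in> borel_measurable borel" "f \<in> borel_measurable borel"
  shows "(\<integral>\<^sup>+ x. V x * nconv j f x \<partial>lborel) = (\<integral>\<^sup>+ x. nconv j V x * f x \<partial>lborel)"
proof -
  have "(\<integral>\<^sup>+ x. V x * nconv j f x \<partial>lborel) = (\<integral>\<^sup>+ x. \<integral>\<^sup>+ y. V x * (j (x - y) * f y) \<partial>lborel \<partial>lborel)"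
    by (simp add: nconv_def nn_integral_cmult)
  also have "\<dots> = (\<integral>\<^sup>+ y. \<integral>\<^sup>+ x. V x * (j (x - y) * f y) \<partial>lborel \<partial>lborel)"
    by (rule lborel_pair.Fubini') measurable
  also have "\<dots> = (\<integral>\<^sup>+ y. (\<integral>\<^sup>+ x. j (y - x) * V x \<partial>lborel) * f y \<partial>lborel)"
  proof -
    have sym: "j (x - y) = j (y - x)" for x y using j_even[of "y - x"] by simp
    have "(\<integral>\<^sup>+ x. V x * (j (x - y) * f y) \<partial>lborel) = (\<integral>\<^sup>+ x. j (y - x) * V x \<partial>lborel) * f y" for y
      by (subst nn_integral_multc[symmetric]) (auto simp: mult_ac sym[of _ y])
    then show ?thesis by simp
  qed
  finally show ?thesis by (simp add: nconv_def)
qed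

text \<open>G(t) is symmetric because j is even. Weighted integral bounds for
  \<open>green_op t f\<close> thereby reduce to pointwise bounds for
  \<open>green_op t V\<close>.\<close>

lemma nn_integral_green_op_dual:
  assumes [measurable]: "V \<in> borel_measurable borel" "f \<in> borel_measurable borel"
  shows "(\<integral>\<^sup>+ x. V x * green_op t f x \<partial>lborel) = (\<integral>\<^sup>+ x. green_op t V x * f x \<partial>lborel)"
proof -
  have K: "(\<integral>\<^sup>+ x. V x * (nconv j ^^ k) f x \<partial>lborel) = (\<integral>\<^sup>+ x. (nconv j ^^ k) V x * f x \<partial>lborel)"
    if [measurable]: "V \<in> borel_measurable borel" "f \<in> borel_measurable borel" for k f V
    using that
  proof (induction k arbitrary: f V)
    case (Suc k)
    note [measurable] = Suc.prems
    show ?case by (simp add: nn_integral_nconv_dual Suc.IH funpow_swap1)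
  qed simp
  let ?c = "\<lambda>k. ennreal (exp (- mass * t)) * ennreal (t ^ k / fact k)"
  have "(\<integral>\<^sup>+ x. V x * green_op t f x \<partial>lborel) = (\<integral>\<^sup>+ x. (\<Sum>k. ?c k * (V x * (nconv j ^^ k) f x)) \<partial>lborel)"
    by (simp add: green_op_def mult_ac flip: ennreal_suminf_cmult)
  also have "\<dots> = (\<Sum>k. ?c k * (\<integral>\<^sup>+ x. V x * (nconv j ^^ k) f x \<partial>lborel))"
    by (subst nn_integral_suminf) (auto simp: nn_integral_cmult)
  also have "\<dots> = (\<integral>\<^sup>+ x. (\<Sum>k. ?c k * ((nconv j ^^ k) V x * f x)) \<partial>lborel)"
    by (subst nn_integral_suminf) (auto simp: nn_integral_cmult K)
  also have "\<dots> = (\<integral>\<^sup>+ x. green_op t V x * f x \<partial>lborel)"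
    by (simp add: green_op_def mult_ac flip: ennreal_suminf_cmult ennreal_suminf_multc)
  finally show ?thesis .
qed

text \<open>Peetre's inequality takes the weight out of the convolution at the price of the |b|-th
  moment of j. Both signs of b occur later: -b in sup estimates, b in integral estimates.\<close>

lemma weight_eigen:
  obtains \<beta> where "0 \<le> \<beta>" "\<And>x. nconv j (weight b) x \<le> ennreal \<beta> * weight b x"
proof -
  define c where "c = (\<integral>\<^sup>+ x. j x * ennreal (japanese_bracket x powr \<bar>b\<bar>) \<partial>lborel)"
  obtain c' where c': "0 \<le> c'" "c = ennreal c'"
    using j_moment[of "\<bar>b\<bar>"] by (cases c) (auto simp: c_def)
  have "nconv j (weight b) x \<le> ennreal (2 powr (\<bar>b\<bar> / 2) * c') * weight b x" for x
  proof -
    have "nconv j (weight b) x = nconv (weight b) j x" by (simp add: nconv_commute)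
    also have "\<dots> \<le> (\<integral>\<^sup>+ y. (ennreal (2 powr (\<bar>b\<bar> / 2)) * weight b x) * (j y * ennreal (japanese_bracket y powr \<bar>b\<bar>)) \<partial>lborel)"
      unfolding nconv_def
    proof (intro nn_integral_mono)
      fix y
      have "weight b (x - y) \<le> ennreal (2 powr (\<bar>b\<bar> / 2) * japanese_bracket x powr b * japanese_bracket y powr \<bar>b\<bar>)"
        unfolding weight_def by (intro ennreal_leI japanese_bracket_powr_diff)
      also have "\<dots> = ennreal (2 powr (\<bar>b\<bar> / 2)) * weight b x * ennreal (japanese_bracket y powr \<bar>b\<bar>)"
        by (simp add: weight_def ennreal_mult)
      finally show "weight b (x - y) * j y \<le> (ennreal (2 powr (\<bar>b\<bar> / 2)) * weight b x) * (j y * ennreal (japanese_bracket y powr \<bar>b\<bar>))"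
        by (metis (no_types, lifting) mult.commute mult.left_commute mult_right_mono zero_le)
    qed
    also have "\<dots> = (ennreal (2 powr (\<bar>b\<bar> / 2)) * weight b x) * c"
      by (subst nn_integral_cmult) (auto simp: c_def)
    finally show ?thesis using c' by (simp add: ennreal_mult mult_ac)
  qed
  then show ?thesis using c' by (intro that[of "2 powr (\<bar>b\<bar> / 2) * c'"]) auto
qed

end

section \<open>Weighted decay of the Green operator\<close>

text \<open>A polynomial in y of degree 2m that measures the distance from c on the scale R and
  equals 1 at c. Being a power of a quadratic polynomial, it has explicit second
  differences.\<close>

definition radial_moment :: "nat \<Rightarrow> real \<Rightarrow> real ^ 'n \<Rightarrow> real ^ 'n \<Rightarrow> ennreal"
  where "radial_moment m R c y = ennreal ((1 + (norm (y - c))\<^sup>2 / R\<^sup>2) ^ m)"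

lemma radial_moment_measurable [measurable]: "radial_moment m R c \<in> borel_measurable borel"
  unfolding radial_moment_def by measurable

text \<open>At x + z and x - z the base is A + D + E and A + D - E, with E the inner product term,
  and Cauchy-Schwarz gives E^2 <= 4 A D. The factor 1 / R^2 is that of D = |z|^2 / R^2; the
  remaining powers of 1 + D are absorbed by the weight in z, which uses 1 <= R.\<close>

lemma radial_moment_second_difference:
  assumes R: "1 \<le> R"
  shows "radial_moment m R c (x - z) + radial_moment m R c (x + z)
    \<le> 2 * radial_moment m R c x + ennreal (real (2 + 8 * m * 2 ^ m) * real m / R\<^sup>2) * weight (2 * real m + 2) z * radial_moment m R c x"
proof -
  define C where "C = real (2 + 8 * m * 2 ^ m) * real m"
  have C: "0 \<le> C" by (simp add: C_def)
  define A D E where "A = 1 + (norm (x - c))\<^sup>2 / R\<^sup>2" and "D = (norm z)\<^sup>2 / R\<^sup>2" and "E = 2 * ((x - c) \<bullet> z) / R\<^sup>2"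
  have A: "1 \<le> A" and D: "0 \<le> D" by (auto simp: A_def D_def)
  have plus: "1 + (norm (x + z - c))\<^sup>2 / R\<^sup>2 = A + D + E"
    using dot_norm[of "x - c" z] by (simp add: A_def D_def E_def add_divide_distrib[symmetric] algebra_simps)
  have minus: "1 + (norm (x - z - c))\<^sup>2 / R\<^sup>2 = A + D - E"
    using dot_norm_neg[of "x - c" z]
    by (simp add: A_def D_def E_def add_divide_distrib[symmetric] diff_divide_distrib[symmetric] algebra_simps)
  have "((x - c) \<bullet> z)\<^sup>2 \<le> (norm (x - c))\<^sup>2 * (norm z)\<^sup>2"
    using Cauchy_Schwarz_ineq[of "x - c" z] by (simp add: power2_norm_eq_inner)
  then have "E\<^sup>2 \<le> 4 * ((norm (x - c))\<^sup>2 / R\<^sup>2) * D"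
    using R by (simp add: E_def D_def power_divide power_mult_distrib divide_right_mono field_simps power2_eq_square)
  also have "\<dots> \<le> 4 * A * D"
    using D by (intro mult_right_mono) (auto simp: A_def)
  finally have E: "E\<^sup>2 \<le> 4 * A * D" .
  have "D * (1 + D) ^ m \<le> (japanese_bracket z powr (2 * real m + 2)) / R\<^sup>2"
  proof -
    have z: "D \<le> (norm z)\<^sup>2"
      using divide_left_mono[of 1 "R\<^sup>2" "(norm z)\<^sup>2"] one_le_power[OF R, of 2] R by (auto simp: D_def)
    have "D * (1 + D) ^ m \<le> (1 + (norm z)\<^sup>2) / R\<^sup>2 * (1 + (norm z)\<^sup>2) ^ m"
      using z D by (intro mult_mono power_mono) (auto simp: D_def divide_right_mono)
    also have "\<dots> = (1 + (norm z)\<^sup>2) ^ Suc m / R\<^sup>2" by simp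
    also have "1 + (norm z)\<^sup>2 = japanese_bracket z powr 2"
      by (simp add: japanese_bracket_def)
    also have "(japanese_bracket z powr 2) ^ Suc m = japanese_bracket z powr (2 * real m + 2)"
    proof -
      have "(japanese_bracket z powr 2) ^ Suc m = (japanese_bracket z powr 2) powr real (Suc m)"
        using japanese_bracket_ge_1[of z] by (intro powr_realpow[symmetric]) auto
      also have "\<dots> = japanese_bracket z powr (2 * real (Suc m))" by (rule powr_powr)
      also have "2 * real (Suc m) = 2 * real m + 2" by simp
      finally show ?thesis .
    qed
    finally show ?thesis .
  qed
  then have "C * (D * (1 + D) ^ m) * A ^ m \<le> C * ((japanese_bracket z powr (2 * real m + 2)) / R\<^sup>2) * A ^ m"
    using C A by (intro mult_right_mono mult_left_mono) auto
  then have "(A + D - E) ^ m + (A + D + E) ^ m \<le> 2 * A ^ m + C / R\<^sup>2 * japanese_bracket z powr (2 * real m + 2) * A ^ m"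
    using second_difference_power[OF A D E, of m] by (simp add: C_def mult_ac)
  moreover have "0 \<le> A + D - E" "0 \<le> A + D + E"
    by (auto simp: plus[symmetric] minus[symmetric] add_nonneg_nonneg)
  ultimately have "ennreal ((A + D - E) ^ m) + ennreal ((A + D + E) ^ m) \<le> ennreal (2 * A ^ m + C / R\<^sup>2 * japanese_bracket z powr (2 * real m + 2) * A ^ m)"
    by (subst ennreal_plus[symmetric]) (simp_all only: ennreal_leI zero_le_power)
  also have "\<dots> = 2 * ennreal (A ^ m) + ennreal (C / R\<^sup>2) * weight (2 * real m + 2) z * ennreal (A ^ m)"
  proof -
    have nonneg: "0 \<le> C / R\<^sup>2" "0 \<le> A ^ m" "0 \<le> japanese_bracket z powr (2 * real m + 2)"
      using A C by auto
    then have "ennreal (C / R\<^sup>2 * japanese_bracket z powr (2 * real m + 2) * A ^ m)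
        = ennreal (C / R\<^sup>2) * weight (2 * real m + 2) z * ennreal (A ^ m)"
      unfolding weight_def by (simp only: ennreal_mult mult_nonneg_nonneg)
    moreover have "ennreal (2 * A ^ m) = 2 * ennreal (A ^ m)"
      using nonneg by (simp add: ennreal_mult)
    moreover have "0 \<le> 2 * A ^ m" "0 \<le> C / R\<^sup>2 * japanese_bracket z powr (2 * real m + 2) * A ^ m"
      using nonneg by (simp_all only: mult_nonneg_nonneg zero_le_numeral)
    ultimately show ?thesis by (simp only: ennreal_plus)
  qed
  finally show ?thesis
    unfolding radial_moment_def plus minus by (simp add: A_def C_def)
qed

context dispersal_kernel
begin

text \<open>As \<open>j\<close> is even, the first order term of the increment cancels, which leaves the factor \<open>1 / R\<^sup>2\<close>.\<close>
lemma radial_moment_eigen: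
  obtains C where "0 \<le> C" "\<And>R c x. 1 \<le> R \<Longrightarrow>
    nconv j (radial_moment m R c) x \<le> ennreal (mass + C / R\<^sup>2) * radial_moment m R c x"
proof -
  obtain w where w: "0 \<le> w" "(\<integral>\<^sup>+ z. j z * weight (2 * real m + 2) z \<partial>lborel) = ennreal w"
    using j_moment[of "2 * real m + 2"] unfolding weight_def
    by (cases "\<integral>\<^sup>+ z. j z * ennreal (japanese_bracket z powr (2 * real m + 2)) \<partial>lborel") auto
  define C where "C = real (2 + 8 * m * 2 ^ m) * real m"
  have C: "0 \<le> C" by (simp add: C_def)
  have "nconv j (radial_moment m R c) x \<le> ennreal (mass + C * w / 2 / R\<^sup>2) * radial_moment m R c x"
    if R: "1 \<le> R" for R c x
  proof -
    let ?V = "radial_moment m R c"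
    have 1: "nconv j ?V x = (\<integral>\<^sup>+ z. j z * ?V (x - z) \<partial>lborel)"
      by (subst nconv_commute) (auto simp: nconv_def mult.commute)
    have 2: "nconv j ?V x = (\<integral>\<^sup>+ z. j z * ?V (x + z) \<partial>lborel)"
      unfolding 1 using nn_integral_lborel_reflect[of "\<lambda>z. j z * ?V (x - z)" 0] by (simp add: j_even)
    have "2 * nconv j ?V x = (\<integral>\<^sup>+ z. j z * ?V (x - z) \<partial>lborel) + (\<integral>\<^sup>+ z. j z * ?V (x + z) \<partial>lborel)"
      unfolding mult_2 by (metis 1 2)
    also have "\<dots> = (\<integral>\<^sup>+ z. j z * (?V (x - z) + ?V (x + z)) \<partial>lborel)"
      by (simp add: nn_integral_add distrib_left)
    also have "\<dots> \<le> (\<integral>\<^sup>+ z. j z * (2 * ?V x + ennreal (C / R\<^sup>2) * weight (2 * real m + 2) z * ?V x) \<partial>lborel)"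
      unfolding C_def by (intro nn_integral_mono mult_left_mono radial_moment_second_difference R) auto
    also have "\<dots> = (\<integral>\<^sup>+ z. (2 * ?V x) * j z + (ennreal (C / R\<^sup>2) * ?V x) * (j z * weight (2 * real m + 2) z) \<partial>lborel)"
      by (simp add: distrib_left mult_ac)
    also have "\<dots> = (2 * ?V x) * ennreal mass + (ennreal (C / R\<^sup>2) * ?V x) * ennreal w"
      by (subst nn_integral_add) (auto simp: nn_integral_cmult mass w)
    also have "\<dots> = ennreal (2 * (mass + C * w / 2 / R\<^sup>2)) * ?V x"
    proof -
      have "2 * (mass + C * w / 2 / R\<^sup>2) = 2 * mass + C / R\<^sup>2 * w" by (simp add: field_simps)
      moreover have "ennreal (2 * mass + C / R\<^sup>2 * w) = 2 * ennreal mass + ennreal (C / R\<^sup>2) * ennreal w"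
      proof -
        have "ennreal (C / R\<^sup>2 * w) = ennreal (C / R\<^sup>2) * ennreal w" "ennreal (2 * mass) = 2 * ennreal mass"
          using C w mass_pos ennreal_mult[of "C / R\<^sup>2" w] by (auto simp: ennreal_mult)
        then show ?thesis using mass_pos C w by (subst ennreal_plus) auto
      qed
      ultimately have "ennreal (2 * (mass + C * w / 2 / R\<^sup>2)) = 2 * ennreal mass + ennreal (C / R\<^sup>2) * ennreal w"
        by (simp only:)
      then show ?thesis by (simp only: distrib_right distrib_left mult_ac)
    qed
    also have "\<dots> = 2 * (ennreal (mass + C * w / 2 / R\<^sup>2) * ?V x)"
    proof -
      have "0 \<le> mass + C * w / 2 / R\<^sup>2" using mass_pos C w by simp
      then have "ennreal (2 * (mass + C * w / 2 / R\<^sup>2)) = 2 * ennreal (mass + C * w / 2 / R\<^sup>2)"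
        by (subst ennreal_mult) simp_all
      then show ?thesis by (simp only: mult.assoc)
    qed
    finally show ?thesis by - (subst (asm) ennreal_mult_le_mult_iff, simp_all)
  qed
  then show ?thesis using C w by (intro that[of "C * w / 2"]) auto
qed

text \<open>With R^2 = 1 + t the accumulated growth is exp (C t / (1 + t)), bounded in t, and the
  moment starts from the value 1 at its own centre.\<close>

lemma green_op_radial_moment:
  obtains C where "0 < C"
    "\<And>t x. 0 \<le> t \<Longrightarrow> green_op t (radial_moment m (sqrt (1 + t)) x) x \<le> ennreal C"
proof -
  obtain C where C: "0 \<le> C" "\<And>R c x. 1 \<le> R \<Longrightarrow>
    nconv j (radial_moment m R c) x \<le> ennreal (mass + C / R\<^sup>2) * radial_moment m R c x"
    using radial_moment_eigen by blast
  have "green_op t (radial_moment m (sqrt (1 + t)) x) x \<le> ennreal (exp C)" if t: "0 \<le> t" for t x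
  proof -
    have "green_op t (radial_moment m (sqrt (1 + t)) x) x
        \<le> ennreal (exp ((mass + C / (sqrt (1 + t))\<^sup>2 - mass) * t)) * radial_moment m (sqrt (1 + t)) x x"
    proof (rule green_op_eigen[OF radial_moment_measurable C(2) t])
      show "0 \<le> mass + C / (sqrt (1 + t))\<^sup>2" using C mass_pos by simp
    qed (use t in simp)
    also have "\<dots> = ennreal (exp (C / (1 + t) * t))"
      using t by (simp add: radial_moment_def)
    also have "\<dots> \<le> ennreal (exp C)"
    proof (intro ennreal_leI)
      have "C * t \<le> C * (1 + t)" using C t by (intro mult_left_mono) auto
      then show "exp (C / (1 + t) * t) \<le> exp C" using t by (simp add: field_simps)
    qed
    finally show ?thesis .
  qed
  then show ?thesis by (intro that[of "exp C"]) auto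
qed

text \<open>G(t) averages the normalised convolution powers over a Poisson number of jumps of mean
  \<open>mass * t\<close>, so the decay of the powers turns into a negative Poisson moment.\<close>

lemma green_op_decay:
  obtains C where "0 < C"
    "\<And>f M t x. f \<in> borel_measurable borel \<Longrightarrow> (\<And>x. f x \<le> M) \<Longrightarrow> (\<integral>\<^sup>+ x. f x \<partial>lborel) \<le> M \<Longrightarrow> 0 \<le> t \<Longrightarrow>
      green_op t f x \<le> M * ennreal (C * (1 + t) powr - (real CARD('n) / 2))"
proof -
  define s where "s = real CARD('n) / 2"
  have s: "0 \<le> s" by (simp add: s_def)
  obtain C1 where C1: "0 < C1" "\<And>f M k x. f \<in> borel_measurable borel \<Longrightarrow> (\<And>x. f x \<le> M) \<Longrightarrow> (\<integral>\<^sup>+ x. f x \<partial>lborel) \<le> M \<Longrightarrow>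
      (nconv j ^^ k) f x \<le> M * ennreal (C1 * mass ^ k * (1 + real k) powr - s)"
    using funpow_decay unfolding s_def by blast
  obtain C2 where C2: "0 < C2" "\<And>t :: real. 0 \<le> t \<Longrightarrow>
    (\<Sum>k. ennreal (t ^ k / fact k * (1 + real k) powr - s)) \<le> ennreal (C2 * exp t * (1 + t) powr - s)"
    using poisson_moment_neg[OF s] by blast
  \<comment> \<open>Compares the two time scales: a (1 + t) <= 1 + mass * t.\<close>
  define a where "a = min 1 mass"
  have a: "0 < a" "a \<le> 1" "a \<le> mass" using mass_pos by (auto simp: a_def)
  have "green_op t f x \<le> M * ennreal (C1 * C2 * a powr - s * (1 + t) powr - s)"
    if [measurable]: "f \<in> borel_measurable borel" and f: "\<And>x. f x \<le> M" "(\<integral>\<^sup>+ x. f x \<partial>lborel) \<le> M" and t: "0 \<le> t"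
    for f M t x
  proof -
    have "ennreal (t ^ k / fact k) * (nconv j ^^ k) f x
        \<le> (M * ennreal C1) * ennreal ((mass * t) ^ k / fact k * (1 + real k) powr - s)" for k
    proof -
      have "ennreal (t ^ k / fact k) * (nconv j ^^ k) f x
          \<le> ennreal (t ^ k / fact k) * (M * ennreal (C1 * mass ^ k * (1 + real k) powr - s))"
        by (intro mult_left_mono C1 f) auto
      also have "\<dots> = M * ennreal (t ^ k / fact k * (C1 * mass ^ k * (1 + real k) powr - s))"
        using t C1 mass_pos by (subst ennreal_mult) (auto simp: mult.left_commute)
      also have "t ^ k / fact k * (C1 * mass ^ k * (1 + real k) powr - s) = C1 * ((mass * t) ^ k / fact k * (1 + real k) powr - s)"
        by (simp add: power_mult_distrib)
      also have "M * ennreal \<dots> = (M * ennreal C1) * ennreal ((mass * t) ^ k / fact k * (1 + real k) powr - s)"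
        using t C1 mass_pos by (subst ennreal_mult) (auto simp: mult.assoc)
      finally show ?thesis .
    qed
    then have "(\<Sum>k. ennreal (t ^ k / fact k) * (nconv j ^^ k) f x)
        \<le> (\<Sum>k. (M * ennreal C1) * ennreal ((mass * t) ^ k / fact k * (1 + real k) powr - s))"
      by (intro suminf_le) auto
    also have "\<dots> = (M * ennreal C1) * (\<Sum>k. ennreal ((mass * t) ^ k / fact k * (1 + real k) powr - s))"
      by (rule ennreal_suminf_cmult)
    also have "\<dots> \<le> (M * ennreal C1) * ennreal (C2 * exp (mass * t) * (1 + mass * t) powr - s)"
      using t mass_pos by (intro mult_left_mono C2) auto
    finally have "green_op t f x \<le> ennreal (exp (- mass * t)) * ((M * ennreal C1) * ennreal (C2 * exp (mass * t) * (1 + mass * t) powr - s))"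
      unfolding green_op_def by (intro mult_left_mono) auto
    also have "\<dots> = M * ennreal (exp (- mass * t) * (C1 * (C2 * exp (mass * t) * (1 + mass * t) powr - s)))"
    proof -
      have "ennreal (exp (- mass * t) * (C1 * (C2 * exp (mass * t) * (1 + mass * t) powr - s)))
          = ennreal (exp (- mass * t)) * (ennreal C1 * ennreal (C2 * exp (mass * t) * (1 + mass * t) powr - s))"
        using C1 C2 by (simp only: ennreal_mult' exp_ge_zero less_imp_le)
      then show ?thesis by (simp only: mult_ac)
    qed
    also have "exp (- mass * t) * (C1 * (C2 * exp (mass * t) * (1 + mass * t) powr - s))
        = (exp (- mass * t) * exp (mass * t)) * (C1 * C2 * (1 + mass * t) powr - s)"
      by (simp only: mult_ac)
    also have "exp (- mass * t) * exp (mass * t) = 1"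
      by (simp add: exp_add[symmetric])
    also have "1 * (C1 * C2 * (1 + mass * t) powr - s) = C1 * C2 * (1 + mass * t) powr - s" by simp
    also have "M * ennreal (C1 * C2 * (1 + mass * t) powr - s) \<le> M * ennreal (C1 * C2 * (a powr - s * (1 + t) powr - s))"
    proof (intro mult_left_mono ennreal_leI)
      have "a * t \<le> mass * t" using a t by (intro mult_right_mono) auto
      then have "a * (1 + t) \<le> 1 + mass * t" unfolding distrib_left using a by linarith
      then have "(1 + mass * t) powr - s \<le> (a * (1 + t)) powr - s"
        using a t s by (intro powr_mono2') auto
      also have "\<dots> = a powr - s * (1 + t) powr - s" by (rule powr_mult)
      finally show "(1 + mass * t) powr - s \<le> a powr - s * (1 + t) powr - s" .
    qed (use C1 C2 in auto)
    finally show ?thesis by (simp add: mult.assoc)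
  qed
  then show ?thesis using that[of "C1 * C2 * a powr - s"] C1 C2 a unfolding s_def by simp
qed

end

text \<open>If |y| < |x|/2, then |y - x| >= |x|/2, so |x|^(2m) is at most 4^m R^(2m) times the
  moment. The leftover power b - 2m of |x| is nonpositive and may be evaluated at L; it produces a
  gain once L is large compared with R.\<close>

lemma weight_far_near:
  fixes x y :: "real ^ 'n"
  assumes b: "0 \<le> b" and R: "1 \<le> R" and L: "1 \<le> L" "L < norm x" and m: "b \<le> 2 * real m"
  shows "weight b x \<le> ennreal (2 powr b) * weight b y
    \<or> weight b x \<le> ennreal (2 powr (b / 2) * 4 ^ m * R ^ (2 * m) * L powr (b - 2 * real m)) * radial_moment m R x y"
proof (cases "norm x / 2 \<le> norm y")
  case True
  have "japanese_bracket x \<le> 2 * japanese_bracket y"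
  proof -
    have "(norm x)\<^sup>2 \<le> (2 * norm y)\<^sup>2" using True by (intro power_mono) auto
    then have "1 + (norm x)\<^sup>2 \<le> 4 * (1 + (norm y)\<^sup>2)" by (simp add: power_mult_distrib)
    then have "japanese_bracket x \<le> sqrt (4 * (1 + (norm y)\<^sup>2))"
      unfolding japanese_bracket_def by (rule real_sqrt_le_mono)
    also have "\<dots> = 2 * japanese_bracket y"
      unfolding japanese_bracket_def by (simp only: real_sqrt_mult real_sqrt_four)
    finally show ?thesis .
  qed
  then have "japanese_bracket x powr b \<le> (2 * japanese_bracket y) powr b"
    using b japanese_bracket_ge_1[of x] by (intro powr_mono2) auto
  also have "\<dots> = 2 powr b * japanese_bracket y powr b" by (rule powr_mult)
  finally show ?thesis by (simp add: weight_def ennreal_mult'[symmetric] ennreal_leI)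
next
  case False
  define X where "X = norm x"
  have X: "L < X" "1 < X" using L by (auto simp: X_def)
  have "norm x \<le> norm (y - x) + norm y" using norm_triangle_ineq[of "x - y" y] by (simp add: norm_minus_commute)
  then have "X / 2 \<le> norm (y - x)" using False by (simp add: X_def)
  then have "(X / 2)\<^sup>2 / R\<^sup>2 \<le> (norm (y - x))\<^sup>2 / R\<^sup>2"
    using X by (intro divide_right_mono power_mono) auto
  then have "((X / 2)\<^sup>2 / R\<^sup>2) ^ m \<le> (1 + (norm (y - x))\<^sup>2 / R\<^sup>2) ^ m"
    by (intro power_mono) auto
  moreover have "((X / 2)\<^sup>2 / R\<^sup>2) ^ m = X powr (2 * real m) / (4 ^ m * R ^ (2 * m))"
  proof -
    have "X powr (2 * real m) = X ^ (2 * m)"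
      using X powr_realpow[of X "2 * m"] by simp
    then show ?thesis by (simp add: power_divide power_mult power_mult_distrib)
  qed
  ultimately have V: "X powr (2 * real m) / (4 ^ m * R ^ (2 * m)) \<le> (1 + (norm (y - x))\<^sup>2 / R\<^sup>2) ^ m" (is "_ \<le> ?V")
    by simp
  have "japanese_bracket x powr b = (1 + X\<^sup>2) powr (b / 2)"
    by (simp add: japanese_bracket_def X_def powr_half_sqrt[symmetric] powr_powr add_nonneg_nonneg)
  also have "\<dots> \<le> (2 * X\<^sup>2) powr (b / 2)"
    using X b by (intro powr_mono2) (auto simp: one_le_power)
  also have "\<dots> = 2 powr (b / 2) * X powr b"
  proof -
    have "(X\<^sup>2) powr (b / 2) = X powr b"
      using X powr_powr[of X 2 "b / 2"] by simp
    then show ?thesis by (simp add: powr_mult)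
  qed
  also have "X powr b = X powr (b - 2 * real m) * X powr (2 * real m)"
    by (simp add: powr_add[symmetric])
  also have "\<dots> \<le> L powr (b - 2 * real m) * (4 ^ m * R ^ (2 * m) * ?V)"
  proof (intro mult_mono)
    show "X powr (b - 2 * real m) \<le> L powr (b - 2 * real m)"
      using X L m by (intro powr_mono2') auto
    show "X powr (2 * real m) \<le> 4 ^ m * R ^ (2 * m) * ?V"
      using V R by (simp add: field_simps)
  qed auto
  finally have "japanese_bracket x powr b \<le> (2 powr (b / 2) * 4 ^ m * R ^ (2 * m) * L powr (b - 2 * real m)) * ?V"
    by (simp add: mult_ac)
  then have "weight b x \<le> ennreal (2 powr (b / 2) * 4 ^ m * R ^ (2 * m) * L powr (b - 2 * real m)) * radial_moment m R x y"
    using R unfolding weight_def radial_moment_def by (subst ennreal_mult[symmetric]) (auto intro: ennreal_leI)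
  then show ?thesis ..
qed

context dispersal_kernel
begin

text \<open>On the diffusive scale the sup decay absorbs the weight; beyond it either \<open>y\<close> is as far out
  as \<open>x\<close>, so the weight moves onto \<open>f\<close>, or the jump from \<open>y\<close> to \<open>x\<close> is long and is controlled by a high moment.\<close>
lemma weighted_green_op_decay:
  assumes b: "0 \<le> b" and \<theta>: "0 \<le> \<theta>" "\<theta> < (real CARD('n) - b) / 2"
  obtains C where "0 < C"
    "\<And>f M t x. f \<in> borel_measurable borel \<Longrightarrow> (\<And>x. weight b x * f x \<le> M) \<Longrightarrow>
      (\<integral>\<^sup>+ x. weight b x * f x \<partial>lborel) \<le> M \<Longrightarrow> 0 \<le> t \<Longrightarrow>
      weight b x * green_op t f x \<le> M * ennreal (C * (1 + t) powr - \<theta>)"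
proof -
  define n where "n = real CARD('n)"
  \<comment> \<open>On |x| <= (1 + t)^(1/2 + \<eta>) the weight costs (1 + t)^(b/2 + \<eta> b), and
    the room for the second term is (n - b)/2 - \<theta>. Division by b + 1 instead of b covers b =
    0.\<close>
  define \<eta> where "\<eta> = ((n - b) / 2 - \<theta>) / (b + 1)"
  have \<eta>: "0 < \<eta>" using \<theta> b by (simp add: \<eta>_def n_def)
  have etab: "b * \<eta> \<le> (n - b) / 2 - \<theta>"
  proof -
    have "b * \<eta> \<le> (b + 1) * \<eta>" using \<eta> by (simp add: distrib_right)
    also have "\<dots> = (n - b) / 2 - \<theta>" using b by (simp add: \<eta>_def)
    finally show ?thesis .
  qed
  \<comment> \<open>m is so large that R^(2m) L^(b - 2m), which is T to the power b/2 + \<eta> b - 2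
    \<eta> m, decays like T^(-\<theta>).\<close>
  obtain m :: nat where "max b ((b / 2 + \<eta> * b + \<theta>) / (2 * \<eta>)) \<le> real m" using real_arch_simple by blast
  then have m: "b \<le> 2 * real m" "b / 2 + \<eta> * b + \<theta> \<le> 2 * \<eta> * real m"
    using \<eta> b by (auto simp: field_simps)
  obtain A where A: "0 < A" "\<And>f M t x. f \<in> borel_measurable borel \<Longrightarrow> (\<And>x. f x \<le> M) \<Longrightarrow> (\<integral>\<^sup>+ x. f x \<partial>lborel) \<le> M \<Longrightarrow> 0 \<le> t \<Longrightarrow>
      green_op t f x \<le> M * ennreal (A * (1 + t) powr - (n / 2))"
    using green_op_decay unfolding n_def by blast
  obtain B where B: "0 < B" "\<And>t x. 0 \<le> t \<Longrightarrow> green_op t (radial_moment m (sqrt (1 + t)) x) x \<le> ennreal B"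
    using green_op_radial_moment by blast
  define C where "C = 2 powr b * A + 2 powr (b / 2) * 4 ^ m * B"
  have C: "0 < C" using A B by (auto simp: C_def intro!: add_pos_pos)
  have "weight b x * green_op t f x \<le> M * ennreal (C * (1 + t) powr - \<theta>)"
    if [measurable]: "f \<in> borel_measurable borel" and f: "\<And>x. weight b x * f x \<le> M"
      "(\<integral>\<^sup>+ x. weight b x * f x \<partial>lborel) \<le> M" and t: "0 \<le> t" for f M t x
  proof -
    define T where "T = 1 + t"
    have T: "1 \<le> T" using t by (simp add: T_def)
    define L where "L = T powr (1 / 2 + \<eta>)"
    have L: "1 \<le> L" using T \<eta> by (simp add: L_def ge_one_powr_ge_zero)
    have w1: "1 \<le> weight b x" for x :: "real ^ 'n"
      using b japanese_bracket_ge_1[of x] ge_one_powr_ge_zero[of "japanese_bracket x" b]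
      by (simp add: weight_def flip: ennreal_1)
    have fw: "f x \<le> weight b x * f x" for x
      using mult_right_mono[OF w1[of x], of "f x"] by simp
    have fM: "f x \<le> M" for x using fw[of x] f(1)[of x] by (rule order_trans)
    show ?thesis
    proof (cases "norm x \<le> L")
      case True
      have "green_op t f x \<le> M * ennreal (A * T powr - (n / 2))"
        unfolding T_def
      proof (rule A(2))
        show "(\<integral>\<^sup>+ x. f x \<partial>lborel) \<le> M"
          using nn_integral_mono[of lborel f "\<lambda>x. weight b x * f x"] fw f(2) by (meson order_trans)
      qed (use fM t in auto)
      moreover have "weight b x \<le> ennreal (2 powr (b / 2) * T powr (b / 2 + \<eta> * b))"
        unfolding weight_def
      proof (rule ennreal_leI)
        have "(norm x)\<^sup>2 \<le> L\<^sup>2" using True by (intro power_mono) auto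
        moreover have "1 \<le> L\<^sup>2" using L by (rule one_le_power)
        ultimately have "1 + (norm x)\<^sup>2 \<le> 2 * L\<^sup>2" by linarith
        then have "(1 + (norm x)\<^sup>2) powr (b / 2) \<le> (2 * L\<^sup>2) powr (b / 2)"
          using b by (intro powr_mono2) (auto simp: add_nonneg_nonneg)
        moreover have "japanese_bracket x powr b = (1 + (norm x)\<^sup>2) powr (b / 2)"
          by (simp add: japanese_bracket_def powr_half_sqrt[symmetric] powr_powr add_nonneg_nonneg)
        moreover have "(2 * L\<^sup>2) powr (b / 2) = 2 powr (b / 2) * T powr (b / 2 + \<eta> * b)"
        proof -
          have "L\<^sup>2 = L powr 2" using L by simp
          also have "\<dots> = T powr (1 + 2 * \<eta>)" unfolding L_def by (simp only: powr_powr) (simp add: distrib_right mult.commute)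
          finally have "(L\<^sup>2) powr (b / 2) = T powr (b / 2 + \<eta> * b)"
            by (simp only: powr_powr) (simp add: field_simps)
          then show ?thesis by (simp only: powr_mult)
        qed
        ultimately show "japanese_bracket x powr b \<le> 2 powr (b / 2) * T powr (b / 2 + \<eta> * b)" by simp
      qed
      ultimately have "weight b x * green_op t f x \<le> ennreal (2 powr (b / 2) * T powr (b / 2 + \<eta> * b)) * (M * ennreal (A * T powr - (n / 2)))"
        by (intro mult_mono) auto
      also have "\<dots> = M * ennreal (2 powr (b / 2) * T powr (b / 2 + \<eta> * b) * (A * T powr - (n / 2)))"
        using A by (subst ennreal_mult) (auto simp: mult.left_commute)
      also have "2 powr (b / 2) * T powr (b / 2 + \<eta> * b) * (A * T powr - (n / 2)) = 2 powr (b / 2) * A * T powr (b / 2 + \<eta> * b - n / 2)"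
        using powr_add[of T "b / 2 + \<eta> * b" "- (n / 2)"] by simp
      also have "M * ennreal \<dots> \<le> M * ennreal (C * T powr - \<theta>)"
      proof (intro mult_left_mono ennreal_leI mult_mono)
        have "2 powr (b / 2) * A \<le> 2 powr b * A"
          using b A by (intro mult_right_mono powr_mono) auto
        then show "2 powr (b / 2) * A \<le> C" using B unfolding C_def by (simp add: add_increasing2)
        show "T powr (b / 2 + \<eta> * b - n / 2) \<le> T powr - \<theta>"
          using etab T by (intro powr_mono) (auto simp: field_simps)
      qed (use C in auto)
      finally show ?thesis by (simp add: T_def)
    next
      case False
      define R where "R = sqrt T"
      have R: "1 \<le> R" using T by (simp add: R_def)
      define \<kappa> where "\<kappa> = 2 powr (b / 2) * 4 ^ m * R ^ (2 * m) * L powr (b - 2 * real m)"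
      have \<kappa>: "0 \<le> \<kappa>" using R by (simp add: \<kappa>_def)
      \<comment> \<open>The alternative near or far depends on y, so it is replaced by the sum of
        both bounds, to which the linear operator applies.\<close>
      have pt: "weight b x * f y \<le> ennreal (2 powr b) * (weight b y * f y) + M * ennreal \<kappa> * radial_moment m R x y" for y
      proof -
        have "weight b x * f y \<le> (ennreal (2 powr b) * weight b y) * f y \<or> weight b x * f y \<le> (ennreal \<kappa> * radial_moment m R x y) * M"
          using weight_far_near[OF b R L _ m(1), of x y] False fM[of y] unfolding \<kappa>_def
          by (metis mult_mono mult_right_mono not_le zero_le)
        then show ?thesis by (auto simp: mult_ac intro: add_increasing add_increasing2)
      qed
      have "weight b x * green_op t f x = green_op t (\<lambda>y. weight b x * f y) x"
        by (simp add: green_op_cmult)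
      also have "\<dots> \<le> green_op t (\<lambda>y. ennreal (2 powr b) * (weight b y * f y) + M * ennreal \<kappa> * radial_moment m R x y) x"
        by (intro green_op_mono pt)
      also have "\<dots> = ennreal (2 powr b) * green_op t (\<lambda>y. weight b y * f y) x + M * ennreal \<kappa> * green_op t (radial_moment m R x) x"
        by (subst green_op_add) (auto simp: green_op_cmult)
      also have "\<dots> \<le> ennreal (2 powr b) * (M * ennreal (A * T powr - (n / 2))) + M * ennreal \<kappa> * ennreal B"
        unfolding R_def T_def by (intro add_mono mult_left_mono A B f t) auto
      also have "\<dots> = M * ennreal (2 powr b * (A * T powr - (n / 2)) + \<kappa> * B)"
        using A B \<kappa> by (simp add: ennreal_mult distrib_left mult_ac)
      also have "\<dots> \<le> M * ennreal (C * T powr - \<theta>)"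
      proof (intro mult_left_mono ennreal_leI)
        have "\<theta> \<le> n / 2" using \<theta> b by (simp add: n_def field_simps)
        then have "2 powr b * (A * T powr - (n / 2)) \<le> 2 powr b * (A * T powr - \<theta>)"
          using A T by (intro mult_left_mono powr_mono) auto
        moreover have "\<kappa> * B \<le> 2 powr (b / 2) * 4 ^ m * T powr - \<theta> * B"
        proof -
          have "R ^ (2 * m) = T powr real m"
            using T by (simp add: R_def power_mult powr_realpow)
          moreover have "L powr (b - 2 * real m) = T powr ((1 / 2 + \<eta>) * (b - 2 * real m))"
            unfolding L_def by (simp only: powr_powr)
          ultimately have "R ^ (2 * m) * L powr (b - 2 * real m) = T powr (real m + (1 / 2 + \<eta>) * (b - 2 * real m))"
            by (simp only: powr_add)
          also have "\<dots> \<le> T powr - \<theta>"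
            using m(2) T by (intro powr_mono) (auto simp: algebra_simps)
          finally have "2 powr (b / 2) * 4 ^ m * (R ^ (2 * m) * L powr (b - 2 * real m)) \<le> 2 powr (b / 2) * 4 ^ m * T powr - \<theta>"
            by (intro mult_left_mono) auto
          then show ?thesis unfolding \<kappa>_def using B by (intro mult_right_mono) (auto simp: mult.assoc)
        qed
        ultimately show "2 powr b * (A * T powr - (n / 2)) + \<kappa> * B \<le> C * T powr - \<theta>"
          by (simp add: C_def algebra_simps)
      qed auto
      finally show ?thesis by (simp add: T_def)
    qed
  qed
  then show ?thesis using that C by blast
qed

end

section \<open>The Duhamel operator\<close>

text \<open>The mean value theorem covers 0 < v < u. The case v = 0 is separate, since the
  derivative of \<open>powr\<close> is taken at a positive base; there u^p = u^(p-1) u and p >= 1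
  suffice.\<close>

lemma powr_diff_le:
  fixes u v m p :: real
  assumes "0 \<le> v" "v \<le> u" "u \<le> m" "1 \<le> p"
  shows "u powr p - v powr p \<le> p * m powr (p - 1) * (u - v)"
proof (cases "v = 0 \<or> v = u")
  case True
  show ?thesis
  proof (cases "v = u")
    case False
    then have v: "v = 0" "0 < u" using True assms by auto
    have "u powr p = u powr (p - 1) * u"
      using v powr_add[of u "p - 1" 1] by simp
    also have "\<dots> \<le> p * m powr (p - 1) * u"
    proof (rule mult_right_mono)
      have "1 * u powr (p - 1) \<le> p * m powr (p - 1)"
        using assms by (intro mult_mono powr_mono2) auto
      then show "u powr (p - 1) \<le> p * m powr (p - 1)" by simp
    qed (use v in simp)
    finally show ?thesis using v assms by simp
  qed simp
next
  case False
  then have v: "0 < v" "v < u" using assms by auto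
  have "\<exists>z. v < z \<and> z < u \<and> u powr p - v powr p = (u - v) * (p * z powr (p - 1))"
    using v by (intro MVT2) (auto intro!: derivative_eq_intros)
  then obtain z where z: "v < z" "z < u" "u powr p - v powr p = (u - v) * (p * z powr (p - 1))"
    by blast
  have "p * z powr (p - 1) \<le> p * m powr (p - 1)"
    using z v assms by (intro mult_left_mono powr_mono2) auto
  then show ?thesis using z(3) v by (simp add: mult_left_mono mult.commute)
qed

text \<open>Makes integrals over the time variable measurable in their parameters.\<close>

lemma sigma_finite_lebesgue: "sigma_finite_measure (lebesgue :: 'a::euclidean_space measure)"
proof
  obtain A :: "'a set set" where A: "countable A" "A \<subseteq> sets lborel" "\<Union>A = space lborel" "\<forall>a\<in>A. emeasure lborel a \<noteq> \<infinity>"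
    using lborel.sigma_finite_countable by blast
  then show "\<exists>A :: 'a set set. countable A \<and> A \<subseteq> sets lebesgue \<and> \<Union>A = space lebesgue \<and> (\<forall>a\<in>A. emeasure lebesgue a \<noteq> \<infinity>)"
    by (intro exI[of _ A]) (auto simp: subset_eq)
qed

interpretation lebesgue: sigma_finite_measure "lebesgue :: 'a::euclidean_space measure"
  by (rule sigma_finite_lebesgue)

text \<open>After commuting, the translation acts on the continuous factor f, and g times a constant
  dominates.\<close>

lemma nconv_continuous_on:
  fixes g f :: "'a::euclidean_space \<Rightarrow> ennreal"
  assumes [measurable]: "g \<in> borel_measurable borel" and g: "(\<integral>\<^sup>+ x. g x \<partial>lborel) < \<infinity>" "\<And>x. g x < \<infinity>"
    and f: "continuous_on UNIV f" "\<And>x. f x \<le> c" "c < \<infinity>"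
  shows "continuous_on UNIV (nconv g f)"
  unfolding continuous_on_sequentially
proof safe
  fix X :: "nat \<Rightarrow> 'a" and x assume X: "X \<longlonglongrightarrow> x"
  have [measurable]: "f \<in> borel_measurable borel" using f(1) by (rule borel_measurable_continuous_onI)
  have eq: "nconv g f y = (\<integral>\<^sup>+ z. g z * f (y - z) \<partial>lborel)" for y
    by (subst nconv_commute) (auto simp: nconv_def mult.commute)
  have "(\<lambda>i. \<integral>\<^sup>+ z. g z * f (X i - z) \<partial>lborel) \<longlonglongrightarrow> (\<integral>\<^sup>+ z. g z * f (x - z) \<partial>lborel)"
  proof (rule nn_integral_dominated_convergence[where w = "\<lambda>z. g z * c"])
    show "(\<integral>\<^sup>+ z. g z * c \<partial>lborel) < \<infinity>"
      using g f by (simp add: nn_integral_multc ennreal_mult_less_top)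
    show "AE z in lborel. (\<lambda>i. g z * f (X i - z)) \<longlonglongrightarrow> g z * f (x - z)"
    proof (intro AE_I2 ennreal_tendsto_cmult g[unfolded infinity_ennreal_def])
      fix z
      show "(\<lambda>i. f (X i - z)) \<longlonglongrightarrow> f (x - z)"
        by (rule continuous_on_tendsto_compose[OF f(1)]) (auto intro!: tendsto_intros X)
    qed
  qed (use f in \<open>auto intro!: mult_left_mono\<close>)
  then show "(nconv g f \<circ> X) \<longlonglongrightarrow> nconv g f x" by (simp add: eq comp_def)
qed

context dispersal_kernel
begin

lemma nconv_funpow_continuous_on:
  assumes f: "continuous_on UNIV f" "\<And>x. f x \<le> c" "c < \<infinity>"
  shows "continuous_on UNIV ((nconv j ^^ k) f)"
proof (induction k)
  case (Suc k)
  have [measurable]: "f \<in> borel_measurable borel" using f(1) by (rule borel_measurable_continuous_onI)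
  show ?case unfolding funpow.simps comp_def
  proof (rule nconv_continuous_on[OF j_measurable])
    show "(nconv j ^^ k) f x \<le> ennreal mass ^ k * c" for x
      using nconv_funpow_bounded[of j f c k x] f by (simp add: mass)
    show "ennreal mass ^ k * c < \<infinity>"
      using f mass_pos by (simp add: ennreal_power ennreal_mult_less_top)
    show "(\<integral>\<^sup>+ x. j x \<partial>lborel) < \<infinity>" by (simp add: mass)
  qed (use Suc j_finite in auto)
qed (use f in simp)

lemma green_op_continuous_on:
  assumes f: "continuous_on UNIV f" "\<And>x. f x \<le> c" "c < \<infinity>" and t: "0 \<le> t"
  shows "continuous_on UNIV (green_op t f)"
  unfolding continuous_on_sequentially
proof safe
  fix X :: "nat \<Rightarrow> real ^ 'n" and x assume X: "X \<longlonglongrightarrow> x"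
  have [measurable]: "f \<in> borel_measurable borel" using f(1) by (rule borel_measurable_continuous_onI)
  let ?F = "\<lambda>y k. ennreal (t ^ k / fact k) * (nconv j ^^ k) f y"
  let ?w = "\<lambda>k. ennreal (t ^ k / fact k) * (ennreal mass ^ k * c)"
  \<comment> \<open>The series is read as an integral over the counting measure, so dominated
    convergence applies to it as well.\<close>
  have "(\<lambda>i. \<integral>\<^sup>+ k. ?F (X i) k \<partial>count_space UNIV) \<longlonglongrightarrow> (\<integral>\<^sup>+ k. ?F x k \<partial>count_space UNIV)"
  proof (rule nn_integral_dominated_convergence[where w = ?w])
    have w: "?w k = ennreal ((t * mass) ^ k / fact k) * c" for k
      using t mass_pos
      by (simp add: mult.assoc[symmetric] ennreal_power ennreal_mult[symmetric] power_mult_distrib)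
    have "(\<Sum>k. ?w k) = ennreal (exp (t * mass)) * c"
      unfolding w using t mass_pos by (simp only: ennreal_suminf_multc suminf_ennreal_exp mult_nonneg_nonneg less_imp_le)
    then show "(\<integral>\<^sup>+ k. ?w k \<partial>count_space UNIV) < \<infinity>"
      using f by (simp only: nn_integral_count_space_nat) (simp add: ennreal_mult_less_top)
    show "AE k in count_space UNIV. ?F (X i) k \<le> ?w k" for i
      using nconv_funpow_bounded[of j f c _ "X i"] f by (intro AE_I2 mult_left_mono) (auto simp: mass)
    show "AE k in count_space UNIV. (\<lambda>i. ?F (X i) k) \<longlonglongrightarrow> ?F x k"
    proof (intro AE_I2 ennreal_tendsto_cmult)
      fix k
      show "(\<lambda>i. (nconv j ^^ k) f (X i)) \<longlonglongrightarrow> (nconv j ^^ k) f x"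
        by (rule continuous_on_tendsto_compose[OF nconv_funpow_continuous_on[OF f]]) (auto intro: X)
    qed auto
  qed auto
  then show "(green_op t f \<circ> X) \<longlonglongrightarrow> green_op t f x"
    unfolding comp_def green_op_def nn_integral_count_space_nat by (intro ennreal_tendsto_cmult) auto
qed

end

text \<open>Joint measurability mixes \<open>lebesgue\<close> in time with \<open>borel\<close> in
  space: in time the coefficient is only Lebesgue measurable, while convolutions are formed of Borel
  functions.\<close>

locale semilinear_problem = dispersal_kernel j for j :: "real ^ 'n \<Rightarrow> ennreal" +
  fixes A :: "real \<Rightarrow> real ^ 'n \<Rightarrow> real" and \<sigma> p C\<^sub>A :: real
  assumes A_measurable: "(\<lambda>(t, y). A t y) \<in> borel_measurable (lebesgue \<Otimes>\<^sub>M borel)"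
    and A_continuous: "\<And>t. continuous_on UNIV (A t)"
    and A_nonneg: "\<And>t y. 0 \<le> A t y"
    and A_le: "\<And>t y. A t y \<le> C\<^sub>A * japanese_bracket y powr \<sigma>"
    and p_gt_1: "1 < p" and sigma_nonneg: "0 \<le> \<sigma>" and C_pos: "0 < C\<^sub>A"
begin

definition b :: real where "b = \<sigma> / (p - 1)"

lemma b_nonneg: "0 \<le> b" and b_mult: "b * (p - 1) = \<sigma>"
  using p_gt_1 sigma_nonneg by (auto simp: b_def)

definition source :: "(real \<Rightarrow> real ^ 'n \<Rightarrow> real) \<Rightarrow> real \<Rightarrow> real ^ 'n \<Rightarrow> ennreal"
  where "source u \<tau> y = ennreal (A \<tau> y * u \<tau> y powr p)"

definition duhamel :: "(real \<Rightarrow> real ^ 'n \<Rightarrow> real) \<Rightarrow> real \<Rightarrow> real ^ 'n \<Rightarrow> ennreal"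
  where "duhamel u t x = (\<integral>\<^sup>+ \<tau>. indicator {0..t} \<tau> * green_op (t - \<tau>) (source u \<tau>) x \<partial>lebesgue)"

lemma source_measurable [measurable]:
  assumes "(\<lambda>(t, y). u t y) \<in> borel_measurable (lebesgue \<Otimes>\<^sub>M borel)"
  shows "(\<lambda>(t, y). source u t y) \<in> borel_measurable (lebesgue \<Otimes>\<^sub>M borel)"
  using A_measurable assms unfolding source_def case_prod_beta' by measurable

lemma source_measurable_space [measurable]:
  assumes "(\<lambda>(t, y). u t y) \<in> borel_measurable (lebesgue \<Otimes>\<^sub>M borel)"
  shows "source u \<tau> \<in> borel_measurable borel"
  using measurable_compose[OF measurable_Pair1' source_measurable[OF assms], of \<tau>] by simp

lemma ident_measurable_lebesgue: "(\<lambda>t :: real. t) \<in> borel_measurable lebesgue"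
  by (rule measurable_completion) simp

text \<open>The indicator belongs to the integrand, so that one measure space serves all t and the
  region \<tau> <= t is measurable jointly in both times.\<close>

lemma duhamel_integrand_measurable:
  assumes u: "(\<lambda>(t, y). u t y) \<in> borel_measurable (lebesgue \<Otimes>\<^sub>M borel)"
  shows "(\<lambda>((t, \<tau>), x). indicator {0..t} \<tau> * green_op (t - \<tau>) (source u \<tau>) x)
    \<in> borel_measurable ((lebesgue \<Otimes>\<^sub>M lebesgue) \<Otimes>\<^sub>M borel)"
proof -
  note [measurable] = ident_measurable_lebesgue
  have "(\<lambda>w. (snd (fst w), snd w)) \<in> (lebesgue \<Otimes>\<^sub>M lebesgue) \<Otimes>\<^sub>M borel \<rightarrow>\<^sub>M lebesgue \<Otimes>\<^sub>M borel"
    by measurable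
  from measurable_compose[OF this source_measurable[OF u]]
  have [measurable]: "(\<lambda>w. source u (snd (fst w)) (snd w)) \<in> borel_measurable ((lebesgue \<Otimes>\<^sub>M lebesgue) \<Otimes>\<^sub>M borel)"
    by (simp add: case_prod_beta')
  have "(\<lambda>(w, x). green_op (fst w - snd w) (source u (snd w)) x) \<in> borel_measurable ((lebesgue \<Otimes>\<^sub>M lebesgue) \<Otimes>\<^sub>M borel)"
    by (rule green_op_measurable_param) (simp_all add: case_prod_beta')
  then have [measurable]: "(\<lambda>w. green_op (fst (fst w) - snd (fst w)) (source u (snd (fst w))) (snd w)) \<in> borel_measurable ((lebesgue \<Otimes>\<^sub>M lebesgue) \<Otimes>\<^sub>M borel)"
    by (simp add: case_prod_beta')
  have "(\<lambda>w. (if 0 \<le> snd (fst w) \<and> snd (fst w) \<le> fst (fst w) then 1 else 0) * green_op (fst (fst w) - snd (fst w)) (source u (snd (fst w))) (snd w))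
      \<in> borel_measurable ((lebesgue \<Otimes>\<^sub>M lebesgue) \<Otimes>\<^sub>M borel)"
    by measurable
  then show ?thesis by (simp add: case_prod_beta' indicator_def)
qed

lemma duhamel_integrand_measurable_time [measurable]:
  assumes u: "(\<lambda>(t, y). u t y) \<in> borel_measurable (lebesgue \<Otimes>\<^sub>M borel)"
  shows "(\<lambda>\<tau>. indicator {0..t} \<tau> * green_op (t - \<tau>) (source u \<tau>) x) \<in> borel_measurable lebesgue"
proof -
  have "(\<lambda>\<tau>. ((t, \<tau>), x)) \<in> lebesgue \<rightarrow>\<^sub>M (lebesgue \<Otimes>\<^sub>M lebesgue) \<Otimes>\<^sub>M borel"
    by measurable
  from measurable_compose[OF this duhamel_integrand_measurable[OF u]] show ?thesis by simp
qed

lemma duhamel_measurable: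
  assumes u: "(\<lambda>(t, y). u t y) \<in> borel_measurable (lebesgue \<Otimes>\<^sub>M borel)"
  shows "(\<lambda>(t, x). duhamel u t x) \<in> borel_measurable (lebesgue \<Otimes>\<^sub>M borel)"
proof -
  have "(\<lambda>(w, \<tau>). indicator {0..fst w} \<tau> * green_op (fst w - \<tau>) (source u \<tau>) (snd w))
      \<in> borel_measurable ((lebesgue \<Otimes>\<^sub>M borel) \<Otimes>\<^sub>M lebesgue)"
  proof -
    have "(\<lambda>w. ((fst (fst w), snd w), snd (fst w))) \<in> (lebesgue \<Otimes>\<^sub>M borel) \<Otimes>\<^sub>M lebesgue \<rightarrow>\<^sub>M (lebesgue \<Otimes>\<^sub>M lebesgue) \<Otimes>\<^sub>M borel"
      by measurable
    from measurable_compose[OF this duhamel_integrand_measurable[OF u]] show ?thesis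
      by (simp add: case_prod_beta')
  qed
  then show ?thesis
    unfolding duhamel_def case_prod_beta'
    by (intro lebesgue.borel_measurable_nn_integral) (simp add: case_prod_beta')
qed

lemma powr_weight_le:
  assumes u: "0 \<le> u" "u \<le> M * japanese_bracket y powr - b" and M: "0 \<le> M"
  shows "A t y * (u powr (p - 1)) \<le> C\<^sub>A * M powr (p - 1)"
proof -
  have jb: "0 < japanese_bracket y" using japanese_bracket_ge_1[of y] by linarith
  have "A t y * u powr (p - 1) \<le> (C\<^sub>A * japanese_bracket y powr \<sigma>) * (M * japanese_bracket y powr - b) powr (p - 1)"
    using u p_gt_1 A_nonneg C_pos by (intro mult_mono A_le powr_mono2) auto
  also have "(M * japanese_bracket y powr - b) powr (p - 1) = M powr (p - 1) * japanese_bracket y powr - \<sigma>"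
    using b_mult by (simp add: powr_mult powr_powr)
  also have "(C\<^sub>A * japanese_bracket y powr \<sigma>) * (M powr (p - 1) * japanese_bracket y powr - \<sigma>)
      = C\<^sub>A * M powr (p - 1) * (japanese_bracket y powr \<sigma> * japanese_bracket y powr - \<sigma>)"
    by (simp only: mult_ac)
  also have "japanese_bracket y powr \<sigma> * japanese_bracket y powr - \<sigma> = 1"
    using jb by (simp add: powr_add[symmetric])
  finally show ?thesis by simp
qed

text \<open>Additive and one-sided, as the sources are [0, \<infinity>]-valued. If u exceeds v, the
  mean value bound applies and the weights cancel by \<open>powr_weight_le\<close>; otherwise
  monotonicity is enough.\<close>

lemma source_lipschitz:
  assumes u: "0 \<le> u \<tau> y" "u \<tau> y \<le> M * japanese_bracket y powr - b"
    and v: "0 \<le> v \<tau> y" "v \<tau> y \<le> M * japanese_bracket y powr - b" and M: "0 \<le> M"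
    and d: "\<bar>u \<tau> y - v \<tau> y\<bar> \<le> d * japanese_bracket y powr - b"
  shows "source u \<tau> y \<le> source v \<tau> y + ennreal (C\<^sub>A * p * M powr (p - 1) * d) * weight (- b) y"
proof -
  let ?w = "japanese_bracket y powr - b"
  have jb: "0 < ?w" using japanese_bracket_ge_1[of y] by simp
  have d0: "0 \<le> d"
    using d jb abs_ge_zero[of "u \<tau> y - v \<tau> y"] by (metis order_trans zero_le_mult_iff not_less order_less_imp_le mult_nonneg_nonpos mult.commute mult_less_0_iff)
  have "A \<tau> y * u \<tau> y powr p \<le> A \<tau> y * v \<tau> y powr p + C\<^sub>A * p * M powr (p - 1) * d * ?w"
  proof (cases "v \<tau> y \<le> u \<tau> y")
    case True
    have "A \<tau> y * (u \<tau> y powr p - v \<tau> y powr p) \<le> A \<tau> y * (p * u \<tau> y powr (p - 1) * (u \<tau> y - v \<tau> y))"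
      using powr_diff_le[OF v(1) True order_refl] p_gt_1 A_nonneg by (intro mult_left_mono) auto
    also have "\<dots> = (A \<tau> y * u \<tau> y powr (p - 1)) * (p * (u \<tau> y - v \<tau> y))"
      by (simp only: mult_ac)
    also have "\<dots> \<le> (C\<^sub>A * M powr (p - 1)) * (p * (d * ?w))"
    proof (rule mult_mono)
      show "p * (u \<tau> y - v \<tau> y) \<le> p * (d * ?w)"
        using d True p_gt_1 by (intro mult_left_mono) auto
    qed (use powr_weight_le[OF u M, of \<tau>] True p_gt_1 C_pos in auto)
    finally show ?thesis by (simp add: algebra_simps)
  next
    case False
    then have "A \<tau> y * u \<tau> y powr p \<le> A \<tau> y * v \<tau> y powr p"
      using u p_gt_1 A_nonneg by (intro mult_left_mono powr_mono2) auto
    moreover have "0 \<le> C\<^sub>A * p * M powr (p - 1) * d * ?w"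
      using C_pos p_gt_1 d0 by simp
    ultimately show ?thesis by linarith
  qed
  then have "source u \<tau> y \<le> ennreal (A \<tau> y * v \<tau> y powr p + C\<^sub>A * p * M powr (p - 1) * d * ?w)"
    unfolding source_def by (rule ennreal_leI)
  also have "\<dots> = source v \<tau> y + ennreal (C\<^sub>A * p * M powr (p - 1) * d) * weight (- b) y"
    using A_nonneg C_pos p_gt_1 d0 unfolding source_def weight_def
    by (subst ennreal_plus) (auto simp: ennreal_mult)
  finally show ?thesis .
qed

text \<open>The integrand is K exp (L \<tau> + \<beta> t), and integrating exp (L \<tau>) gains the
  factor 1 / L that makes the Duhamel operator contract.\<close>

lemma nn_integral_exp_growth:
  assumes L: "0 < L" "0 \<le> K" "0 \<le> t"
  shows "(\<integral>\<^sup>+ \<tau>. indicator {0..t} \<tau> * ennreal (K * exp ((\<beta> + L) * \<tau>) * exp (\<beta> * (t - \<tau>))) \<partial>lebesgue)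
    \<le> ennreal (K / L * exp ((\<beta> + L) * t))"
proof -
  let ?f = "\<lambda>\<tau>. K * exp (L * \<tau> + \<beta> * t)" and ?F = "\<lambda>\<tau>. K / L * exp (L * \<tau> + \<beta> * t)"
  have "(\<integral>\<^sup>+ \<tau>. indicator {0..t} \<tau> * ennreal (K * exp ((\<beta> + L) * \<tau>) * exp (\<beta> * (t - \<tau>))) \<partial>lebesgue)
      = (\<integral>\<^sup>+ \<tau>. ennreal (?f \<tau>) * indicator {0..t} \<tau> \<partial>lborel)"
    by (simp add: nn_integral_completion mult.assoc exp_add[symmetric] algebra_simps)
  also have "\<dots> = ennreal (?F t - ?F 0)"
    using L by (intro nn_integral_FTC_Icc) (auto intro!: derivative_eq_intros simp: has_real_derivative_iff_has_vector_derivative[symmetric])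
  also have "\<dots> \<le> ennreal (?F t)" using L by (intro ennreal_leI) simp
  finally show ?thesis by (simp add: algebra_simps)
qed

text \<open>Twice the Lipschitz constant of the source, so that the gain of one time integration is
  at most 1/2; the summand 1 keeps the rate positive for M = 0.\<close>

definition lipschitz_rate :: "real \<Rightarrow> real"
  where "lipschitz_rate M = 2 * (C\<^sub>A * p * M powr (p - 1) + 1)"

lemma duhamel_contraction:
  assumes \<beta>: "0 \<le> \<beta>" "\<And>x. nconv j (weight (- b)) x \<le> ennreal \<beta> * weight (- b) x"
    and u_meas: "(\<lambda>(t, y). u t y) \<in> borel_measurable (lebesgue \<Otimes>\<^sub>M borel)"
    and v_meas: "(\<lambda>(t, y). v t y) \<in> borel_measurable (lebesgue \<Otimes>\<^sub>M borel)"
    and u: "\<And>\<tau> y. 0 \<le> \<tau> \<Longrightarrow> \<tau> \<le> t \<Longrightarrow> 0 \<le> u \<tau> y \<and> u \<tau> y \<le> M * japanese_bracket y powr - b"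
    and v: "\<And>\<tau> y. 0 \<le> \<tau> \<Longrightarrow> \<tau> \<le> t \<Longrightarrow> 0 \<le> v \<tau> y \<and> v \<tau> y \<le> M * japanese_bracket y powr - b"
    and M: "0 \<le> M" and d: "0 \<le> d"
    and uv: "\<And>\<tau> y. 0 \<le> \<tau> \<Longrightarrow> \<tau> \<le> t \<Longrightarrow> \<bar>u \<tau> y - v \<tau> y\<bar> \<le> d * exp ((\<beta> + lipschitz_rate M) * \<tau>) * japanese_bracket y powr - b"
    and t: "0 \<le> t"
  shows "duhamel u t x \<le> duhamel v t x + ennreal (d / 2 * exp ((\<beta> + lipschitz_rate M) * t) * japanese_bracket x powr - b)"
proof -
  define L where "L = C\<^sub>A * p * M powr (p - 1)"
  have L: "0 \<le> L" using C_pos p_gt_1 by (simp add: L_def)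
  define r where "r = lipschitz_rate M"
  have r: "0 < r" "r = 2 * (L + 1)" using L by (auto simp: r_def lipschitz_rate_def L_def)
  note [measurable] = source_measurable_space[OF u_meas] source_measurable_space[OF v_meas]
    duhamel_integrand_measurable_time[OF v_meas]
  let ?g = "\<lambda>\<tau>. indicator {0..t} \<tau> * ennreal (L * d * exp ((\<beta> + r) * \<tau>) * exp (\<beta> * (t - \<tau>))) :: ennreal"
  have "?g \<in> borel_measurable borel" by measurable
  then have [measurable]: "?g \<in> borel_measurable lebesgue" by (intro measurable_completion) simp
  have pt: "indicator {0..t} \<tau> * green_op (t - \<tau>) (source u \<tau>) x
      \<le> indicator {0..t} \<tau> * green_op (t - \<tau>) (source v \<tau>) x + ?g \<tau> * weight (- b) x" for \<tau>
  proof (cases "\<tau> \<in> {0..t}")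
    case True
    then have \<tau>: "0 \<le> \<tau>" "\<tau> \<le> t" by auto
    let ?k = "ennreal (L * (d * exp ((\<beta> + r) * \<tau>)))"
    have "green_op (t - \<tau>) (source u \<tau>) x \<le> green_op (t - \<tau>) (\<lambda>y. source v \<tau> y + ?k * weight (- b) y) x"
      unfolding L_def r_def using u[OF \<tau>] v[OF \<tau>] uv[OF \<tau>] M by (intro green_op_mono source_lipschitz) auto
    also have "\<dots> = green_op (t - \<tau>) (source v \<tau>) x + ?k * green_op (t - \<tau>) (weight (- b)) x"
      by (subst green_op_add) (auto simp: green_op_cmult)
    also have "\<dots> \<le> green_op (t - \<tau>) (source v \<tau>) x + ?k * (ennreal (exp ((\<beta> - mass) * (t - \<tau>))) * weight (- b) x)"
      using \<tau> \<beta> by (intro add_left_mono mult_left_mono green_op_eigen) auto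
    also have "\<dots> \<le> green_op (t - \<tau>) (source v \<tau>) x + ?k * (ennreal (exp (\<beta> * (t - \<tau>))) * weight (- b) x)"
      using \<tau> mass_pos by (intro add_left_mono mult_left_mono mult_right_mono ennreal_leI) (auto simp: mult_right_mono)
    also have "?k * (ennreal (exp (\<beta> * (t - \<tau>))) * weight (- b) x) = ?g \<tau> * weight (- b) x"
      using True L d by (simp add: ennreal_mult mult.assoc)
    finally show ?thesis using True by simp
  qed simp
  have "duhamel u t x \<le> (\<integral>\<^sup>+ \<tau>. indicator {0..t} \<tau> * green_op (t - \<tau>) (source v \<tau>) x + ?g \<tau> * weight (- b) x \<partial>lebesgue)"
    unfolding duhamel_def by (intro nn_integral_mono pt)
  also have "\<dots> = duhamel v t x + (\<integral>\<^sup>+ \<tau>. ?g \<tau> \<partial>lebesgue) * weight (- b) x"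
    unfolding duhamel_def by (subst nn_integral_add) (auto simp: nn_integral_multc)
  also have "\<dots> \<le> duhamel v t x + ennreal (L * d / r * exp ((\<beta> + r) * t)) * weight (- b) x"
    using r L d t by (intro add_left_mono mult_right_mono nn_integral_exp_growth) auto
  also have "\<dots> \<le> duhamel v t x + ennreal (d / 2 * exp ((\<beta> + r) * t)) * weight (- b) x"
  proof (intro add_left_mono mult_right_mono ennreal_leI)
    have "L * d \<le> (L + 1) * d" using d by (intro mult_right_mono) auto
    then show "L * d / r \<le> d / 2" using L r by (simp add: field_simps)
  qed auto
  also have "ennreal (d / 2 * exp ((\<beta> + r) * t)) * weight (- b) x = ennreal (d / 2 * exp ((\<beta> + r) * t) * japanese_bracket x powr - b)"
    unfolding weight_def using d by (intro ennreal_mult[symmetric]) auto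
  finally show ?thesis by (simp only: r_def)
qed

end

section \<open>Small initial data\<close>

lemma weight_ge_1: "0 \<le> b \<Longrightarrow> 1 \<le> weight b x"
  using japanese_bracket_ge_1[of x] ge_one_powr_ge_zero[of "japanese_bracket x" b]
  by (simp add: weight_def flip: ennreal_1)

lemma weight_inverse: "weight b x * weight (- b) x = 1"
  using japanese_bracket_ge_1[of x]
  by (simp add: weight_def ennreal_mult[symmetric] powr_add[symmetric])

lemma weight_mult_le_iff: "weight b x * ennreal u \<le> ennreal M \<longleftrightarrow> u \<le> M * japanese_bracket x powr - b"
  if "0 \<le> u" "0 \<le> M"
proof -
  have jb: "0 < japanese_bracket x powr b" using japanese_bracket_ge_1[of x] by simp
  have "weight b x * ennreal u \<le> ennreal M \<longleftrightarrow> japanese_bracket x powr b * u \<le> M"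
    using that by (simp add: weight_def ennreal_mult[symmetric])
  also have "\<dots> \<longleftrightarrow> u \<le> M * japanese_bracket x powr - b"
    using jb by (simp add: powr_minus field_simps)
  finally show ?thesis .
qed

text \<open>The bound \<open>K_small\<close> is what makes \<open>2 G(t) u\<^sub>0\<close> a supersolution.\<close>
locale small_data = semilinear_problem j A \<sigma> p C\<^sub>A
  for j :: "real ^ 'n \<Rightarrow> ennreal" and A and \<sigma> p C\<^sub>A :: real +
  fixes u\<^sub>0 :: "real ^ 'n \<Rightarrow> real" and K :: "real \<Rightarrow> real" and K\<^sub>0 m :: real
  assumes u0_continuous: "continuous_on UNIV u\<^sub>0" and u0_nonneg: "\<And>x. 0 \<le> u\<^sub>0 x"
    and u0_le: "\<And>x. weight b x * ennreal (u\<^sub>0 x) \<le> ennreal m"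
    and u0_integral: "(\<integral>\<^sup>+ x. weight b x * ennreal (u\<^sub>0 x) \<partial>lborel) \<le> ennreal m" and m_nonneg: "0 \<le> m"
    and free_decay: "\<And>t x. 0 \<le> t \<Longrightarrow> weight b x * green_op t (\<lambda>x. ennreal (u\<^sub>0 x)) x \<le> ennreal (K t)"
    and K_nonneg: "\<And>t. 0 \<le> K t" and K_le: "\<And>t. K t \<le> K\<^sub>0" and K_measurable: "K \<in> borel_measurable borel"
    and K_small: "(\<integral>\<^sup>+ t. indicator {0..} t * ennreal (2 * (C\<^sub>A * (2 * K t) powr (p - 1))) \<partial>lebesgue) \<le> 1"
begin

section \<open>Functions below twice the free evolution\<close>

definition free :: "real \<Rightarrow> real ^ 'n \<Rightarrow> ennreal"
  where "free t = green_op t (\<lambda>x. ennreal (u\<^sub>0 x))"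

text \<open>The 2 in front is that of u <= 2 G(t) u0: it lets the source be compared with G(t) u0
  instead of u.\<close>

definition potential :: "real \<Rightarrow> real" where "potential t = 2 * (C\<^sub>A * (2 * K t) powr (p - 1))"

definition picard_map :: "(real \<Rightarrow> real ^ 'n \<Rightarrow> real) \<Rightarrow> real \<Rightarrow> real ^ 'n \<Rightarrow> ennreal"
  where "picard_map u t x = free t x + duhamel u t x"

definition dominated :: "(real \<Rightarrow> real ^ 'n \<Rightarrow> real) \<Rightarrow> bool"
  where "dominated u \<longleftrightarrow> (\<forall>t\<ge>0. \<forall>x. 0 \<le> u t x \<and> ennreal (u t x) \<le> 2 * free t x)"

lemma K0_nonneg: "0 \<le> K\<^sub>0"
  using K_nonneg[of 0] K_le[of 0] by linarith

lemma u0_measurable [measurable]: "(\<lambda>x. ennreal (u\<^sub>0 x)) \<in> borel_measurable borel"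
  using borel_measurable_continuous_onI[OF u0_continuous] by measurable

lemma free_measurable_space [measurable]: "free t \<in> borel_measurable borel"
  unfolding free_def by measurable

lemma free_measurable: "(\<lambda>(t, x). free t x) \<in> borel_measurable (lebesgue \<Otimes>\<^sub>M borel)"
  unfolding free_def by (rule green_op_measurable_param[OF ident_measurable_lebesgue]) measurable

lemma u0_bounded: "ennreal (u\<^sub>0 x) \<le> ennreal m"
  using mult_right_mono[OF weight_ge_1[OF b_nonneg, of x], of "ennreal (u\<^sub>0 x)"] u0_le[of x]
  by (simp add: order_trans)

lemma free_bounded: "0 \<le> t \<Longrightarrow> free t x \<le> ennreal m"
  unfolding free_def using u0_bounded by (intro green_op_bounded)

lemma free_finite: "0 \<le> t \<Longrightarrow> free t x < \<infinity>"
  using free_bounded[of t x] by (simp add: le_less_trans)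

lemma free_semigroup: "0 \<le> s \<Longrightarrow> 0 \<le> t \<Longrightarrow> green_op s (free t) x = free (s + t) x"
  unfolding free_def by (rule green_op_semigroup) measurable

lemma free_le_weight:
  assumes "0 \<le> t"
  shows "free t x \<le> ennreal K\<^sub>0 * weight (- b) x"
proof -
  have "free t x = weight (- b) x * (weight b x * free t x)"
  proof -
    have "weight (- b) x * (weight b x * free t x) = (weight b x * weight (- b) x) * free t x"
      by (simp only: mult_ac)
    then show ?thesis by (simp only: weight_inverse mult_1_left)
  qed
  also have "\<dots> \<le> weight (- b) x * ennreal K\<^sub>0"
    using free_decay[OF assms, of x] ennreal_leI[OF K_le[of t]] unfolding free_def
    by (intro mult_left_mono) (auto intro: order_trans)
  finally show ?thesis by (simp add: mult.commute)
qed

lemma potential_le: "potential t \<le> 2 * (C\<^sub>A * (2 * K\<^sub>0) powr (p - 1))"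
  unfolding potential_def using K_le[of t] K_nonneg[of t] C_pos p_gt_1
  by (intro mult_left_mono powr_mono2) auto

lemma potential_measurable [measurable]: "potential \<in> borel_measurable borel"
  unfolding potential_def using K_measurable by measurable

lemma potential_measurable_lebesgue [measurable]:
  "(\<lambda>\<tau>. indicator {0..} \<tau> * ennreal (potential \<tau>)) \<in> borel_measurable lebesgue"
proof -
  have "(\<lambda>\<tau>. indicator {0..} \<tau> * ennreal (potential \<tau>)) \<in> borel_measurable borel" by measurable
  then show ?thesis by (intro measurable_completion) simp
qed

lemma dominated_bound:
  assumes "dominated u" "0 \<le> t"
  shows "0 \<le> u t x \<and> u t x \<le> 2 * K t * japanese_bracket x powr - b"
proof -
  have u: "0 \<le> u t x" "ennreal (u t x) \<le> 2 * free t x"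
    using assms by (auto simp: dominated_def)
  have "weight b x * ennreal (u t x) \<le> weight b x * (2 * free t x)"
    using u by (intro mult_left_mono) auto
  also have "\<dots> = 2 * (weight b x * free t x)" by (simp add: mult.left_commute)
  also have "\<dots> \<le> 2 * ennreal (K t)"
    using free_decay[OF assms(2), of x] unfolding free_def by (intro mult_left_mono) auto
  also have "\<dots> = ennreal (2 * K t)" using K_nonneg by (simp add: ennreal_mult)
  finally show ?thesis
    using u K_nonneg[of t] by (subst (asm) weight_mult_le_iff) auto
qed

lemma dominated_bound_uniform:
  assumes "dominated u" "0 \<le> t"
  shows "0 \<le> u t x \<and> u t x \<le> 2 * K\<^sub>0 * japanese_bracket x powr - b"
proof -
  have "2 * K t * japanese_bracket x powr - b \<le> 2 * K\<^sub>0 * japanese_bracket x powr - b"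
    using K_le[of t] by (intro mult_right_mono) auto
  then show ?thesis using dominated_bound[OF assms, of x] by linarith
qed

lemma source_dominated:
  assumes "dominated u" "0 \<le> t"
  shows "source u t y \<le> ennreal (potential t) * free t y"
proof -
  have u: "0 \<le> u t y" "ennreal (u t y) \<le> 2 * free t y"
    using assms by (auto simp: dominated_def)
  have "A t y * u t y powr p = (A t y * u t y powr (p - 1)) * u t y"
    using u powr_add[of "u t y" "p - 1" 1] p_gt_1 by (cases "u t y = 0") auto
  also have "\<dots> \<le> (C\<^sub>A * (2 * K t) powr (p - 1)) * u t y"
    using dominated_bound[OF assms, of y] K_nonneg[of t]
    by (intro mult_right_mono powr_weight_le) auto
  finally have "source u t y \<le> ennreal ((C\<^sub>A * (2 * K t) powr (p - 1)) * u t y)"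
    unfolding source_def by (rule ennreal_leI)
  also have "\<dots> = ennreal (C\<^sub>A * (2 * K t) powr (p - 1)) * ennreal (u t y)"
    using u C_pos by (intro ennreal_mult) auto
  also have "\<dots> \<le> ennreal (C\<^sub>A * (2 * K t) powr (p - 1)) * (2 * free t y)"
    by (intro mult_left_mono u) auto
  also have "\<dots> = ennreal (potential t) * free t y"
    unfolding potential_def using C_pos by (subst ennreal_mult) (auto simp: mult_ac)
  finally show ?thesis .
qed

lemma green_op_source_dominated:
  assumes "dominated u" "0 \<le> \<tau>" "0 \<le> s"
  shows "green_op s (source u \<tau>) x \<le> ennreal (potential \<tau>) * free (s + \<tau>) x"
proof -
  have "green_op s (source u \<tau>) x \<le> green_op s (\<lambda>y. ennreal (potential \<tau>) * free \<tau> y) x"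
    using assms by (intro green_op_mono source_dominated) auto
  also have "\<dots> = ennreal (potential \<tau>) * free (s + \<tau>) x"
    using assms by (simp add: green_op_cmult free_semigroup)
  finally show ?thesis .
qed

text \<open>G(t - \<tau>) G(\<tau>) u0 = G(t) u0 no longer depends on \<tau>, so the time integral
  falls on the potential alone, and \<open>K_small\<close> bounds it by 1.\<close>

lemma duhamel_dominated:
  assumes "dominated u" "0 \<le> t"
  shows "duhamel u t x \<le> free t x"
proof -
  have "duhamel u t x \<le> (\<integral>\<^sup>+ \<tau>. (indicator {0..} \<tau> * ennreal (potential \<tau>)) * free t x \<partial>lebesgue)"
    unfolding duhamel_def
  proof (intro nn_integral_mono)
    fix \<tau>
    show "indicator {0..t} \<tau> * green_op (t - \<tau>) (source u \<tau>) x \<le> (indicator {0..} \<tau> * ennreal (potential \<tau>)) * free t x"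
      using green_op_source_dominated[OF assms(1), of \<tau> "t - \<tau>" x] by (auto simp: indicator_def)
  qed
  also have "\<dots> = (\<integral>\<^sup>+ \<tau>. indicator {0..} \<tau> * ennreal (potential \<tau>) \<partial>lebesgue) * free t x"
    by (subst nn_integral_multc) auto
  also have "\<dots> \<le> 1 * free t x"
    using K_small unfolding potential_def by (intro mult_right_mono) auto
  finally show ?thesis by simp
qed

lemma picard_map_dominated: "dominated u \<Longrightarrow> 0 \<le> t \<Longrightarrow> picard_map u t x \<le> 2 * free t x"
  unfolding picard_map_def mult_2 by (intro add_left_mono duhamel_dominated)

lemma picard_map_finite: "dominated u \<Longrightarrow> 0 \<le> t \<Longrightarrow> picard_map u t x < \<infinity>"
  using picard_map_dominated[of u t x] free_finite[of t x]
  by (auto intro!: le_less_trans[of "picard_map u t x"] simp: ennreal_mult_less_top)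

lemma picard_map_measurable:
  assumes "(\<lambda>(t, x). u t x) \<in> borel_measurable (lebesgue \<Otimes>\<^sub>M borel)"
  shows "(\<lambda>(t, x). picard_map u t x) \<in> borel_measurable (lebesgue \<Otimes>\<^sub>M borel)"
  using free_measurable duhamel_measurable[OF assms] unfolding picard_map_def case_prod_beta' by measurable

lemma picard_map_continuous:
  assumes meas: "(\<lambda>(t, x). u t x) \<in> borel_measurable (lebesgue \<Otimes>\<^sub>M borel)"
    and u: "dominated u" "\<And>t. 0 \<le> t \<Longrightarrow> continuous_on UNIV (u t)" and t: "0 \<le> t"
  shows "continuous_on UNIV (picard_map u t)"
proof -
  have "continuous_on UNIV (free t)"
    unfolding free_def using u0_bounded t
    by (intro green_op_continuous_on[where c = "ennreal m"]) (auto intro!: continuous_on_ennreal u0_continuous)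
  moreover have "continuous_on UNIV (duhamel u t)"
    unfolding continuous_on_sequentially
  proof safe
    fix X :: "nat \<Rightarrow> real ^ 'n" and x assume X: "X \<longlonglongrightarrow> x"
    let ?w = "\<lambda>\<tau>. (indicator {0..} \<tau> * ennreal (potential \<tau>)) * ennreal m"
    have "(\<lambda>i. \<integral>\<^sup>+ \<tau>. indicator {0..t} \<tau> * green_op (t - \<tau>) (source u \<tau>) (X i) \<partial>lebesgue)
        \<longlonglongrightarrow> (\<integral>\<^sup>+ \<tau>. indicator {0..t} \<tau> * green_op (t - \<tau>) (source u \<tau>) x \<partial>lebesgue)"
    proof (rule nn_integral_dominated_convergence[where w = ?w])
      show "(\<integral>\<^sup>+ \<tau>. ?w \<tau> \<partial>lebesgue) < \<infinity>"
        using K_small unfolding potential_def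
        by (subst nn_integral_multc) (auto simp: potential_measurable_lebesgue[unfolded potential_def] ennreal_mult_less_top intro: le_less_trans)
      show "AE \<tau> in lebesgue. indicator {0..t} \<tau> * green_op (t - \<tau>) (source u \<tau>) (X i) \<le> ?w \<tau>" for i
      proof (intro AE_I2)
        fix \<tau>
        show "indicator {0..t} \<tau> * green_op (t - \<tau>) (source u \<tau>) (X i) \<le> ?w \<tau>"
        proof (cases "\<tau> \<in> {0..t}")
          case True
          have "green_op (t - \<tau>) (source u \<tau>) (X i) \<le> ennreal (potential \<tau>) * free (t - \<tau> + \<tau>) (X i)"
            using True u by (intro green_op_source_dominated) auto
          also have "\<dots> \<le> ennreal (potential \<tau>) * ennreal m"
            using t by (intro mult_left_mono free_bounded) auto
          finally show ?thesis using True by simp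
        qed simp
      qed
      show "AE \<tau> in lebesgue. (\<lambda>i. indicator {0..t} \<tau> * green_op (t - \<tau>) (source u \<tau>) (X i))
          \<longlonglongrightarrow> indicator {0..t} \<tau> * green_op (t - \<tau>) (source u \<tau>) x"
      proof (intro AE_I2)
        fix \<tau>
        show "(\<lambda>i. indicator {0..t} \<tau> * green_op (t - \<tau>) (source u \<tau>) (X i))
          \<longlonglongrightarrow> indicator {0..t} \<tau> * green_op (t - \<tau>) (source u \<tau>) x"
        proof (cases "\<tau> \<in> {0..t}")
          case True
          have cont: "continuous_on UNIV (source u \<tau>)"
            unfolding source_def using True u p_gt_1 A_continuous
            by (intro continuous_on_ennreal continuous_intros continuous_on_powr') (auto simp: dominated_def)
          have "source u \<tau> y \<le> ennreal (potential \<tau>) * ennreal m" for y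
            using source_dominated[OF u(1), of \<tau> y] mult_left_mono[OF free_bounded[of \<tau> y], of "ennreal (potential \<tau>)"] True
            by (auto intro: order_trans)
          then have "continuous_on UNIV (green_op (t - \<tau>) (source u \<tau>))"
            using cont True by (intro green_op_continuous_on) (auto simp: ennreal_mult_less_top)
          then show ?thesis
            using True by (intro ennreal_tendsto_cmult continuous_on_tendsto_compose[where f = "green_op (t - \<tau>) (source u \<tau>)"] X) auto
        qed simp
      qed
    qed (use duhamel_integrand_measurable_time[OF meas] in simp_all)
    then show "(duhamel u t \<circ> X) \<longlonglongrightarrow> duhamel u t x"
      by (simp add: duhamel_def comp_def)
  qed
  ultimately show ?thesis
    unfolding picard_map_def by (intro continuous_on_add_ennreal) auto
qed

text \<open>Between s and t only the mass that does not jump is kept, and the source after time s is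
  discarded. This controls how fast a solution can decrease.\<close>

lemma picard_map_increment_lower:
  assumes meas: "(\<lambda>(t, x). u t x) \<in> borel_measurable (lebesgue \<Otimes>\<^sub>M borel)" and st: "0 \<le> s" "s \<le> t"
  shows "ennreal (exp (- mass * (t - s))) * picard_map u s x \<le> picard_map u t x"
proof -
  let ?e = "ennreal (exp (- mass * (t - s)))"
  have "?e * free s x \<le> green_op (t - s) (free s) x" using st by (intro green_op_ge) auto
  also have "\<dots> = free t x" using st free_semigroup[of "t - s" s x] by simp
  finally have 1: "?e * free s x \<le> free t x" .
  have "?e * duhamel u s x = (\<integral>\<^sup>+ \<tau>. ?e * (indicator {0..s} \<tau> * green_op (s - \<tau>) (source u \<tau>) x) \<partial>lebesgue)"
    unfolding duhamel_def using duhamel_integrand_measurable_time[OF meas] by (subst nn_integral_cmult) auto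
  also have "\<dots> \<le> duhamel u t x"
    unfolding duhamel_def
  proof (intro nn_integral_mono)
    fix \<tau>
    show "?e * (indicator {0..s} \<tau> * green_op (s - \<tau>) (source u \<tau>) x) \<le> indicator {0..t} \<tau> * green_op (t - \<tau>) (source u \<tau>) x"
    proof (cases "\<tau> \<in> {0..s}")
      case True
      note [measurable] = source_measurable_space[OF meas]
      have "?e * green_op (s - \<tau>) (source u \<tau>) x \<le> green_op (t - s) (green_op (s - \<tau>) (source u \<tau>)) x"
        using st by (intro green_op_ge) auto
      also have "\<dots> = green_op (t - \<tau>) (source u \<tau>) x"
        using True st green_op_semigroup[of "source u \<tau>" "t - s" "s - \<tau>" x] by simp
      finally show ?thesis using True st by simp
    qed simp
  qed
  finally have "?e * duhamel u s x \<le> duhamel u t x" .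
  with 1 show ?thesis unfolding picard_map_def distrib_left by (rule add_mono)
qed

text \<open>The first error term comes from mass that jumps between s and t. The free part yields it
  once; the source before s yields it with the factor \<open>potential \<tau>\<close>, hence at most
  once more after integration, whence the 2. The last term is the source released between s and
  t.\<close>

lemma picard_map_increment_upper:
  assumes meas: "(\<lambda>(t, x). u t x) \<in> borel_measurable (lebesgue \<Otimes>\<^sub>M borel)" and u: "dominated u" and st: "0 \<le> s" "s \<le> t"
  shows "picard_map u t x \<le> picard_map u s x
    + 2 * (ennreal ((t - s) * exp (mass * (t - s))) * green_op (t - s) (nconv j (free s)) x)
    + ennreal (2 * (C\<^sub>A * (2 * K\<^sub>0) powr (p - 1)) * (t - s)) * free t x"
proof -
  define r where "r = t - s"
  have r: "0 \<le> r" using st by (simp add: r_def)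
  define \<rho> where "\<rho> = ennreal (r * exp (mass * r))"
  define Q where "Q = green_op r (nconv j (free s)) x"
  define k where "k = 2 * (C\<^sub>A * (2 * K\<^sub>0) powr (p - 1))"
  have k: "0 \<le> k" using C_pos by (simp add: k_def)
  note [measurable] = source_measurable_space[OF meas] duhamel_integrand_measurable_time[OF meas]
  have "free t x = green_op r (free s) x"
    using st free_semigroup[of r s x] r by (simp add: r_def)
  also have "\<dots> \<le> free s x + \<rho> * Q"
    unfolding \<rho>_def Q_def using r by (intro green_op_le_increment) auto
  finally have 1: "free t x \<le> free s x + \<rho> * Q" .
  have pt: "indicator {0..t} \<tau> * green_op (t - \<tau>) (source u \<tau>) x
      \<le> indicator {0..s} \<tau> * green_op (s - \<tau>) (source u \<tau>) x + (indicator {0..} \<tau> * ennreal (potential \<tau>)) * (\<rho> * Q)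
        + indicator {s..t} \<tau> * (ennreal k * free t x)" for \<tau>
  proof (cases "\<tau> \<in> {0..s}")
    case True
    then have \<tau>: "0 \<le> \<tau>" "\<tau> \<le> s" by auto
    have "green_op (t - \<tau>) (source u \<tau>) x = green_op r (green_op (s - \<tau>) (source u \<tau>)) x"
      using \<tau> r green_op_semigroup[of "source u \<tau>" r "s - \<tau>" x] by (simp add: r_def)
    also have "\<dots> \<le> green_op (s - \<tau>) (source u \<tau>) x + \<rho> * green_op r (nconv j (green_op (s - \<tau>) (source u \<tau>))) x"
      unfolding \<rho>_def using r by (intro green_op_le_increment) auto
    also have "green_op r (nconv j (green_op (s - \<tau>) (source u \<tau>))) x
        \<le> green_op r (nconv j (\<lambda>y. ennreal (potential \<tau>) * free s y)) x"
      using \<tau> green_op_source_dominated[OF u \<tau>(1), of "s - \<tau>"] by (intro green_op_mono nconv_mono) auto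
    also have "\<dots> = ennreal (potential \<tau>) * Q"
    proof -
      have "nconv j (\<lambda>y. ennreal (potential \<tau>) * free s y) = (\<lambda>y. ennreal (potential \<tau>) * nconv j (free s) y)"
        by (intro ext nconv_cmult) simp_all
      then show ?thesis by (simp add: Q_def green_op_cmult)
    qed
    finally have "green_op (t - \<tau>) (source u \<tau>) x \<le> green_op (s - \<tau>) (source u \<tau>) x + ennreal (potential \<tau>) * (\<rho> * Q)"
      by (simp add: mult_left_mono mult.left_commute)
    then show ?thesis using \<tau> st by (simp add: add_increasing2)
  next
    case False
    show ?thesis
    proof (cases "\<tau> \<in> {0..t}")
      case True
      have "green_op (t - \<tau>) (source u \<tau>) x \<le> ennreal (potential \<tau>) * free (t - \<tau> + \<tau>) x"
        using True by (intro green_op_source_dominated u) auto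
      also have "\<dots> \<le> ennreal k * free t x"
        unfolding k_def using potential_le by (auto intro!: mult_right_mono ennreal_leI)
      finally show ?thesis using True False by (simp add: add_increasing)
    qed simp
  qed
  have "duhamel u t x \<le> (\<integral>\<^sup>+ \<tau>. indicator {0..s} \<tau> * green_op (s - \<tau>) (source u \<tau>) x + (indicator {0..} \<tau> * ennreal (potential \<tau>)) * (\<rho> * Q)
        + indicator {s..t} \<tau> * (ennreal k * free t x) \<partial>lebesgue)"
    unfolding duhamel_def by (intro nn_integral_mono pt)
  also have "\<dots> = duhamel u s x + (\<integral>\<^sup>+ \<tau>. indicator {0..} \<tau> * ennreal (potential \<tau>) \<partial>lebesgue) * (\<rho> * Q) + ennreal r * (ennreal k * free t x)"
  proof -
    have "{s..t} \<in> sets lebesgue" by simp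
    then have [measurable]: "indicator {s..t} \<in> borel_measurable lebesgue"
      by (rule borel_measurable_indicator)
    have "(\<integral>\<^sup>+ \<tau>. indicator {s..t} \<tau> * (ennreal k * free t x) \<partial>lebesgue) = ennreal r * (ennreal k * free t x)"
      using st by (subst nn_integral_multc) (auto simp: r_def)
    then show ?thesis
      unfolding duhamel_def by (subst nn_integral_add, simp, simp, subst nn_integral_add) (auto simp: nn_integral_multc)
  qed
  also have "\<dots> \<le> duhamel u s x + 1 * (\<rho> * Q) + ennreal r * (ennreal k * free t x)"
    using K_small unfolding potential_def by (intro add_mono mult_right_mono) auto
  finally have "picard_map u t x \<le> (free s x + \<rho> * Q) + (duhamel u s x + 1 * (\<rho> * Q) + ennreal r * (ennreal k * free t x))"
    unfolding picard_map_def by (intro add_mono 1)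
  also have "\<dots> = picard_map u s x + 2 * (\<rho> * Q) + ennreal (k * r) * free t x"
  proof -
    have "ennreal (k * r) * free t x = ennreal r * (ennreal k * free t x)"
      using r k by (simp add: ennreal_mult mult_ac)
    then show ?thesis by (simp only: picard_map_def mult_2 mult_1_left add_ac)
  qed
  finally show ?thesis by (simp add: \<rho>_def Q_def k_def r_def)
qed

end

section \<open>Uniqueness under a common weighted bound\<close>

context semilinear_problem
begin

text \<open>The difference is first bounded by M times the weight, and every use of the contraction
  halves this constant. M may be any common bound on [0, T], and the inhomogeneity F may be
  arbitrary.\<close>

lemma mild_solution_unique:
  assumes u_meas: "(\<lambda>(t, x). u t x) \<in> borel_measurable (lebesgue \<Otimes>\<^sub>M borel)"
    and v_meas: "(\<lambda>(t, x). v t x) \<in> borel_measurable (lebesgue \<Otimes>\<^sub>M borel)"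
    and u: "\<And>t x. 0 \<le> t \<Longrightarrow> t \<le> T \<Longrightarrow> 0 \<le> u t x \<and> u t x \<le> M * japanese_bracket x powr - b"
    and v: "\<And>t x. 0 \<le> t \<Longrightarrow> t \<le> T \<Longrightarrow> 0 \<le> v t x \<and> v t x \<le> M * japanese_bracket x powr - b"
    and u_eq: "\<And>t x. 0 \<le> t \<Longrightarrow> t \<le> T \<Longrightarrow> ennreal (u t x) = F t x + duhamel u t x"
    and v_eq: "\<And>t x. 0 \<le> t \<Longrightarrow> t \<le> T \<Longrightarrow> ennreal (v t x) = F t x + duhamel v t x"
    and M: "0 \<le> M" and t: "0 \<le> t" "t \<le> T"
  shows "u t x = v t x"
proof -
  obtain \<beta> where \<beta>: "0 \<le> \<beta>" "\<And>x. nconv j (weight (- b)) x \<le> ennreal \<beta> * weight (- b) x"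
    using weight_eigen by blast
  define \<mu> where "\<mu> = \<beta> + lipschitz_rate M"
  have \<mu>: "0 \<le> \<mu>" using \<beta> C_pos p_gt_1 by (simp add: \<mu>_def lipschitz_rate_def)
  \<comment> \<open>Stated for its own u and v, so that it can be used again with the two solutions
    exchanged.\<close>
  have one_sided: "u t x \<le> v t x + d / 2 * exp (\<mu> * t) * japanese_bracket x powr - b"
    if bound: "\<And>t x. 0 \<le> t \<Longrightarrow> t \<le> T \<Longrightarrow> \<bar>u t x - v t x\<bar> \<le> d * exp (\<mu> * t) * japanese_bracket x powr - b"
      and d: "0 \<le> d" and t: "0 \<le> t" "t \<le> T"
      and uv: "(\<lambda>(t, x). u t x) \<in> borel_measurable (lebesgue \<Otimes>\<^sub>M borel)" "(\<lambda>(t, x). v t x) \<in> borel_measurable (lebesgue \<Otimes>\<^sub>M borel)"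
        "\<And>t x. 0 \<le> t \<Longrightarrow> t \<le> T \<Longrightarrow> 0 \<le> u t x \<and> u t x \<le> M * japanese_bracket x powr - b"
        "\<And>t x. 0 \<le> t \<Longrightarrow> t \<le> T \<Longrightarrow> 0 \<le> v t x \<and> v t x \<le> M * japanese_bracket x powr - b"
        "\<And>t x. 0 \<le> t \<Longrightarrow> t \<le> T \<Longrightarrow> ennreal (u t x) = F t x + duhamel u t x"
        "\<And>t x. 0 \<le> t \<Longrightarrow> t \<le> T \<Longrightarrow> ennreal (v t x) = F t x + duhamel v t x"
    for u v d t x
  proof -
    let ?e = "d / 2 * exp (\<mu> * t) * japanese_bracket x powr - b"
    have "ennreal (u t x) = F t x + duhamel u t x" by (rule uv(5)[OF t])
    also have "\<dots> \<le> F t x + (duhamel v t x + ennreal ?e)"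
      unfolding \<mu>_def
    proof (intro add_left_mono duhamel_contraction[OF \<beta> uv(1,2) _ _ M d _ t(1)])
      show "0 \<le> u \<tau> y \<and> u \<tau> y \<le> M * japanese_bracket y powr - b"
        "0 \<le> v \<tau> y \<and> v \<tau> y \<le> M * japanese_bracket y powr - b" if "0 \<le> \<tau>" "\<tau> \<le> t" for \<tau> y
        using uv(3)[of \<tau> y] uv(4)[of \<tau> y] that t by auto
      show "\<bar>u \<tau> y - v \<tau> y\<bar> \<le> d * exp ((\<beta> + lipschitz_rate M) * \<tau>) * japanese_bracket y powr - b"
        if "0 \<le> \<tau>" "\<tau> \<le> t" for \<tau> y
        using bound[of \<tau> y] that t by (simp add: \<mu>_def)
    qed
    also have "\<dots> = ennreal (v t x) + ennreal ?e" by (simp add: uv(6)[OF t] add.assoc)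
    also have "\<dots> = ennreal (v t x + ?e)" using uv(4)[OF t, of x] d by (intro ennreal_plus[symmetric]) auto
    finally show ?thesis using uv(4)[OF t, of x] d by (subst (asm) ennreal_le_iff) auto
  qed
  have iter: "\<bar>u t x - v t x\<bar> \<le> M / 2 ^ k * exp (\<mu> * t) * japanese_bracket x powr - b" if "0 \<le> t" "t \<le> T" for k t x
    using that
  proof (induction k arbitrary: t x)
    case 0
    have "\<bar>u t x - v t x\<bar> \<le> M * japanese_bracket x powr - b * 1" using u[OF 0, of x] v[OF 0, of x] by auto
    also have "\<dots> \<le> M * japanese_bracket x powr - b * exp (\<mu> * t)"
      using M \<mu> 0 by (intro mult_left_mono) auto
    finally show ?case by (simp add: mult_ac)
  next
    case (Suc k)
    have le: "\<bar>v t x - u t x\<bar> \<le> M / 2 ^ k * exp (\<mu> * t) * japanese_bracket x powr - b" if "0 \<le> t" "t \<le> T" for t x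
      using Suc.IH[OF that, of x] by (simp add: abs_minus_commute)
    have "u t x \<le> v t x + (M / 2 ^ k) / 2 * exp (\<mu> * t) * japanese_bracket x powr - b"
      using Suc.IH Suc.prems M by (intro one_sided u_meas v_meas u v u_eq v_eq) auto
    moreover have "v t x \<le> u t x + (M / 2 ^ k) / 2 * exp (\<mu> * t) * japanese_bracket x powr - b"
      using le Suc.prems M by (intro one_sided u_meas v_meas u v u_eq v_eq) auto
    ultimately show ?case by (simp add: abs_le_iff field_simps)
  qed
  have "(\<lambda>k. M * exp (\<mu> * t) * japanese_bracket x powr - b * (1 / 2) ^ k) \<longlonglongrightarrow> M * exp (\<mu> * t) * japanese_bracket x powr - b * 0"
    by (intro tendsto_mult_left LIMSEQ_power_zero) auto
  then have "\<bar>u t x - v t x\<bar> \<le> M * exp (\<mu> * t) * japanese_bracket x powr - b * 0"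
  proof (rule LIMSEQ_le_const)
    have "\<bar>u t x - v t x\<bar> \<le> M * exp (\<mu> * t) * japanese_bracket x powr - b * (1 / 2) ^ k" for k
      using iter[OF t, of x k] by (simp add: power_divide mult_ac)
    then show "\<exists>N. \<forall>k\<ge>N. \<bar>u t x - v t x\<bar> \<le> M * exp (\<mu> * t) * japanese_bracket x powr - b * (1 / 2) ^ k" by blast
  qed
  then show ?thesis by simp
qed

end

section \<open>Existence by Picard iteration\<close>

context small_data
begin

text \<open>At times t >= 0 the map has finite values on dominated functions, so
  \<open>enn2real\<close> loses nothing there.\<close>

primrec picard :: "nat \<Rightarrow> real \<Rightarrow> real ^ 'n \<Rightarrow> real" where
  "picard 0 = (\<lambda>t x. 0)"
| "picard (Suc k) = (\<lambda>t x. enn2real (picard_map (picard k) t x))"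

lemma picard_measurable: "(\<lambda>(t, x). picard k t x) \<in> borel_measurable (lebesgue \<Otimes>\<^sub>M borel)"
proof (induction k)
  case (Suc k)
  show ?case using picard_map_measurable[OF Suc] unfolding picard.simps case_prod_beta' by measurable
qed simp

lemma picard_dominated: "dominated (picard k)"
proof (induction k)
  case (Suc k)
  have "ennreal (picard (Suc k) t x) = picard_map (picard k) t x" if "0 \<le> t" for t x
    using picard_map_finite[OF Suc that, of x] by simp
  then show ?case using picard_map_dominated[OF Suc] by (simp add: dominated_def)
qed (simp add: dominated_def)

lemma picard_Suc: "0 \<le> t \<Longrightarrow> ennreal (picard (Suc k) t x) = picard_map (picard k) t x"
  using picard_map_finite[OF picard_dominated, of t k x] by simp

lemma picard_continuous: "0 \<le> t \<Longrightarrow> continuous_on UNIV (picard k t)"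
proof (induction k arbitrary: t)
  case (Suc k)
  have c: "continuous_on UNIV (picard_map (picard k) t)"
    by (rule picard_map_continuous[OF picard_measurable picard_dominated Suc.IH Suc.prems])
  show ?case
    unfolding continuous_on_sequentially
  proof safe
    fix X :: "nat \<Rightarrow> real ^ 'n" and x assume "X \<longlonglongrightarrow> x"
    then have "(\<lambda>i. picard_map (picard k) t (X i)) \<longlonglongrightarrow> picard_map (picard k) t x"
      by (intro continuous_on_tendsto_compose[OF c]) auto
    then have "(\<lambda>i. ennreal (picard (Suc k) t (X i))) \<longlonglongrightarrow> ennreal (picard (Suc k) t x)"
      unfolding picard_Suc[OF Suc.prems] .
    then show "(picard (Suc k) t \<circ> X) \<longlonglongrightarrow> picard (Suc k) t x"
      by (simp add: comp_def tendsto_ennreal_iff)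
  qed
qed simp

lemma mild_solution_exists:
  obtains u where "(\<lambda>(t, x). u t x) \<in> borel_measurable (lebesgue \<Otimes>\<^sub>M borel)" "dominated u"
    "\<And>t. 0 \<le> t \<Longrightarrow> continuous_on UNIV (u t)" "\<And>t x. 0 \<le> t \<Longrightarrow> ennreal (u t x) = picard_map u t x"
proof -
  obtain \<beta> where \<beta>: "0 \<le> \<beta>" "\<And>x. nconv j (weight (- b)) x \<le> ennreal \<beta> * weight (- b) x"
    using weight_eigen by blast
  define M where "M = 2 * K\<^sub>0"
  have M: "0 \<le> M" using K0_nonneg by (simp add: M_def)
  define \<mu> where "\<mu> = \<beta> + lipschitz_rate M"
  have \<mu>: "0 \<le> \<mu>" using \<beta> C_pos p_gt_1 by (simp add: \<mu>_def lipschitz_rate_def)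
  let ?E = "\<lambda>t x. exp (\<mu> * t) * japanese_bracket x powr - b"
  have contract: "picard_map u t x \<le> picard_map v t x + ennreal (d / 2 * ?E t x)"
    if "(\<lambda>(t, x). u t x) \<in> borel_measurable (lebesgue \<Otimes>\<^sub>M borel)" "(\<lambda>(t, x). v t x) \<in> borel_measurable (lebesgue \<Otimes>\<^sub>M borel)"
      "dominated u" "dominated v" "0 \<le> d" "0 \<le> t"
      "\<And>t x. 0 \<le> t \<Longrightarrow> \<bar>u t x - v t x\<bar> \<le> d * ?E t x" for u v d t x
  proof -
    have "duhamel u t x \<le> duhamel v t x + ennreal (d / 2 * exp (\<mu> * t) * japanese_bracket x powr - b)"
      unfolding \<mu>_def
    proof (rule duhamel_contraction[OF \<beta> that(1,2) _ _ M that(5) _ that(6)])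
      show "0 \<le> u \<tau> y \<and> u \<tau> y \<le> M * japanese_bracket y powr - b" "0 \<le> v \<tau> y \<and> v \<tau> y \<le> M * japanese_bracket y powr - b"
        if "0 \<le> \<tau>" for \<tau> y
        unfolding M_def by (rule dominated_bound_uniform; fact)+
      show "\<bar>u \<tau> y - v \<tau> y\<bar> \<le> d * exp ((\<beta> + lipschitz_rate M) * \<tau>) * japanese_bracket y powr - b" if "0 \<le> \<tau>" for \<tau> y
        using \<open>\<And>t x. 0 \<le> t \<Longrightarrow> \<bar>u t x - v t x\<bar> \<le> d * ?E t x\<close>[OF that, of y] by (simp add: \<mu>_def mult.assoc)
    qed
    then show ?thesis unfolding picard_map_def add.assoc by (intro add_left_mono) (simp add: mult.assoc)
  qed
  have real_le: "u \<le> v + e" if "ennreal u \<le> ennreal v + ennreal e" "0 \<le> v" "0 \<le> e" for u v e :: real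
    using that by (simp add: ennreal_plus[symmetric] del: ennreal_plus)
  have E: "0 \<le> ?E t x" for t x by simp
  have step: "\<bar>picard (Suc k) t x - picard k t x\<bar> \<le> M / 2 ^ k * ?E t x" if "0 \<le> t" for k t x
    using that
  proof (induction k arbitrary: t x)
    case 0
    have "0 \<le> picard 1 t x" "picard 1 t x \<le> M * japanese_bracket x powr - b * 1"
      using dominated_bound_uniform[OF picard_dominated 0, of 1 x] by (auto simp: M_def)
    moreover have "M * japanese_bracket x powr - b * 1 \<le> M * japanese_bracket x powr - b * exp (\<mu> * t)"
      using M \<mu> 0 by (intro mult_left_mono) auto
    ultimately show ?case by (simp add: mult_ac)
  next
    case (Suc k)
    let ?d = "M / 2 ^ k"
    have d: "0 \<le> ?d / 2 * ?E t x" using M by simp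
    have nn: "0 \<le> picard i t x" for i
      using picard_dominated Suc.prems by (auto simp: dominated_def)
    have "ennreal (picard (Suc (Suc k)) t x) \<le> ennreal (picard (Suc k) t x) + ennreal (?d / 2 * ?E t x)"
      unfolding picard_Suc[OF Suc.prems] using M Suc
      by (intro contract picard_measurable picard_dominated) auto
    moreover have "ennreal (picard (Suc k) t x) \<le> ennreal (picard (Suc (Suc k)) t x) + ennreal (?d / 2 * ?E t x)"
      unfolding picard_Suc[OF Suc.prems] using M Suc.prems Suc.IH
      by (intro contract picard_measurable picard_dominated) (auto simp: abs_minus_commute)
    ultimately have "picard (Suc (Suc k)) t x \<le> picard (Suc k) t x + ?d / 2 * ?E t x"
      "picard (Suc k) t x \<le> picard (Suc (Suc k)) t x + ?d / 2 * ?E t x"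
      using real_le nn d by blast+
    then show ?case by (simp add: abs_le_iff field_simps del: picard.simps)
  qed
  \<comment> \<open>The factor 1 - 1 / 2^l is the exact geometric sum of the steps k, ..., k + l -
    1; with the limit value 2 alone the induction on l would not close.\<close>
  have tail: "\<bar>picard (k + l) t x - picard k t x\<bar> \<le> 2 * (M / 2 ^ k * ?E t x) * (1 - 1 / 2 ^ l)" if t: "0 \<le> t" for k l t x
  proof (induction l)
    case (Suc l)
    have "\<bar>picard (k + Suc l) t x - picard k t x\<bar> \<le> \<bar>picard (Suc (k + l)) t x - picard (k + l) t x\<bar> + \<bar>picard (k + l) t x - picard k t x\<bar>"
      by (simp del: picard.simps)
    also have "\<dots> \<le> M / 2 ^ (k + l) * ?E t x + 2 * (M / 2 ^ k * ?E t x) * (1 - 1 / 2 ^ l)"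
      by (intro add_mono step t Suc)
    also have "\<dots> = 2 * (M / 2 ^ k * ?E t x) * (1 - 1 / 2 ^ Suc l)"
      by (simp add: power_add field_simps)
    finally show ?case .
  qed simp
  have tail': "\<bar>picard l t x - picard k t x\<bar> \<le> 2 * (M / 2 ^ k * ?E t x)" if t: "0 \<le> t" "k \<le> l" for k l t x
  proof -
    have "2 * (M / 2 ^ k * ?E t x) * (1 - 1 / 2 ^ (l - k)) \<le> 2 * (M / 2 ^ k * ?E t x) * 1"
      using M by (intro mult_left_mono) auto
    then show ?thesis using tail[OF t(1), of k "l - k" x] t by simp
  qed
  define u where "u t x = lim (\<lambda>k. picard k t x)" for t x
  have lim: "(\<lambda>k. picard k t x) \<longlonglongrightarrow> u t x" if t: "0 \<le> t" for t x
  proof -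
    have to_0: "(\<lambda>k. 2 * M * ?E t x * (1 / 2) ^ k) \<longlonglongrightarrow> 2 * M * ?E t x * 0"
      by (intro tendsto_mult_left LIMSEQ_power_zero) auto
    have "Cauchy (\<lambda>k. picard k t x)"
    proof (rule metric_CauchyI)
      fix e :: real assume "0 < e"
      then obtain N where N: "\<And>k. N \<le> k \<Longrightarrow> 2 * M * ?E t x * (1 / 2) ^ k < e / 2"
        using order_tendstoD(2)[OF to_0, of "e / 2"] by (auto simp: eventually_sequentially)
      have "dist (picard k t x) (picard N t x) < e / 2" if "N \<le> k" for k
      proof -
        have "2 * (M / 2 ^ N * ?E t x) = 2 * M * ?E t x * (1 / 2) ^ N" by (simp add: power_divide)
        then show ?thesis using tail'[OF t that, of x] N[of N] unfolding dist_real_def by linarith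
      qed
      then have "dist (picard k t x) (picard l t x) < e" if "N \<le> k" "N \<le> l" for k l
        using that by (meson dist_triangle_half_l)
      then show "\<exists>N. \<forall>k\<ge>N. \<forall>l\<ge>N. dist (picard k t x) (picard l t x) < e" by blast
    qed
    then show ?thesis unfolding u_def by (simp add: Cauchy_convergent_iff convergent_LIMSEQ_iff)
  qed
  have u_meas: "(\<lambda>(t, x). u t x) \<in> borel_measurable (lebesgue \<Otimes>\<^sub>M borel)"
    using picard_measurable unfolding u_def case_prod_beta' by (intro borel_measurable_lim_metric) simp
  have u_dom: "dominated u"
    unfolding dominated_def
  proof safe
    fix t x assume t: "0 \<le> (t :: real)"
    have P: "0 \<le> picard k t x" "ennreal (picard k t x) \<le> 2 * free t x" for k
      using picard_dominated t by (auto simp: dominated_def)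
    show "0 \<le> u t x" using LIMSEQ_le_const[OF lim[OF t]] P by blast
    have "(\<lambda>k. ennreal (picard k t x)) \<longlonglongrightarrow> ennreal (u t x)" using lim[OF t] by (rule tendsto_ennrealI)
    then show "ennreal (u t x) \<le> 2 * free t x" using LIMSEQ_le_const2 P by blast
  qed
  have close: "\<bar>u t x - picard k t x\<bar> \<le> 2 * (M / 2 ^ k) * ?E t x" if t: "0 \<le> t" for k t x
  proof -
    have "(\<lambda>l. \<bar>picard l t x - picard k t x\<bar>) \<longlonglongrightarrow> \<bar>u t x - picard k t x\<bar>"
      by (intro tendsto_intros lim t)
    then show ?thesis
      by (rule LIMSEQ_le_const2) (use tail'[OF t, of k _ x] in \<open>auto simp: mult.assoc intro!: exI[of _ k]\<close>)
  qed
  have u_cont: "continuous_on UNIV (u t)" if t: "0 \<le> t" for t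
  proof (rule uniform_limit_theorem)
    show "uniform_limit UNIV (\<lambda>k. picard k t) (u t) sequentially"
    proof (rule uniform_limitI)
      fix e :: real assume "0 < e"
      have "(\<lambda>k. 2 * M * exp (\<mu> * t) * (1 / 2) ^ k) \<longlonglongrightarrow> 2 * M * exp (\<mu> * t) * 0"
        by (intro tendsto_mult_left LIMSEQ_power_zero) auto
      then have "\<forall>\<^sub>F k in sequentially. 2 * M * exp (\<mu> * t) * (1 / 2) ^ k < e"
        using \<open>0 < e\<close> by (intro order_tendstoD(2)) auto
      then show "\<forall>\<^sub>F k in sequentially. \<forall>x\<in>UNIV. dist (picard k t x) (u t x) < e"
      proof eventually_elim
        case (elim k)
        show ?case
        proof
          fix x :: "real ^ 'n"
          have "japanese_bracket x powr - b \<le> 1"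
            using japanese_bracket_ge_1[of x] b_nonneg powr_mono[of "- b" 0 "japanese_bracket x"] by simp
          then have "2 * (M / 2 ^ k) * ?E t x \<le> 2 * (M / 2 ^ k) * (exp (\<mu> * t) * 1)"
            using M by (intro mult_left_mono) auto
          then have "\<bar>u t x - picard k t x\<bar> < e"
            using close[OF t, of x k] elim by (simp add: power_divide mult_ac)
          then show "dist (picard k t x) (u t x) < e" by (simp add: dist_real_def abs_minus_commute)
        qed
      qed
    qed
  qed (use picard_continuous t in auto)
  have u_eq: "ennreal (u t x) = picard_map u t x" if t: "0 \<le> t" for t x
  proof -
    obtain w where w: "0 \<le> w" "picard_map u t x = ennreal w"
      using picard_map_finite[OF u_dom t, of x] by (cases "picard_map u t x") auto
    have nn: "0 \<le> picard k t x" for k using picard_dominated t by (auto simp: dominated_def)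
    let ?e = "\<lambda>k. 2 * (M / 2 ^ k) / 2 * ?E t x"
    \<comment> \<open>The map is taken to the limit by its own contraction estimate: if
      \<open>picard k\<close> is close to u, then \<open>picard (Suc k)\<close> is close to the
      image of u.\<close>
    have near: "\<bar>w - picard (Suc k) t x\<bar> \<le> ?e k" for k
    proof -
      have "ennreal w \<le> ennreal (picard (Suc k) t x) + ennreal (?e k)"
        unfolding picard_Suc[OF t] w(2)[symmetric] using close M t
        by (intro contract u_meas picard_measurable u_dom picard_dominated) auto
      moreover have "ennreal (picard (Suc k) t x) \<le> ennreal w + ennreal (?e k)"
        unfolding picard_Suc[OF t] w(2)[symmetric] using close M t
        by (intro contract u_meas picard_measurable u_dom picard_dominated) (auto simp: abs_minus_commute)
      moreover have "0 \<le> ?e k" using M by simp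
      ultimately have "w \<le> picard (Suc k) t x + ?e k" "picard (Suc k) t x \<le> w + ?e k"
        using real_le nn w(1) by blast+
      then show ?thesis by (simp add: abs_le_iff del: picard.simps)
    qed
    have "(\<lambda>k. M * ?E t x * (1 / 2) ^ k) \<longlonglongrightarrow> M * ?E t x * 0"
      by (intro tendsto_mult_left LIMSEQ_power_zero) auto
    then have "(\<lambda>k. ?e k) \<longlonglongrightarrow> 0" by (simp add: power_divide mult_ac)
    then have "(\<lambda>k. w - picard (Suc k) t x) \<longlonglongrightarrow> 0"
      by (rule Lim_null_comparison[rotated]) (use near in \<open>auto simp del: picard.simps\<close>)
    moreover have "(\<lambda>k. w - picard (Suc k) t x) \<longlonglongrightarrow> w - u t x"
      by (intro tendsto_diff tendsto_const LIMSEQ_Suc lim t)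
    ultimately have "w - u t x = 0" by (rule LIMSEQ_unique[rotated])
    then show ?thesis using w by simp
  qed
  show ?thesis by (rule that[OF u_meas u_dom u_cont u_eq])
qed

text \<open>An increase of u is bounded by the upper increment lemma, a decrease by the lower one,
  and both bounds are t - s times free evolutions. Their sup norms follow from the eigenvalue
  inequality for \<open>weight (- b)\<close>, their integrals by duality from the one for
  \<open>weight b\<close>.\<close>

lemma time_lipschitz:
  assumes meas: "(\<lambda>(t, x). u t x) \<in> borel_measurable (lebesgue \<Otimes>\<^sub>M borel)" and u: "dominated u"
    and eq: "\<And>t x. 0 \<le> t \<Longrightarrow> ennreal (u t x) = picard_map u t x"
  obtains C where "0 \<le> C"
    "\<And>s t x. 0 \<le> s \<Longrightarrow> s \<le> t \<Longrightarrow> t \<le> T \<Longrightarrow> weight b x * ennreal \<bar>u t x - u s x\<bar> \<le> ennreal (C * (t - s))"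
    "\<And>s t. 0 \<le> s \<Longrightarrow> s \<le> t \<Longrightarrow> t \<le> T \<Longrightarrow> (\<integral>\<^sup>+ x. weight b x * ennreal \<bar>u t x - u s x\<bar> \<partial>lborel) \<le> ennreal (C * (t - s))"
proof -
  obtain \<beta> where \<beta>: "0 \<le> \<beta>" "\<And>x. nconv j (weight (- b)) x \<le> ennreal \<beta> * weight (- b) x"
    using weight_eigen by blast
  obtain \<gamma> where \<gamma>: "0 \<le> \<gamma>" "\<And>x. nconv j (weight b) x \<le> ennreal \<gamma> * weight b x"
    using weight_eigen by blast
  let ?W = "weight b :: real ^ 'n \<Rightarrow> ennreal" and ?V = "weight (- b) :: real ^ 'n \<Rightarrow> ennreal"
  define k where "k = 2 * (C\<^sub>A * (2 * K\<^sub>0) powr (p - 1))"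
  have k: "0 \<le> k" using C_pos by (simp add: k_def)
  \<comment> \<open>P and Q are maxima of a sup bound and an integral bound, so that
    \<open>combine\<close> serves both norms with one constant.\<close>
  define P where "P = max K\<^sub>0 (exp (\<gamma> * T) * m)"
  define Q where "Q = max (K\<^sub>0 * \<beta> * exp (\<beta> * T)) (exp (\<gamma> * T) * (\<gamma> * (exp (\<gamma> * T) * m)))"
  have P: "0 \<le> P" "K\<^sub>0 \<le> P" "exp (\<gamma> * T) * m \<le> P" using K0_nonneg by (auto simp: P_def)
  have Q: "0 \<le> Q" "K\<^sub>0 * \<beta> * exp (\<beta> * T) \<le> Q" "exp (\<gamma> * T) * (\<gamma> * (exp (\<gamma> * T) * m)) \<le> Q"
    using K0_nonneg \<beta> by (auto simp: Q_def le_max_iff_disj)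
  have green_weight: "green_op r (weight c) x \<le> ennreal (exp (e * T)) * weight c x"
    if "0 \<le> e" "\<And>x. nconv j (weight c) x \<le> ennreal e * weight c x" "0 \<le> r" "r \<le> T" for e c r x
  proof -
    have "green_op r (weight c) x \<le> ennreal (exp ((e - mass) * r)) * weight c x"
      using that by (intro green_op_eigen) auto
    also have "\<dots> \<le> ennreal (exp (e * T)) * weight c x"
    proof (intro mult_right_mono ennreal_leI)
      have "(e - mass) * r \<le> e * r" using mass_pos that by (intro mult_right_mono) auto
      also have "\<dots> \<le> e * T" using that by (intro mult_left_mono) auto
      finally show "exp ((e - mass) * r) \<le> exp (e * T)" by simp
    qed auto
    finally show ?thesis .
  qed
  have WV: "?W x * (c * ?V x) = c" for c x
    using weight_inverse[of b x] by (simp add: mult.left_commute)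
  have sup_free: "?W x * free s x \<le> ennreal P" if "0 \<le> s" for s x
  proof -
    have "?W x * free s x \<le> ?W x * (ennreal K\<^sub>0 * ?V x)" by (intro mult_left_mono free_le_weight that) auto
    also have "\<dots> \<le> ennreal P" unfolding WV using P by (intro ennreal_leI) auto
    finally show ?thesis .
  qed
  have int_green: "(\<integral>\<^sup>+ x. ?W x * green_op r f x \<partial>lborel) \<le> ennreal (exp (\<gamma> * T)) * (\<integral>\<^sup>+ x. ?W x * f x \<partial>lborel)"
    if "0 \<le> r" "r \<le> T" and [measurable]: "f \<in> borel_measurable borel" for r f
  proof -
    have "(\<integral>\<^sup>+ x. ?W x * green_op r f x \<partial>lborel) = (\<integral>\<^sup>+ x. green_op r ?W x * f x \<partial>lborel)"
      by (rule nn_integral_green_op_dual) measurable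
    also have "\<dots> \<le> (\<integral>\<^sup>+ x. ennreal (exp (\<gamma> * T)) * (?W x * f x) \<partial>lborel)"
      unfolding mult.assoc[symmetric] using \<gamma> that by (intro nn_integral_mono mult_right_mono green_weight) auto
    finally show ?thesis by (simp add: nn_integral_cmult)
  qed
  have int_free: "(\<integral>\<^sup>+ x. ?W x * free s x \<partial>lborel) \<le> ennreal (exp (\<gamma> * T) * m)" if "0 \<le> s" "s \<le> T" for s
  proof -
    have "(\<integral>\<^sup>+ x. ?W x * free s x \<partial>lborel) \<le> ennreal (exp (\<gamma> * T)) * ennreal m"
      unfolding free_def using that u0_integral
      by (intro order_trans[OF int_green]) (auto intro!: mult_left_mono)
    then show ?thesis using m_nonneg by (simp add: ennreal_mult)
  qed
  have sup_inc: "?W x * green_op r (nconv j (free s)) x \<le> ennreal Q" if "0 \<le> r" "r \<le> T" "0 \<le> s" for r s x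
  proof -
    have "nconv j (free s) y \<le> ennreal (K\<^sub>0 * \<beta>) * ?V y" for y
    proof -
      have "nconv j (free s) y \<le> nconv j (\<lambda>y. ennreal K\<^sub>0 * ?V y) y"
        by (intro nconv_mono free_le_weight that)
      also have "\<dots> = ennreal K\<^sub>0 * nconv j ?V y" by (rule nconv_cmult) measurable
      also have "\<dots> \<le> ennreal K\<^sub>0 * (ennreal \<beta> * ?V y)" by (intro mult_left_mono \<beta>) auto
      finally show ?thesis using K0_nonneg by (simp add: ennreal_mult' mult.assoc)
    qed
    then have "green_op r (nconv j (free s)) x \<le> green_op r (\<lambda>y. ennreal (K\<^sub>0 * \<beta>) * ?V y) x"
      by (intro green_op_mono)
    also have "\<dots> = ennreal (K\<^sub>0 * \<beta>) * green_op r ?V x" by (rule green_op_cmult) measurable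
    also have "\<dots> \<le> ennreal (K\<^sub>0 * \<beta>) * (ennreal (exp (\<beta> * T)) * ?V x)"
      using \<beta> that by (intro mult_left_mono green_weight) auto
    also have "\<dots> = ennreal (K\<^sub>0 * \<beta> * exp (\<beta> * T)) * ?V x"
      using K0_nonneg \<beta> by (simp add: ennreal_mult mult.assoc)
    finally have "?W x * green_op r (nconv j (free s)) x \<le> ?W x * (ennreal (K\<^sub>0 * \<beta> * exp (\<beta> * T)) * ?V x)"
      by (rule mult_left_mono) simp
    also have "\<dots> \<le> ennreal Q" unfolding WV using Q by (intro ennreal_leI) auto
    finally show ?thesis .
  qed
  have int_inc: "(\<integral>\<^sup>+ x. ?W x * green_op r (nconv j (free s)) x \<partial>lborel) \<le> ennreal Q" if "0 \<le> r" "r \<le> T" "0 \<le> s" "s \<le> T" for r s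
  proof -
    have "(\<integral>\<^sup>+ x. ?W x * nconv j (free s) x \<partial>lborel) = (\<integral>\<^sup>+ x. nconv j ?W x * free s x \<partial>lborel)"
      by (rule nn_integral_nconv_dual) measurable
    also have "\<dots> \<le> (\<integral>\<^sup>+ x. ennreal \<gamma> * (?W x * free s x) \<partial>lborel)"
      unfolding mult.assoc[symmetric] by (intro nn_integral_mono mult_right_mono \<gamma>) auto
    also have "\<dots> = ennreal \<gamma> * (\<integral>\<^sup>+ x. ?W x * free s x \<partial>lborel)"
      by (rule nn_integral_cmult) measurable
    also have "\<dots> \<le> ennreal \<gamma> * ennreal (exp (\<gamma> * T) * m)"
      by (intro mult_left_mono int_free that) auto
    finally have "(\<integral>\<^sup>+ x. ?W x * green_op r (nconv j (free s)) x \<partial>lborel) \<le> ennreal (exp (\<gamma> * T)) * (ennreal \<gamma> * ennreal (exp (\<gamma> * T) * m))"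
      using that by (intro order_trans[OF int_green]) (auto intro!: mult_left_mono)
    also have "\<dots> = ennreal (exp (\<gamma> * T) * (\<gamma> * (exp (\<gamma> * T) * m)))"
      using \<gamma> m_nonneg by (simp add: ennreal_mult)
    also have "\<dots> \<le> ennreal Q" using Q by (intro ennreal_leI) auto
    finally show ?thesis .
  qed
  \<comment> \<open>One majorant for both signs of the difference: the first summand covers a
    decrease, the other two an increase.\<close>
  define H where "H s t x = ennreal (2 * mass * (t - s)) * free s x
      + (ennreal (2 * ((t - s) * exp (mass * (t - s)))) * green_op (t - s) (nconv j (free s)) x + ennreal (k * (t - s)) * free t x)" for s t x
  have diff_le: "ennreal \<bar>u t x - u s x\<bar> \<le> H s t x" if st: "0 \<le> s" "s \<le> t" for s t x
  proof (cases "u s x \<le> u t x")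
    case True
    have us: "0 \<le> u s x" using u st by (auto simp: dominated_def)
    have "ennreal (u s x) + ennreal (u t x - u s x) = ennreal (u t x)"
      using True us by (subst ennreal_plus[symmetric]) auto
    also have "\<dots> \<le> ennreal (u s x) + 2 * (ennreal ((t - s) * exp (mass * (t - s))) * green_op (t - s) (nconv j (free s)) x) + ennreal (k * (t - s)) * free t x"
      using picard_map_increment_upper[OF meas u st, of x] eq st by (simp add: k_def)
    also have "\<dots> = ennreal (u s x) + (ennreal (2 * ((t - s) * exp (mass * (t - s)))) * green_op (t - s) (nconv j (free s)) x + ennreal (k * (t - s)) * free t x)"
      using st by (simp add: ennreal_mult add.assoc mult.assoc)
    finally have "ennreal (u t x - u s x) \<le> ennreal (2 * ((t - s) * exp (mass * (t - s)))) * green_op (t - s) (nconv j (free s)) x + ennreal (k * (t - s)) * free t x"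
      by (subst (asm) ennreal_add_left_cancel_le) auto
    then show ?thesis using True unfolding H_def by (simp add: add_increasing)
  next
    case False
    have us: "0 \<le> u s x" "ennreal (u s x) \<le> 2 * free s x" "0 \<le> u t x" using u st by (auto simp: dominated_def)
    have "ennreal (exp (- mass * (t - s)) * u s x) \<le> ennreal (u t x)"
      using picard_map_increment_lower[OF meas st, of x] eq st us by (simp add: ennreal_mult)
    then have "exp (- mass * (t - s)) * u s x \<le> u t x" using us by simp
    moreover have "(1 + (- mass * (t - s))) * u s x \<le> exp (- mass * (t - s)) * u s x"
      using us by (intro mult_right_mono exp_ge_add_one_self) auto
    ultimately have "u s x - u t x \<le> mass * (t - s) * u s x" by (simp add: algebra_simps)
    then have "ennreal \<bar>u t x - u s x\<bar> \<le> ennreal (mass * (t - s) * u s x)"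
      using False by (intro ennreal_leI) auto
    also have "\<dots> = ennreal (mass * (t - s)) * ennreal (u s x)"
      using us mass_pos st by (intro ennreal_mult) auto
    also have "\<dots> \<le> ennreal (mass * (t - s)) * (2 * free s x)"
      by (intro mult_left_mono us) auto
    also have "\<dots> = ennreal (2 * mass * (t - s)) * free s x"
    proof -
      have "ennreal (2 * mass * (t - s)) = ennreal (2 * (mass * (t - s)))" by (simp only: mult.assoc)
      also have "\<dots> = 2 * ennreal (mass * (t - s))"
        using mass_pos st by (subst ennreal_mult) auto
      finally show ?thesis by (simp only: mult_ac)
    qed
    finally show ?thesis unfolding H_def by (rule order_trans) simp
  qed
  define C where "C = 2 * mass * P + (2 * exp (mass * T) * Q + k * P)"
  have C: "0 \<le> C" using mass_pos P Q k by (simp add: C_def)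
  have combine: "ennreal (2 * mass * r) * F1 + (ennreal (2 * (r * exp (mass * r))) * F2 + ennreal (k * r) * F3) \<le> ennreal (C * r)"
    if F: "F1 \<le> ennreal P" "F2 \<le> ennreal Q" "F3 \<le> ennreal P" and r: "0 \<le> r" "r \<le> T" for F1 F2 F3 r
  proof -
    have "ennreal (2 * mass * r) * F1 + (ennreal (2 * (r * exp (mass * r))) * F2 + ennreal (k * r) * F3)
        \<le> ennreal (2 * mass * r) * ennreal P + (ennreal (2 * (r * exp (mass * T))) * ennreal Q + ennreal (k * r) * ennreal P)"
      using F r k mass_pos by (intro add_mono mult_mono ennreal_leI) auto
    also have "\<dots> = ennreal (2 * mass * r * P + (2 * (r * exp (mass * T)) * Q + k * r * P))"
      using r P Q k mass_pos by (simp add: ennreal_mult' ennreal_plus)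
    also have "2 * mass * r * P + (2 * (r * exp (mass * T)) * Q + k * r * P) = C * r"
      by (simp add: C_def algebra_simps)
    finally show ?thesis .
  qed
  show thesis
  proof (rule that[OF C])
    fix s t :: real assume st: "0 \<le> s" "s \<le> t" "t \<le> T"
    show "weight b x * ennreal \<bar>u t x - u s x\<bar> \<le> ennreal (C * (t - s))" for x
    proof -
      have "?W x * ennreal \<bar>u t x - u s x\<bar> \<le> ?W x * H s t x"
        using st by (intro mult_left_mono diff_le) auto
      also have "\<dots> = ennreal (2 * mass * (t - s)) * (?W x * free s x)
          + (ennreal (2 * ((t - s) * exp (mass * (t - s)))) * (?W x * green_op (t - s) (nconv j (free s)) x) + ennreal (k * (t - s)) * (?W x * free t x))"
        unfolding H_def by (simp add: distrib_left mult_ac)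
      also have "\<dots> \<le> ennreal (C * (t - s))"
        using st by (intro combine sup_free sup_inc) auto
      finally show ?thesis .
    qed
    have "(\<integral>\<^sup>+ x. ?W x * ennreal \<bar>u t x - u s x\<bar> \<partial>lborel) \<le> (\<integral>\<^sup>+ x. ?W x * H s t x \<partial>lborel)"
      using st by (intro nn_integral_mono mult_left_mono diff_le) auto
    also have "\<dots> = (\<integral>\<^sup>+ x. ennreal (2 * mass * (t - s)) * (?W x * free s x)
          + (ennreal (2 * ((t - s) * exp (mass * (t - s)))) * (?W x * green_op (t - s) (nconv j (free s)) x) + ennreal (k * (t - s)) * (?W x * free t x)) \<partial>lborel)"
      unfolding H_def by (simp add: distrib_left mult_ac)
    also have "\<dots> = ennreal (2 * mass * (t - s)) * (\<integral>\<^sup>+ x. ?W x * free s x \<partial>lborel)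
          + (ennreal (2 * ((t - s) * exp (mass * (t - s)))) * (\<integral>\<^sup>+ x. ?W x * green_op (t - s) (nconv j (free s)) x \<partial>lborel)
            + ennreal (k * (t - s)) * (\<integral>\<^sup>+ x. ?W x * free t x \<partial>lborel))"
      by (simp add: nn_integral_add nn_integral_cmult)
    also have "\<dots> \<le> ennreal (C * (t - s))"
      using st P by (intro combine int_inc order_trans[OF int_free] ennreal_leI) auto
    finally show "(\<integral>\<^sup>+ x. ?W x * ennreal \<bar>u t x - u s x\<bar> \<partial>lborel) \<le> ennreal (C * (t - s))" .
  qed
qed

end

section \<open>Solutions in the sense of the real-valued equation\<close>

lemma AE_lborel_reflect:
  fixes x :: "'a::euclidean_space"
  assumes "AE y in lborel. P y"
  shows "AE y in lborel. P (x - y)"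
proof -
  obtain N where N: "{y. \<not> P y} \<subseteq> N" "emeasure lborel N = 0" "N \<in> sets lborel"
    using AE_E[OF assms] by auto
  have [measurable]: "N \<in> sets borel" using N by simp
  have "(\<integral>\<^sup>+ y. indicator N (x - y) \<partial>lborel) = 0"
    using nn_integral_lborel_reflect[of "indicator N" x] N by simp
  then have "AE y in lborel. indicator N (x - y) = (0 :: ennreal)"
    by (subst (asm) nn_integral_0_iff_AE) auto
  then show ?thesis
    by eventually_elim (use N in \<open>auto simp: indicator_def split: if_splits\<close>)
qed

lemma lebesgue_measurable_reflect:
  fixes J :: "'a::euclidean_space \<Rightarrow> real"
  assumes "J \<in> borel_measurable lebesgue"
  shows "(\<lambda>y. J (x - y)) \<in> borel_measurable lebesgue"
proof -
  have "(\<lambda>y. x + (\<Sum>j\<in>Basis. (-1 * (y \<bullet> j)) *\<^sub>R j)) \<in> lebesgue \<rightarrow>\<^sub>M (lebesgue :: 'a measure)"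
    by (rule lebesgue_affine_measurable) auto
  moreover have "(\<lambda>y. x + (\<Sum>j\<in>Basis. (-1 * (y \<bullet> j)) *\<^sub>R j)) = (\<lambda>y. x - y)"
    by (simp add: sum_negf euclidean_representation)
  ultimately show ?thesis using measurable_compose[OF _ assms, of "\<lambda>y. x - y"] by simp
qed

text \<open>The product of the completed Lebesgue measures is not complete, so Tonelli's theorem is only
  applied to a Borel version of \<open>J\<close>.\<close>
lemma borel_even_representative:
  fixes J :: "'a::euclidean_space \<Rightarrow> real"
  assumes J: "J \<in> borel_measurable lebesgue" "\<And>x. 0 \<le> J x" "\<And>x. J (- x) = J x"
  obtains k where "k \<in> borel_measurable borel" "\<And>x. 0 \<le> k x" "\<And>x. k (- x) = k x" "AE x in lborel. J x = k x"
proof -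
  obtain g where g: "g \<in> borel_measurable lborel" "AE x in lborel. J x = g x"
    using completion_ex_borel_measurable_real[OF J(1)] by blast
  then have [measurable]: "g \<in> borel_measurable borel" by simp
  \<comment> \<open>Averaging |g| with its reflection makes positivity and evenness hold at every
    point; almost everywhere both values agree with J x, as J is even and nonnegative.\<close>
  define k where "k x = (\<bar>g x\<bar> + \<bar>g (- x)\<bar>) / 2" for x
  have "AE x in lborel. J (0 - x) = g (0 - x)" by (rule AE_lborel_reflect[OF g(2)])
  with g(2) have "AE x in lborel. J x = k x"
  proof eventually_elim
    case (elim x)
    then show ?case using J(2)[of x] by (simp add: k_def J(3))
  qed
  moreover have "k \<in> borel_measurable borel" unfolding k_def by measurable
  moreover have "0 \<le> k x" "k (- x) = k x" for x by (auto simp: k_def)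
  ultimately show ?thesis by (intro that[of k])
qed

text \<open>A Caratheodory function. The identity in y is the limit of simple functions; inserted
  into f, each of them leaves finitely many measurable functions of t, and continuity in y passes to
  the limit.\<close>

lemma caratheodory_measurable:
  fixes f :: "'w \<Rightarrow> 'a::euclidean_space \<Rightarrow> real"
  assumes meas: "\<And>y. (\<lambda>t. f t y) \<in> borel_measurable M" and cont: "\<And>t. continuous_on UNIV (f t)"
  shows "(\<lambda>(t, y). f t y) \<in> borel_measurable (M \<Otimes>\<^sub>M borel)"
proof -
  have "\<exists>F. (\<forall>i. simple_function borel (F i)) \<and> (\<forall>y\<in>space borel. (\<lambda>i. F i y) \<longlonglongrightarrow> y)
      \<and> (\<forall>i. \<forall>y\<in>space borel. dist (F i y) 0 \<le> 2 * dist (y :: 'a) 0)"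
    by (rule borel_measurable_implies_sequence_metric) simp
  then obtain F :: "nat \<Rightarrow> 'a \<Rightarrow> 'a" where *: "(\<forall>i. simple_function borel (F i)) \<and> (\<forall>y\<in>space borel. (\<lambda>i. F i y) \<longlonglongrightarrow> y)
      \<and> (\<forall>i. \<forall>y\<in>space borel. dist (F i y) 0 \<le> 2 * dist (y :: 'a) 0)" ..
  have F: "\<And>i. simple_function borel (F i)" "\<And>y. (\<lambda>i. F i y) \<longlonglongrightarrow> y"
    using * by simp_all
  have "(\<lambda>w. f (fst w) (F i (snd w))) \<in> borel_measurable (M \<Otimes>\<^sub>M borel)" for i
  proof (rule measurable_compose_countable'[where I = "range (F i)"])
    have fin: "finite (range (F i))" using simple_functionD(1)[OF F(1)] by simp
    then show "countable (range (F i))" by (rule countable_finite)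
    have "F i \<in> borel \<rightarrow>\<^sub>M count_space (range (F i))"
      using simple_functionD(2)[OF F(1), of i] fin by (subst measurable_count_space_eq2) auto
    then show "(\<lambda>w. F i (snd w)) \<in> M \<Otimes>\<^sub>M borel \<rightarrow>\<^sub>M count_space (range (F i))"
      by (rule measurable_compose[OF measurable_snd])
    show "(\<lambda>w. f (fst w) c) \<in> borel_measurable (M \<Otimes>\<^sub>M borel)" for c
      by (rule measurable_compose[OF measurable_fst meas])
  qed
  then show ?thesis unfolding case_prod_beta'
  proof (rule borel_measurable_LIMSEQ_real[rotated])
    fix w :: "'w \<times> 'a"
    show "(\<lambda>i. f (fst w) (F i (snd w))) \<longlonglongrightarrow> f (fst w) (snd w)"
      by (rule continuous_on_tendsto_compose[OF cont]) (auto intro: F)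
  qed
qed

section \<open>Weighted norms and the solution class\<close>

lemma weighted_Lnorm_1:
  fixes f :: "real ^ 'n \<Rightarrow> real"
  shows "weighted_Lnorm 1 b f = (\<integral>\<^sup>+ x. weight b x * ennreal \<bar>f x\<bar> \<partial>lborel)"
proof -
  define I where "I = (\<integral>\<^sup>+ x. weight b x * ennreal \<bar>f x\<bar> \<partial>lborel)"
  have "(\<integral>\<^sup>+ x. ennreal (\<bar>japanese_bracket x powr b * f x\<bar> powr 1) \<partial>lebesgue) = I"
    unfolding I_def nn_integral_completion
    by (intro nn_integral_cong) (simp add: weight_def abs_mult ennreal_mult)
  then show ?thesis
    by (cases I) (simp_all add: weighted_Lnorm_def Let_def I_def[symmetric])
qed

lemma weighted_Lnorm_inf_le:
  fixes f :: "real ^ 'n \<Rightarrow> real"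
  assumes [measurable]: "f \<in> borel_measurable borel" and le: "\<And>x. weight b x * ennreal \<bar>f x\<bar> \<le> c"
  shows "weighted_Lnorm \<infinity> b f \<le> c"
proof -
  have "(\<lambda>x. ennreal \<bar>japanese_bracket x powr b * f x\<bar>) \<in> borel_measurable borel" by measurable
  then have "(\<lambda>x. ennreal \<bar>japanese_bracket x powr b * f x\<bar>) \<in> borel_measurable lebesgue"
    by (intro measurable_completion) simp
  moreover have "ennreal \<bar>japanese_bracket x powr b * f x\<bar> \<le> c" for x
    using le[of x] by (simp add: weight_def abs_mult ennreal_mult)
  ultimately show ?thesis unfolding weighted_Lnorm_def by (auto intro!: esssup_I)
qed

lemma continuous_on_japanese_bracket: "continuous_on UNIV japanese_bracket"
  unfolding japanese_bracket_def by (intro continuous_intros)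

text \<open>Where a continuous function exceeds its essential supremum is an open null set, hence
  empty. This turns the norm into a bound at every point.\<close>

lemma le_weighted_Lnorm_inf:
  fixes f :: "real ^ 'n \<Rightarrow> real"
  assumes f: "continuous_on UNIV f"
  shows "weight b x * ennreal \<bar>f x\<bar> \<le> weighted_Lnorm \<infinity> b f"
proof (cases "weighted_Lnorm \<infinity> b f")
  case (real s)
  let ?g = "\<lambda>x. \<bar>japanese_bracket x powr b * f x\<bar>"
  have cont: "continuous_on UNIV ?g"
  proof -
    have "japanese_bracket x \<noteq> 0" for x :: "real ^ 'n"
      using japanese_bracket_ge_1[of x] by linarith
    then show ?thesis by (intro continuous_intros f continuous_on_japanese_bracket) simp
  qed
  have "AE x in lebesgue. ennreal (?g x) \<le> ennreal s"
    using esssup_AE[of "\<lambda>x. ennreal (?g x)" lebesgue] real by (simp add: weighted_Lnorm_def)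
  then have "AE x in lebesgue. x \<notin> {x. s < ?g x}"
    using real by (auto simp: not_less elim!: eventually_mono)
  moreover have op: "open {x. s < ?g x}"
    by (rule open_Collect_less[OF continuous_on_const cont])
  ultimately have "negligible {x. s < ?g x}"
    unfolding negligible_iff_null_sets by (subst AE_iff_null_sets) auto
  then have "{x. s < ?g x} = {}" using open_not_negligible[OF op] by blast
  then have "?g x \<le> s" by (auto simp: not_less[symmetric])
  then have "ennreal (?g x) \<le> weighted_Lnorm \<infinity> b f" using real by (simp add: ennreal_leI)
  then show ?thesis by (simp add: weight_def abs_mult ennreal_mult)
qed simp

lemma solution_class_continuous:
  assumes v: "v \<in> solution_class b" and t0: "0 \<le> t0" and e: "0 < e"
  obtains \<delta> where "0 < \<delta>" "\<And>t x. 0 \<le> t \<Longrightarrow> \<bar>t - t0\<bar> < \<delta> \<Longrightarrow> weight b x * ennreal \<bar>v t x - v t0 x\<bar> \<le> ennreal e"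
proof -
  have cont: "continuous_on UNIV (v t)" if "0 \<le> t" for t
    using v that by (simp add: solution_class_def)
  have "((\<lambda>t. weighted_Lnorm 1 b (\<lambda>x. v t x - v t0 x) + weighted_Lnorm \<infinity> b (\<lambda>x. v t x - v t0 x)) \<longlongrightarrow> 0) (at t0 within {0..})"
    using v t0 by (simp add: solution_class_def)
  then have "\<forall>\<^sub>F t in at t0 within {0..}. weighted_Lnorm 1 b (\<lambda>x. v t x - v t0 x) + weighted_Lnorm \<infinity> b (\<lambda>x. v t x - v t0 x) < ennreal e"
    using e by (intro order_tendstoD(2)) auto
  then obtain \<delta> where \<delta>: "0 < \<delta>" "\<And>t. 0 \<le> t \<Longrightarrow> t \<noteq> t0 \<Longrightarrow> dist t t0 < \<delta> \<Longrightarrow>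
      weighted_Lnorm 1 b (\<lambda>x. v t x - v t0 x) + weighted_Lnorm \<infinity> b (\<lambda>x. v t x - v t0 x) < ennreal e"
    unfolding eventually_at by auto
  show thesis
  proof (rule that[OF \<delta>(1)])
    fix t x assume t: "0 \<le> t" "\<bar>t - t0\<bar> < \<delta>"
    show "weight b x * ennreal \<bar>v t x - v t0 x\<bar> \<le> ennreal e"
    proof (cases "t = t0")
      case False
      have "weight b x * ennreal \<bar>v t x - v t0 x\<bar> \<le> weighted_Lnorm \<infinity> b (\<lambda>x. v t x - v t0 x)"
        using cont t t0 by (intro le_weighted_Lnorm_inf continuous_intros) auto
      also have "\<dots> \<le> weighted_Lnorm 1 b (\<lambda>x. v t x - v t0 x) + weighted_Lnorm \<infinity> b (\<lambda>x. v t x - v t0 x)"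
        by simp
      also have "\<dots> \<le> ennreal e" using \<delta>(2)[OF t(1) False] t by (simp add: dist_real_def less_imp_le)
      finally show ?thesis .
    qed simp
  qed
qed

text \<open>v is jointly continuous: its continuity in time is uniform in space because the weight
  is at least 1, and each \<open>v t0\<close> is continuous. \<open>max 0 t\<close> removes the
  unspecified values at negative times.\<close>

lemma solution_class_measurable:
  fixes v :: "real \<Rightarrow> real ^ 'n \<Rightarrow> real"
  assumes v: "v \<in> solution_class b" and b: "0 \<le> b"
  shows "(\<lambda>(t, x). v (max 0 t) x) \<in> borel_measurable (lebesgue \<Otimes>\<^sub>M borel)"
proof -
  have cont: "continuous_on UNIV (v t)" if "0 \<le> t" for t
    using v that by (simp add: solution_class_def)
  have "continuous_on UNIV (\<lambda>w. v (max 0 (fst w)) (snd w))"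
    unfolding continuous_on_iff
  proof (intro ballI allI impI)
    fix w :: "real \<times> (real ^ 'n)" and e :: real assume e: "0 < e"
    define t0 where "t0 = max 0 (fst w)"
    have t0: "0 \<le> t0" by (simp add: t0_def)
    obtain \<delta> where \<delta>: "0 < \<delta>" "\<And>t x. 0 \<le> t \<Longrightarrow> \<bar>t - t0\<bar> < \<delta> \<Longrightarrow> weight b x * ennreal \<bar>v t x - v t0 x\<bar> \<le> ennreal (e / 2)"
      using solution_class_continuous[OF v t0, of "e / 2"] e by auto
    obtain \<eta> where \<eta>: "0 < \<eta>" "\<And>x. dist x (snd w) < \<eta> \<Longrightarrow> dist (v t0 x) (v t0 (snd w)) < e / 2"
      using cont[OF t0] e unfolding continuous_on_iff by (metis UNIV_I half_gt_zero)
    have "dist (v (max 0 (fst w')) (snd w')) (v (max 0 (fst w)) (snd w)) < e" if w': "dist w' w < min \<delta> \<eta>" for w'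
    proof -
      have "dist (fst w') (fst w) < \<delta>" "dist (snd w') (snd w) < \<eta>"
        using w' dist_fst_le[of w' w] dist_snd_le[of w' w] by auto
      then have "\<bar>max 0 (fst w') - t0\<bar> < \<delta>" unfolding t0_def dist_real_def by linarith
      then have "weight b (snd w') * ennreal \<bar>v (max 0 (fst w')) (snd w') - v t0 (snd w')\<bar> \<le> ennreal (e / 2)"
        by (intro \<delta>) auto
      moreover have "1 * ennreal \<bar>v (max 0 (fst w')) (snd w') - v t0 (snd w')\<bar>
          \<le> weight b (snd w') * ennreal \<bar>v (max 0 (fst w')) (snd w') - v t0 (snd w')\<bar>"
        by (intro mult_right_mono weight_ge_1 b) auto
      ultimately have "1 * ennreal \<bar>v (max 0 (fst w')) (snd w') - v t0 (snd w')\<bar> \<le> ennreal (e / 2)"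
        by (rule order_trans[rotated])
      then have "ennreal \<bar>v (max 0 (fst w')) (snd w') - v t0 (snd w')\<bar> \<le> ennreal (e / 2)"
        by (simp only: mult_1_left)
      then have "dist (v (max 0 (fst w')) (snd w')) (v t0 (snd w')) \<le> e / 2"
        using e unfolding dist_real_def by (subst (asm) ennreal_le_iff) auto
      moreover have "dist (v t0 (snd w')) (v t0 (snd w)) < e / 2"
        using \<open>dist (snd w') (snd w) < \<eta>\<close> by (rule \<eta>)
      ultimately show ?thesis
        using dist_triangle[of "v (max 0 (fst w')) (snd w')" "v t0 (snd w)" "v t0 (snd w')"]
        unfolding t0_def by linarith
    qed
    then show "\<exists>d>0. \<forall>w'\<in>UNIV. dist w' w < d \<longrightarrow> dist (v (max 0 (fst w')) (snd w')) (v (max 0 (fst w)) (snd w)) < e"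
      using \<delta>(1) \<eta>(1) by (intro exI[of _ "min \<delta> \<eta>"]) auto
  qed
  then have m1: "(\<lambda>w. v (max 0 (fst w)) (snd w)) \<in> borel_measurable (borel \<Otimes>\<^sub>M borel)"
    unfolding borel_prod by (rule borel_measurable_continuous_onI)
  have m2: "(\<lambda>w. (fst w, snd w)) \<in> lebesgue \<Otimes>\<^sub>M borel \<rightarrow>\<^sub>M borel \<Otimes>\<^sub>M borel"
  proof (rule measurable_Pair)
    show "fst \<in> lebesgue \<Otimes>\<^sub>M borel \<rightarrow>\<^sub>M borel"
      by (rule measurable_compose[OF measurable_fst, of "\<lambda>x. x"]) (auto intro: measurable_completion)
  qed simp
  show ?thesis using measurable_compose[OF m2 m1] by (simp add: case_prod_beta')
qed

text \<open>Continuity in time gives a bound near each time, and finitely many of these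
  neighbourhoods cover [0, T]. It provides the constant M for a competing solution in the uniqueness
  argument.\<close>

lemma solution_class_bounded:
  assumes v: "v \<in> solution_class b" and T: "0 \<le> T"
  obtains M where "0 \<le> M" "\<And>t x. 0 \<le> t \<Longrightarrow> t \<le> T \<Longrightarrow> weight b x * ennreal \<bar>v t x\<bar> \<le> ennreal M"
proof -
  have "\<exists>\<delta> M. 0 < \<delta> \<and> 0 \<le> M \<and> (\<forall>t x. 0 \<le> t \<and> \<bar>t - t0\<bar> < \<delta> \<longrightarrow> weight b x * ennreal \<bar>v t x\<bar> \<le> ennreal M)"
    if t0: "0 \<le> t0" for t0
  proof -
    obtain \<delta> where \<delta>: "0 < \<delta>" "\<And>t x. 0 \<le> t \<Longrightarrow> \<bar>t - t0\<bar> < \<delta> \<Longrightarrow> weight b x * ennreal \<bar>v t x - v t0 x\<bar> \<le> ennreal 1"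
      using solution_class_continuous[OF v t0, of 1] by auto
    have "weighted_Lnorm \<infinity> b (v t0) < \<infinity>" "continuous_on UNIV (v t0)"
      using v t0 by (auto simp: solution_class_def weighted_L_def)
    then obtain N where N: "0 \<le> N" "\<And>x. weight b x * ennreal \<bar>v t0 x\<bar> \<le> ennreal N"
      using le_weighted_Lnorm_inf[of "v t0" b] by (cases "weighted_Lnorm \<infinity> b (v t0)") auto
    have "weight b x * ennreal \<bar>v t x\<bar> \<le> ennreal (1 + N)" if "0 \<le> t" "\<bar>t - t0\<bar> < \<delta>" for t x
    proof -
      have "ennreal \<bar>v t x\<bar> \<le> ennreal (\<bar>v t x - v t0 x\<bar> + \<bar>v t0 x\<bar>)" by (intro ennreal_leI) auto
      then have "weight b x * ennreal \<bar>v t x\<bar> \<le> weight b x * (ennreal \<bar>v t x - v t0 x\<bar> + ennreal \<bar>v t0 x\<bar>)"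
        by (intro mult_left_mono) auto
      also have "\<dots> \<le> ennreal 1 + ennreal N"
        unfolding distrib_left by (intro add_mono \<delta>(2) N(2) that)
      finally show ?thesis using N(1) by simp
    qed
    then show ?thesis using \<delta>(1) N(1) by (intro exI[of _ \<delta>] exI[of _ "1 + N"]) auto
  qed
  then obtain \<delta> M where \<delta>: "\<And>t0. 0 \<le> t0 \<Longrightarrow> 0 < \<delta> t0" and M: "\<And>t0. 0 \<le> t0 \<Longrightarrow> 0 \<le> M t0"
    and bound: "\<And>t0 t x. 0 \<le> t0 \<Longrightarrow> 0 \<le> t \<Longrightarrow> \<bar>t - t0\<bar> < \<delta> t0 \<Longrightarrow> weight b x * ennreal \<bar>v t x\<bar> \<le> ennreal (M t0)"
    by metis
  obtain C where C: "C \<subseteq> {0..T}" "finite C" "{0..T} \<subseteq> (\<Union>c\<in>C. ball c (\<delta> c))"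
  proof (rule compactE_image[of "{0..T}" "{0..T}" "\<lambda>c. ball c (\<delta> c)"])
    show "{0..T} \<subseteq> (\<Union>c\<in>{0..T}. ball c (\<delta> c))" using \<delta> by fastforce
  qed auto
  show thesis
  proof (rule that)
    show "0 \<le> (\<Sum>c\<in>C. M c)" using C M by (intro sum_nonneg) auto
    fix t x assume t: "0 \<le> t" "t \<le> T"
    then obtain c where c: "c \<in> C" "\<bar>t - c\<bar> < \<delta> c" using C by (auto simp: dist_real_def abs_minus_commute subset_iff)
    have "weight b x * ennreal \<bar>v t x\<bar> \<le> ennreal (M c)" using c C t by (intro bound) auto
    also have "\<dots> \<le> ennreal (\<Sum>c\<in>C. M c)"
      using c C M by (intro ennreal_leI member_le_sum) auto
    finally show "weight b x * ennreal \<bar>v t x\<bar> \<le> ennreal (\<Sum>c\<in>C. M c)" .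
  qed
qed

text \<open>Finiteness is not assumed: where the convolution is infinite, the Bochner integral and
  \<open>enn2real\<close> both take the value 0.\<close>

lemma convolve_eq_nconv:
  fixes J k h :: "real ^ 'n \<Rightarrow> real"
  assumes J: "J \<in> borel_measurable lebesgue" "AE x in lborel. J x = k x"
    and k [measurable]: "k \<in> borel_measurable borel" "\<And>x. 0 \<le> k x"
    and h [measurable]: "h \<in> borel_measurable borel" "\<And>x. 0 \<le> h x"
  shows "convolve J h x = enn2real (nconv (\<lambda>z. ennreal (k z)) (\<lambda>y. ennreal (h y)) x)"
proof -
  have [measurable]: "h \<in> borel_measurable lebesgue" by (intro measurable_completion) simp
  have kb: "(\<lambda>y. k (x - y) * h y) \<in> borel_measurable borel" by measurable
  then have kl: "(\<lambda>y. k (x - y) * h y) \<in> borel_measurable lebesgue" by (intro measurable_completion) simp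
  have "AE y in lebesgue. J (x - y) = k (x - y)"
    using AE_lborel_reflect[OF J(2), of x] by (rule AE_completion)
  then have ae: "AE y in lebesgue. J (x - y) * h y = k (x - y) * h y" by eventually_elim simp
  have "convolve J h x = (\<integral>y. k (x - y) * h y \<partial>lebesgue)"
    unfolding convolve_def
    by (rule integral_cong_AE[OF _ kl ae]) (intro borel_measurable_times lebesgue_measurable_reflect J, simp)
  also have "\<dots> = (\<integral>y. k (x - y) * h y \<partial>lborel)" using kb by (intro integral_completion) simp
  also have "\<dots> = enn2real (\<integral>\<^sup>+ y. ennreal (k (x - y) * h y) \<partial>lborel)"
    using k h kb by (intro integral_eq_nn_integral) auto
  also have "\<dots> = enn2real (nconv (\<lambda>z. ennreal (k z)) (\<lambda>y. ennreal (h y)) x)"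
    using k h by (simp add: nconv_def ennreal_mult)
  finally show ?thesis .
qed

text \<open>The bound on h keeps all convolution powers finite, so that passing through
  \<open>enn2real\<close> and back is the identity and the comparison can be iterated. Finiteness of
  \<open>green_op\<close> yields the summability of the real series.\<close>

lemma (in dispersal_kernel) green_eq_green_op:
  fixes J k h :: "real ^ 'n \<Rightarrow> real"
  assumes J: "J \<in> borel_measurable lebesgue" "AE x in lborel. J x = k x" "total_mass J = mass"
    and k: "k \<in> borel_measurable borel" "\<And>x. 0 \<le> k x" "j = (\<lambda>z. ennreal (k z))"
    and h [measurable]: "h \<in> borel_measurable borel" and h0: "\<And>x. 0 \<le> h x" "\<And>x. h x \<le> c" and t: "0 \<le> t"
  shows "green J t h x = enn2real (green_op t (\<lambda>y. ennreal (h y)) x)"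
proof -
  let ?h = "\<lambda>y. ennreal (h y)" and ?r = "\<lambda>i x. enn2real ((nconv j ^^ i) (\<lambda>y. ennreal (h y)) x)"
  have fin: "(nconv j ^^ i) ?h x < \<infinity>" for i x
  proof -
    have "(nconv j ^^ i) ?h x \<le> ennreal mass ^ i * ennreal c"
      using nconv_funpow_bounded[of j ?h "ennreal c" i x] h0 by (simp add: mass ennreal_leI)
    also have "\<dots> < \<infinity>" using mass_pos by (simp add: ennreal_power ennreal_mult_less_top)
    finally show ?thesis .
  qed
  then have r: "(\<lambda>x. ennreal (?r i x)) = (nconv j ^^ i) ?h" for i by auto
  have pow: "(convolve J ^^ i) h = ?r i" for i
  proof (induction i)
    case (Suc i)
    have "convolve J (?r i) x = enn2real (nconv j (\<lambda>y. ennreal (?r i y)) x)" for x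
      unfolding k(3) by (rule convolve_eq_nconv[OF J(1,2) k(1,2)]) (auto simp: k(3)[symmetric])
    then have "convolve J (?r i) = ?r (Suc i)" unfolding r by auto
    then show ?case by (simp only: funpow.simps comp_def Suc)
  qed (use h0 in simp)
  let ?a = "\<lambda>i. t ^ i / fact i * ?r i x"
  have a: "ennreal (?a i) = ennreal (t ^ i / fact i) * (nconv j ^^ i) ?h x" for i
    using t fun_cong[OF r[of i], of x] by (subst ennreal_mult) auto
  have "green_op t ?h x \<le> ennreal c" using h0 t by (intro green_op_bounded ennreal_leI) auto
  then have "green_op t ?h x < \<infinity>" by (rule le_less_trans) simp
  then have "(\<Sum>i. ennreal (?a i)) \<noteq> top"
    unfolding a green_op_def by (auto simp: ennreal_mult_less_top)
  then have "(\<Sum>i. ennreal (?a i)) = ennreal (\<Sum>i. ?a i)" "summable ?a"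
    using t by (auto intro!: suminf_ennreal summable_suminf_not_top)
  then have "green_op t ?h x = ennreal (exp (- mass * t) * (\<Sum>i. ?a i))"
    unfolding green_op_def a[symmetric] using t by (simp add: ennreal_mult suminf_nonneg)
  then have "enn2real (green_op t ?h x) = exp (- mass * t) * (\<Sum>i. ?a i)"
    using \<open>summable ?a\<close> t by (simp add: suminf_nonneg)
  then show ?thesis by (simp add: green_def pow J(3))
qed

lemma (in semilinear_problem) duhamel_eq_integral:
  fixes J k :: "real ^ 'n \<Rightarrow> real" and a :: "real ^ 'n \<Rightarrow> real \<Rightarrow> real"
  assumes J: "J \<in> borel_measurable lebesgue" "AE x in lborel. J x = k x" "total_mass J = mass"
    and k: "k \<in> borel_measurable borel" "\<And>x. 0 \<le> k x" "j = (\<lambda>z. ennreal (k z))"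
    and A: "\<And>t y. 0 < t \<Longrightarrow> A t y = a y t"
    and v_meas: "(\<lambda>(t, x). v t x) \<in> borel_measurable (lebesgue \<Otimes>\<^sub>M borel)"
    and v_cont: "\<And>\<tau>. 0 \<le> \<tau> \<Longrightarrow> \<tau> \<le> t \<Longrightarrow> continuous_on UNIV (v \<tau>)"
    and v: "\<And>\<tau> y. 0 \<le> \<tau> \<Longrightarrow> \<tau> \<le> t \<Longrightarrow> 0 \<le> v \<tau> y \<and> v \<tau> y \<le> M * japanese_bracket y powr - b"
    and M: "0 \<le> M" and t: "0 \<le> t"
  shows "duhamel v t x < \<infinity>"
    and "(LINT \<tau>:{0..t}|lebesgue. green J (t - \<tau>) (\<lambda>y. a y \<tau> * v \<tau> y powr p) x) = enn2real (duhamel v t x)"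
proof -
  let ?G = "\<lambda>\<tau>. indicator {0..t} \<tau> * green_op (t - \<tau>) (source v \<tau>) x"
  define c where "c = C\<^sub>A * M powr (p - 1) * M"
  have c: "0 \<le> c" using C_pos M by (simp add: c_def)
  have bound: "0 \<le> A \<tau> y * v \<tau> y powr p" "A \<tau> y * v \<tau> y powr p \<le> c" if \<tau>: "0 \<le> \<tau>" "\<tau> \<le> t" for \<tau> y
  proof -
    have vb: "0 \<le> v \<tau> y" "v \<tau> y \<le> M * japanese_bracket y powr - b" using v[OF \<tau>, of y] by auto
    have "japanese_bracket y powr - b \<le> 1"
      using japanese_bracket_ge_1[of y] b_nonneg powr_mono[of "- b" 0 "japanese_bracket y"] by simp
    then have "M * japanese_bracket y powr - b \<le> M * 1" using M by (intro mult_left_mono)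
    then have vM: "v \<tau> y \<le> M" using vb by linarith
    have "A \<tau> y * v \<tau> y powr p = (A \<tau> y * v \<tau> y powr (p - 1)) * v \<tau> y"
      using vb powr_add[of "v \<tau> y" "p - 1" 1] p_gt_1 by (cases "v \<tau> y = 0") auto
    also have "\<dots> \<le> c"
      unfolding c_def using vb vM M C_pos by (intro mult_mono powr_weight_le) auto
    finally show "A \<tau> y * v \<tau> y powr p \<le> c" .
  qed (use A_nonneg in simp)
  have G_le: "?G \<tau> \<le> ennreal c * indicator {0..t} \<tau>" for \<tau>
    using bound by (auto simp: indicator_def source_def intro!: green_op_bounded ennreal_leI)
  note G_meas = duhamel_integrand_measurable_time[OF v_meas, of t x]
  have "duhamel v t x \<le> (\<integral>\<^sup>+ \<tau>. ennreal c * indicator {0..t} \<tau> \<partial>lebesgue)"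
    unfolding duhamel_def by (intro nn_integral_mono G_le)
  also have "\<dots> = ennreal c * ennreal t" using t by (simp add: nn_integral_cmult_indicator)
  also have "\<dots> < \<infinity>" by (simp add: ennreal_mult_less_top)
  finally show "duhamel v t x < \<infinity>" .
  have eq: "green J (t - \<tau>) (\<lambda>y. a y \<tau> * v \<tau> y powr p) x = enn2real (green_op (t - \<tau>) (source v \<tau>) x)"
    if \<tau>: "0 < \<tau>" "\<tau> \<le> t" for \<tau>
  proof -
    have "continuous_on UNIV (\<lambda>y. A \<tau> y * v \<tau> y powr p)"
      using \<tau> v v_cont p_gt_1 A_continuous by (intro continuous_intros continuous_on_powr') auto
    then have "(\<lambda>y. A \<tau> y * v \<tau> y powr p) \<in> borel_measurable borel"
      by (rule borel_measurable_continuous_onI)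
    then have "green J (t - \<tau>) (\<lambda>y. A \<tau> y * v \<tau> y powr p) x = enn2real (green_op (t - \<tau>) (\<lambda>y. ennreal (A \<tau> y * v \<tau> y powr p)) x)"
      using bound \<tau> by (intro green_eq_green_op[OF J k, where c = c]) auto
    then show ?thesis using \<tau> A by (simp add: source_def[abs_def])
  qed
  \<comment> \<open>A and a agree only for positive times, so the integrands may differ at \<tau> =
    0.\<close>
  have "(LINT \<tau>:{0..t}|lebesgue. green J (t - \<tau>) (\<lambda>y. a y \<tau> * v \<tau> y powr p) x)
      = (LINT \<tau>|lebesgue. enn2real (?G \<tau>))"
    unfolding set_lebesgue_integral_def
  proof (rule integral_discrete_difference[where X = "{0}"])
    fix \<tau> :: real assume "\<tau> \<notin> {0}"
    then show "indicat_real {0..t} \<tau> *\<^sub>R green J (t - \<tau>) (\<lambda>y. a y \<tau> * v \<tau> y powr p) x = enn2real (?G \<tau>)"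
      using eq[of \<tau>] by (auto simp: indicator_def)
  qed auto
  also have "\<dots> = enn2real (\<integral>\<^sup>+ \<tau>. ennreal (enn2real (?G \<tau>)) \<partial>lebesgue)"
    using G_meas by (intro integral_eq_nn_integral) auto
  also have "(\<integral>\<^sup>+ \<tau>. ennreal (enn2real (?G \<tau>)) \<partial>lebesgue) = duhamel v t x"
    unfolding duhamel_def
  proof (rule nn_integral_cong)
    fix \<tau>
    have "?G \<tau> < \<infinity>" by (rule le_less_trans[OF G_le]) (simp add: indicator_def)
    then show "ennreal (enn2real (?G \<tau>)) = ?G \<tau>" by simp
  qed
  finally show "(LINT \<tau>:{0..t}|lebesgue. green J (t - \<tau>) (\<lambda>y. a y \<tau> * v \<tau> y powr p) x) = enn2real (duhamel v t x)" .
qed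

lemma nn_integral_powr_tail:
  assumes "1 < q"
  shows "(\<integral>\<^sup>+ t. indicator {0..} t * ennreal ((1 + max 0 t) powr - q) \<partial>lebesgue) = ennreal (1 / (q - 1))"
proof -
  let ?F = "\<lambda>t. - ((t + 1) powr (1 - q) / (q - 1))"
  have "(\<integral>\<^sup>+ t. indicator {0..} t * ennreal ((1 + max 0 t) powr - q) \<partial>lebesgue)
      = (\<integral>\<^sup>+ t. ennreal ((1 + max 0 t) powr - q) * indicator {0..} t \<partial>lborel)"
    by (simp add: nn_integral_completion mult.commute)
  also have "\<dots> = ennreal (0 - ?F 0)"
  proof (rule nn_integral_FTC_atLeast)
    fix t :: real assume t: "0 \<le> t"
    have "((\<lambda>x. x powr (1 - q)) has_real_derivative (1 - q) * (t + 1) powr (1 - q - 1)) (at (t + 1))"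
      using t by (intro has_real_derivative_powr) auto
    then have "((\<lambda>t. (t + 1) powr (1 - q)) has_real_derivative (1 - q) * (t + 1) powr (1 - q - 1)) (at t)"
      by (simp only: DERIV_shift)
    then have "(?F has_real_derivative - ((1 - q) * (t + 1) powr (1 - q - 1) / (q - 1))) (at t)"
      by (intro DERIV_minus DERIV_cdivide)
    moreover have "- ((1 - q) * (t + 1) powr (1 - q - 1) / (q - 1)) = (1 + max 0 t) powr - q"
      using t assms by (simp add: add.commute field_simps)
    ultimately show "(?F has_real_derivative (1 + max 0 t) powr - q) (at t)" by (simp only:)
  next
    have "((\<lambda>t. (t + 1) powr (1 - q)) \<longlongrightarrow> 0) at_top"
      using assms
      by (intro tendsto_neg_powr filterlim_at_top_mono[OF filterlim_ident]) auto
    then have "(?F \<longlongrightarrow> - (0 / (q - 1))) at_top" by (intro tendsto_intros) (use assms in auto)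
    then show "(?F \<longlongrightarrow> 0) at_top" by simp
  qed auto
  finally show ?thesis by simp
qed

section \<open>From the extended-valued fixed point to the solution class\<close>

context small_data
begin

lemma free_weighted_integral:
  assumes "0 \<le> t"
  shows "(\<integral>\<^sup>+ x. weight b x * free t x \<partial>lborel) < \<infinity>"
proof -
  obtain \<gamma> where \<gamma>: "0 \<le> \<gamma>" "\<And>x. nconv j (weight b) x \<le> ennreal \<gamma> * weight b x"
    using weight_eigen by blast
  have "(\<integral>\<^sup>+ x. weight b x * free t x \<partial>lborel) = (\<integral>\<^sup>+ x. green_op t (weight b) x * ennreal (u\<^sub>0 x) \<partial>lborel)"
    unfolding free_def by (rule nn_integral_green_op_dual) measurable
  also have "\<dots> \<le> (\<integral>\<^sup>+ x. ennreal (exp ((\<gamma> - mass) * t)) * (weight b x * ennreal (u\<^sub>0 x)) \<partial>lborel)"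
    unfolding mult.assoc[symmetric] using \<gamma> assms by (intro nn_integral_mono mult_right_mono green_op_eigen) auto
  also have "\<dots> = ennreal (exp ((\<gamma> - mass) * t)) * (\<integral>\<^sup>+ x. weight b x * ennreal (u\<^sub>0 x) \<partial>lborel)"
    by (rule nn_integral_cmult) measurable
  also have "\<dots> \<le> ennreal (exp ((\<gamma> - mass) * t)) * ennreal m"
    by (intro mult_left_mono u0_integral) auto
  also have "\<dots> < \<infinity>" by (simp add: ennreal_mult_less_top)
  finally show ?thesis .
qed

lemma dominated_in_solution_class:
  assumes meas: "(\<lambda>(t, x). u t x) \<in> borel_measurable (lebesgue \<Otimes>\<^sub>M borel)" and u: "dominated u"
    and cont: "\<And>t. 0 \<le> t \<Longrightarrow> continuous_on UNIV (u t)"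
    and eq: "\<And>t x. 0 \<le> t \<Longrightarrow> ennreal (u t x) = picard_map u t x"
  shows "u \<in> solution_class b"
  unfolding solution_class_def
proof (intro CollectI conjI allI impI)
  fix t :: real assume t: "0 \<le> t"
  show "continuous_on UNIV (u t)" by (rule cont[OF t])
  then have borel: "u t \<in> borel_measurable borel" by (rule borel_measurable_continuous_onI)
  then have leb: "u t \<in> borel_measurable lebesgue" by (intro measurable_completion) simp
  have abs: "\<bar>u t x\<bar> = u t x" and le: "ennreal (u t x) \<le> 2 * free t x" for x
    using u t by (auto simp: dominated_def)
  have "weighted_Lnorm 1 b (u t) \<le> (\<integral>\<^sup>+ x. 2 * (weight b x * free t x) \<partial>lborel)"
    unfolding weighted_Lnorm_1 abs mult.left_commute[of 2] by (intro nn_integral_mono mult_left_mono le) auto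
  also have "\<dots> = 2 * (\<integral>\<^sup>+ x. weight b x * free t x \<partial>lborel)" by (rule nn_integral_cmult) measurable
  also have "\<dots> < \<infinity>" using free_weighted_integral[OF t] by (simp add: ennreal_mult_less_top)
  finally show "u t \<in> weighted_L 1 b" using leb by (simp add: weighted_L_def)
  have "weighted_Lnorm \<infinity> b (u t) \<le> ennreal (2 * K\<^sub>0)"
  proof (rule weighted_Lnorm_inf_le[OF borel])
    fix x
    show "weight b x * ennreal \<bar>u t x\<bar> \<le> ennreal (2 * K\<^sub>0)"
      unfolding abs using dominated_bound_uniform[OF u t, of x] K0_nonneg by (subst weight_mult_le_iff) auto
  qed
  also have "\<dots> < \<infinity>" by simp
  finally show "u t \<in> weighted_L \<infinity> b" using leb by (simp add: weighted_L_def)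
next
  fix t0 :: real assume t0: "0 \<le> t0"
  obtain C where C: "0 \<le> C"
    "\<And>s t x. 0 \<le> s \<Longrightarrow> s \<le> t \<Longrightarrow> t \<le> t0 + 1 \<Longrightarrow> weight b x * ennreal \<bar>u t x - u s x\<bar> \<le> ennreal (C * (t - s))"
    "\<And>s t. 0 \<le> s \<Longrightarrow> s \<le> t \<Longrightarrow> t \<le> t0 + 1 \<Longrightarrow> (\<integral>\<^sup>+ x. weight b x * ennreal \<bar>u t x - u s x\<bar> \<partial>lborel) \<le> ennreal (C * (t - s))"
    using time_lipschitz[OF meas u eq] by blast
  let ?N = "\<lambda>t. weighted_Lnorm 1 b (\<lambda>x. u t x - u t0 x) + weighted_Lnorm \<infinity> b (\<lambda>x. u t x - u t0 x)"
  have le: "?N t \<le> ennreal (C * \<bar>t - t0\<bar>) + ennreal (C * \<bar>t - t0\<bar>)" if t: "0 \<le> t" "t \<le> t0 + 1" for t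
  proof (rule add_mono)
    have "u s \<in> borel_measurable borel" if "0 \<le> s" for s
      using cont[OF that] by (rule borel_measurable_continuous_onI)
    then have [measurable]: "u t \<in> borel_measurable borel" "u t0 \<in> borel_measurable borel" using t t0 by auto
    show "weighted_Lnorm 1 b (\<lambda>x. u t x - u t0 x) \<le> ennreal (C * \<bar>t - t0\<bar>)"
      unfolding weighted_Lnorm_1
    proof (cases "t0 \<le> t")
      case True
      then show "(\<integral>\<^sup>+ x. weight b x * ennreal \<bar>u t x - u t0 x\<bar> \<partial>lborel) \<le> ennreal (C * \<bar>t - t0\<bar>)"
        using C(3)[of t0 t] t t0 by simp
    next
      case False
      then show "(\<integral>\<^sup>+ x. weight b x * ennreal \<bar>u t x - u t0 x\<bar> \<partial>lborel) \<le> ennreal (C * \<bar>t - t0\<bar>)"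
        using C(3)[of t t0] t by (simp add: abs_minus_commute)
    qed
    show "weighted_Lnorm \<infinity> b (\<lambda>x. u t x - u t0 x) \<le> ennreal (C * \<bar>t - t0\<bar>)"
    proof (rule weighted_Lnorm_inf_le)
      fix x
      show "weight b x * ennreal \<bar>u t x - u t0 x\<bar> \<le> ennreal (C * \<bar>t - t0\<bar>)"
        using C(2)[of t0 t x] C(2)[of t t0 x] t t0
        by (cases "t0 \<le> t") (simp_all add: abs_minus_commute)
    qed measurable
  qed
  show "(?N \<longlongrightarrow> 0) (at t0 within {0..})"
  proof (rule tendsto_sandwich[where f = "\<lambda>_. 0" and h = "\<lambda>t. ennreal (C * \<bar>t - t0\<bar>) + ennreal (C * \<bar>t - t0\<bar>)"])
    show "\<forall>\<^sub>F t in at t0 within {0..}. ?N t \<le> ennreal (C * \<bar>t - t0\<bar>) + ennreal (C * \<bar>t - t0\<bar>)"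
      unfolding eventually_at using le by (intro exI[of _ 1]) (auto simp: dist_real_def)
    have "((\<lambda>t. C * \<bar>t - t0\<bar>) \<longlongrightarrow> C * \<bar>t0 - t0\<bar>) (at t0 within {0..})"
      by (intro tendsto_intros)
    then have "((\<lambda>t. ennreal (C * \<bar>t - t0\<bar>)) \<longlongrightarrow> 0) (at t0 within {0..})"
      using tendsto_ennrealI by fastforce
    from tendsto_add[OF this this]
    show "((\<lambda>t. ennreal (C * \<bar>t - t0\<bar>) + ennreal (C * \<bar>t - t0\<bar>)) \<longlongrightarrow> 0) (at t0 within {0..})" by simp
  qed auto
qed

text \<open>The competitor v is not assumed to lie below 2 G(t) u0. It is compared with u on [0, t]
  only, where membership in the class supplies a finite weighted bound, and the contraction admits
  any such bound.\<close>

lemma unique_mild_solution: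
  fixes J k :: "real ^ 'n \<Rightarrow> real" and a :: "real ^ 'n \<Rightarrow> real \<Rightarrow> real"
  assumes J: "J \<in> borel_measurable lebesgue" "AE x in lborel. J x = k x" "total_mass J = mass"
    and k: "k \<in> borel_measurable borel" "\<And>x. 0 \<le> k x" "j = (\<lambda>z. ennreal (k z))"
    and A: "\<And>t y. 0 < t \<Longrightarrow> A t y = a y t"
  shows "\<exists>u. u \<in> solution_class b \<and> mild_solution J a p u\<^sub>0 u \<and>
    (\<forall>v. v \<in> solution_class b \<and> mild_solution J a p u\<^sub>0 v \<longrightarrow> (\<forall>t\<ge>0. \<forall>x. v t x = u t x))"
proof -
  obtain u where u_meas: "(\<lambda>(t, x). u t x) \<in> borel_measurable (lebesgue \<Otimes>\<^sub>M borel)" and u_dom: "dominated u"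
    and u_cont: "\<And>t. 0 \<le> t \<Longrightarrow> continuous_on UNIV (u t)" and u_eq: "\<And>t x. 0 \<le> t \<Longrightarrow> ennreal (u t x) = picard_map u t x"
    using mild_solution_exists by blast
  have u_bound: "0 \<le> u t x \<and> u t x \<le> 2 * K\<^sub>0 * japanese_bracket x powr - b" if "0 \<le> t" for t x
    by (rule dominated_bound_uniform[OF u_dom that])
  have free: "green J t u\<^sub>0 x = enn2real (free t x)" if "0 \<le> t" for t x
    unfolding free_def
  proof (rule green_eq_green_op[OF J k _ _ _ that])
    show "u\<^sub>0 \<in> borel_measurable borel" using u0_continuous by (rule borel_measurable_continuous_onI)
    show "u\<^sub>0 x \<le> m" for x using u0_bounded[of x] m_nonneg by simp
  qed (rule u0_nonneg)
  have u_mild: "mild_solution J a p u\<^sub>0 u"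
    unfolding mild_solution_def
  proof (intro allI impI conjI)
    fix t x assume t: "0 \<le> (t :: real)"
    show "0 \<le> u t x" using u_bound[OF t] by blast
    note duh = duhamel_eq_integral[OF J k A u_meas u_cont u_bound _ t, of x]
    have "u t x = enn2real (free t x + duhamel u t x)"
      using u_eq[OF t, of x] \<open>0 \<le> u t x\<close> unfolding picard_map_def by (metis enn2real_ennreal)
    also have "\<dots> = enn2real (free t x) + enn2real (duhamel u t x)"
      using free_finite[OF t, of x] duh(1) K0_nonneg by (intro enn2real_plus) auto
    also have "\<dots> = green J t u\<^sub>0 x + (LINT \<tau>:{0..t}|lebesgue. green J (t - \<tau>) (\<lambda>y. a y \<tau> * u \<tau> y powr p) x)"
      using duh(2) K0_nonneg free[OF t] by simp
    finally show "u t x = green J t u\<^sub>0 x + (LINT \<tau>:{0..t}|lebesgue. green J (t - \<tau>) (\<lambda>y. a y \<tau> * u \<tau> y powr p) x)" .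
  qed
  have unique: "v t x = u t x" if v: "v \<in> solution_class b" "mild_solution J a p u\<^sub>0 v" and t: "0 \<le> t" for v t x
  proof -
    obtain M where M: "0 \<le> M" "\<And>\<tau> x. 0 \<le> \<tau> \<Longrightarrow> \<tau> \<le> t \<Longrightarrow> weight b x * ennreal \<bar>v \<tau> x\<bar> \<le> ennreal M"
      using solution_class_bounded[OF v(1) t] by blast
    \<comment> \<open>The class says nothing about v at negative times, but the Duhamel lemmas ask
      for joint measurability on the whole time axis.\<close>
    define v' where "v' \<tau> = v (max 0 \<tau>)" for \<tau>
    have v': "v' \<tau> = v \<tau>" if "0 \<le> \<tau>" for \<tau> using that by (simp add: v'_def)
    have v_nonneg: "0 \<le> v \<tau> y" if "0 \<le> \<tau>" for \<tau> y
      using v(2) that unfolding mild_solution_def by blast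
    have v_bound: "0 \<le> v' \<tau> y \<and> v' \<tau> y \<le> M * japanese_bracket y powr - b" if "0 \<le> \<tau>" "\<tau> \<le> t" for \<tau> y
      using M(2)[OF that, of y] v_nonneg[OF that(1), of y] M(1) v'[OF that(1)] by (simp add: weight_mult_le_iff)
    have v_meas: "(\<lambda>(t, x). v' t x) \<in> borel_measurable (lebesgue \<Otimes>\<^sub>M borel)"
      unfolding v'_def by (rule solution_class_measurable[OF v(1) b_nonneg])
    have v_cont: "continuous_on UNIV (v' \<tau>)" if "0 \<le> \<tau>" for \<tau>
      using v(1) that by (simp add: v'_def solution_class_def)
    have v_eq: "ennreal (v' s y) = free s y + duhamel v' s y" if s: "0 \<le> s" "s \<le> t" for s y
    proof -
      note duh = duhamel_eq_integral[OF J k A v_meas v_cont v_bound M(1) s(1), of y]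
      have "v s y = green J s u\<^sub>0 y + (LINT \<tau>:{0..s}|lebesgue. green J (s - \<tau>) (\<lambda>y. a y \<tau> * v \<tau> y powr p) y)"
        using v(2) s unfolding mild_solution_def by blast
      also have "(LINT \<tau>:{0..s}|lebesgue. green J (s - \<tau>) (\<lambda>y. a y \<tau> * v \<tau> y powr p) y)
          = (LINT \<tau>:{0..s}|lebesgue. green J (s - \<tau>) (\<lambda>y. a y \<tau> * v' \<tau> y powr p) y)"
        by (rule set_lebesgue_integral_cong) (auto simp: v')
      also have "\<dots> = enn2real (duhamel v' s y)" using duh(2) s by simp
      finally have "v' s y = enn2real (free s y) + enn2real (duhamel v' s y)"
        using free s v' by simp
      then show ?thesis
        using free_finite[OF s(1), of y] duh(1) s by (simp add: ennreal_plus)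
    qed
    define B where "B = max M (2 * K\<^sub>0)"
    have B: "0 \<le> B" "M \<le> B" "2 * K\<^sub>0 \<le> B" using M(1) by (auto simp: B_def)
    have enlarge: "c * japanese_bracket y powr - b \<le> B * japanese_bracket y powr - b" if "c \<le> B" for c and y :: "real ^ 'n"
      using that by (intro mult_right_mono) auto
    have "v' t x = u t x"
    proof (rule mild_solution_unique[OF v_meas u_meas _ _ v_eq _ B(1) t order_refl])
      show "0 \<le> v' \<tau> y \<and> v' \<tau> y \<le> B * japanese_bracket y powr - b" if "0 \<le> \<tau>" "\<tau> \<le> t" for \<tau> y
        using v_bound[OF that, of y] enlarge[OF B(2), of y] by linarith
      show "0 \<le> u \<tau> y \<and> u \<tau> y \<le> B * japanese_bracket y powr - b" if "0 \<le> \<tau>" "\<tau> \<le> t" for \<tau> y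
        using u_bound[OF that(1), of y] enlarge[OF B(3), of y] by linarith
      show "ennreal (u \<tau> y) = free \<tau> y + duhamel u \<tau> y" if "0 \<le> \<tau>" "\<tau> \<le> t" for \<tau> y
        using u_eq[OF that(1), of y] by (simp add: picard_map_def)
    qed
    then show ?thesis using v'[OF t] by simp
  qed
  show ?thesis
    using dominated_in_solution_class[OF u_meas u_dom u_cont u_eq] u_mild unique by blast
qed

end

section \<open>Reduction to Borel data and choice of the threshold\<close>

theorem theorem1p5:
  fixes J :: "real ^ 'n \<Rightarrow> real"
    and a :: "real ^ 'n \<Rightarrow> real \<Rightarrow> real"
    and \<epsilon>\<^sub>0 \<sigma> p :: real
  assumes J_nonneg: "\<And>x. 0 \<le> J x"
    and J_radial: "radially_symmetric J"
    and J_nontrivial: "total_mass J > 0"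
    and eps0: "\<epsilon>\<^sub>0 > 0"
    and J_L: "J \<in> weighted_L_inf 1 \<inter> weighted_L_inf (ennreal (1 + \<epsilon>\<^sub>0))"
    and sigma: "\<sigma> \<ge> 0"
    and a_meas: "\<And>x. (\<lambda>t. a x t) \<in> borel_measurable (lebesgue_on {0<..})"
    and a_cont: "\<And>t. t > 0 \<Longrightarrow> continuous_on UNIV (\<lambda>x. a x t)"
    and a_weight: "comparable_to_weight a \<sigma>"
    and p: "p > 1 + (\<sigma> + 2) / real CARD('n)"
  shows "\<exists>\<epsilon>>0. \<forall>u0 :: real ^ 'n \<Rightarrow> real.
    continuous_on UNIV u0 \<and> (\<forall>x. 0 \<le> u0 x) \<and>
    weighted_Lnorm 1 (\<sigma> / (p - 1)) u0 + weighted_Lnorm \<infinity> (\<sigma> / (p - 1)) u0 \<le> ennreal \<epsilon> \<longrightarrow>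
    (\<exists>u. u \<in> solution_class (\<sigma> / (p - 1)) \<and> mild_solution J a p u0 u \<and>
      (\<forall>v. v \<in> solution_class (\<sigma> / (p - 1)) \<and> mild_solution J a p u0 v \<longrightarrow>
        (\<forall>t\<ge>0. \<forall>x. v t x = u t x)))"
proof -
  define n where "n = real CARD('n)"
  have n: "0 < n" by (simp add: n_def)
  have J_weighted: "J \<in> weighted_L 1 b" for b
    using J_L by (simp add: weighted_L_inf_def)
  then have J_leb: "J \<in> borel_measurable lebesgue"
    by (auto simp: weighted_L_def)
  have J_even: "J (- x) = J x" for x
    using J_radial unfolding radially_symmetric_def by (metis norm_minus_cancel)
  obtain k where k: "k \<in> borel_measurable borel" "\<And>x. 0 \<le> k x" "\<And>x. k (- x) = k x" and Jk: "AE x in lborel. J x = k x"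
    using borel_even_representative[OF J_leb J_nonneg J_even] by blast
  define j where "j z = ennreal (k z)" for z
  have total: "total_mass J = enn2real (\<integral>\<^sup>+ x. j x \<partial>lborel)"
  proof -
    have "total_mass J = enn2real (\<integral>\<^sup>+ x. ennreal (J x) \<partial>lebesgue)"
      using J_leb J_nonneg unfolding total_mass_def by (subst integral_eq_nn_integral) auto
    also have "(\<integral>\<^sup>+ x. ennreal (J x) \<partial>lebesgue) = (\<integral>\<^sup>+ x. j x \<partial>lborel)"
      unfolding nn_integral_completion j_def by (rule nn_integral_cong_AE) (use Jk in eventually_elim, simp)
    finally show ?thesis .
  qed
  interpret dispersal_kernel j
  proof
    show "j \<in> borel_measurable borel" using k(1) unfolding j_def by measurable
    show "(\<integral>\<^sup>+ x. j x \<partial>lborel) \<noteq> 0" using J_nontrivial total by auto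
    show "(\<integral>\<^sup>+ x. j x * ennreal (japanese_bracket x powr b) \<partial>lborel) < \<infinity>" for b
    proof -
      have "(\<integral>\<^sup>+ x. j x * ennreal (japanese_bracket x powr b) \<partial>lborel) = weighted_Lnorm 1 b J"
        unfolding weighted_Lnorm_1
      proof (rule nn_integral_cong_AE)
        show "AE x in lborel. j x * ennreal (japanese_bracket x powr b) = weight b x * ennreal \<bar>J x\<bar>"
          using Jk by eventually_elim (simp add: weight_def j_def mult.commute k)
      qed
      then show ?thesis using J_weighted[of b] by (simp add: weighted_L_def)
    qed
  qed (simp_all add: j_def k)
  have total_mass: "total_mass J = mass" by (simp add: total mass_def)
  obtain c C where cC: "0 < c" "0 < C" "\<And>x t. 0 < t \<Longrightarrow> c * japanese_bracket x powr \<sigma> \<le> a x t \<and> a x t \<le> C * japanese_bracket x powr \<sigma>"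
    using a_weight unfolding comparable_to_weight_def by metis
  \<comment> \<open>Nothing is known about \<open>a\<close> at time \<open>0\<close>, which is a null set for the time integral.\<close>
  define A where "A t y = (if 0 < t then a y t else C * japanese_bracket y powr \<sigma>)" for t y
  have "0 < (\<sigma> + 2) / n" using n sigma by simp
  then have p1: "1 < p" using p by (simp add: n_def)
  interpret semilinear_problem j A \<sigma> p C
  proof
    have A_time: "(\<lambda>t. A t y) \<in> borel_measurable lebesgue" for y
    proof -
      have "(\<lambda>t. if t \<in> {0<..} then a y t else 0) \<in> borel_measurable lebesgue"
        using a_meas[of y] by (subst borel_measurable_if) auto
      moreover have "(\<lambda>t. if 0 < t then 0 else C * japanese_bracket y powr \<sigma>) \<in> borel_measurable (borel :: real measure)"
        by measurable
      then have "(\<lambda>t :: real. if 0 < t then 0 else C * japanese_bracket y powr \<sigma>) \<in> borel_measurable lebesgue"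
        by (intro measurable_completion) simp
      ultimately have "(\<lambda>t. (if t \<in> {0<..} then a y t else 0) + (if 0 < t then 0 else C * japanese_bracket y powr \<sigma>)) \<in> borel_measurable lebesgue"
        by (rule borel_measurable_add)
      moreover have "(\<lambda>t. (if t \<in> {0<..} then a y t else 0) + (if 0 < t then 0 else C * japanese_bracket y powr \<sigma>)) = (\<lambda>t. A t y)"
        by (auto simp: A_def)
      ultimately show ?thesis by simp
    qed
    show A_cont: "continuous_on UNIV (A t)" for t
    proof (cases "0 < t")
      case True
      then show ?thesis using a_cont by (simp add: A_def)
    next
      case False
      have "japanese_bracket y \<noteq> 0" for y :: "real ^ 'n" using japanese_bracket_ge_1[of y] by linarith
      then have "continuous_on UNIV (\<lambda>y :: real ^ 'n. C * japanese_bracket y powr \<sigma>)"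
        by (intro continuous_intros continuous_on_japanese_bracket) simp
      then show ?thesis using False by (simp add: A_def[abs_def])
    qed
    show "(\<lambda>(t, y). A t y) \<in> borel_measurable (lebesgue \<Otimes>\<^sub>M borel)"
      by (rule caratheodory_measurable[OF A_time A_cont])
    show "0 \<le> A t y" for t y
    proof (cases "0 < t")
      case True
      have "0 \<le> c * japanese_bracket y powr \<sigma>" using cC by simp
      also have "\<dots> \<le> a y t" using cC(3)[OF True] by blast
      finally show ?thesis using True by (simp add: A_def)
    qed (use cC in \<open>simp add: A_def\<close>)
    show "A t y \<le> C * japanese_bracket y powr \<sigma>" for t y
      using cC(3) by (simp add: A_def)
  qed (use cC sigma p1 in auto)
  have b: "b = \<sigma> / (p - 1)" by (rule b_def)
  have gap: "1 / (p - 1) < (n - b) / 2"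
  proof -
    have "\<sigma> + 2 < n * (p - 1)" using p n by (simp add: n_def field_simps)
    then have "1 < (n - b) / 2 * (p - 1)" using b_mult by (simp add: field_simps)
    then show ?thesis using p1 by (simp add: field_simps)
  qed
  \<comment> \<open>The midpoint of the admissible interval: above 1 / (p - 1) the potential is
    integrable in time, below (n - b) / 2 the weighted decay is available.\<close>
  define \<theta> where "\<theta> = (1 / (p - 1) + (n - b) / 2) / 2"
  have "x < (x + y) / 2 \<and> (x + y) / 2 < y" if "x < y" for x y :: real using that by simp
  from this[OF gap] have \<theta>: "1 / (p - 1) < \<theta>" and \<theta>': "\<theta> < (n - b) / 2"
    unfolding \<theta>_def by blast+
  have "0 < 1 / (p - 1)" using p1 by simp
  then have \<theta>0: "0 \<le> \<theta>" using \<theta> by linarith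
  define q where "q = \<theta> * (p - 1)"
  have q: "1 < q" using \<theta> p1 by (simp add: q_def field_simps)
  obtain D where D: "0 < D" "\<And>f M t x. f \<in> borel_measurable borel \<Longrightarrow> (\<And>x. weight b x * f x \<le> M) \<Longrightarrow>
      (\<integral>\<^sup>+ x. weight b x * f x \<partial>lborel) \<le> M \<Longrightarrow> 0 \<le> t \<Longrightarrow>
      weight b x * green_op t f x \<le> M * ennreal (D * (1 + t) powr - \<theta>)"
    using weighted_green_op_decay[OF b_nonneg \<theta>0, folded n_def, OF \<theta>'] by blast
  \<comment> \<open>Solved from 2 C (2 \<epsilon> D)^(p - 1) = q - 1, the reciprocal of the integral
    of (1 + t)^(-q) over t >= 0, so that \<open>K_small\<close> holds with equality.\<close>
  define \<epsilon> where "\<epsilon> = ((q - 1) / (2 * C)) powr (1 / (p - 1)) / (2 * D)"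
  have \<epsilon>: "0 < \<epsilon>" using q cC D by (simp add: \<epsilon>_def)
  have \<epsilon>_eq: "2 * (C * (2 * (\<epsilon> * D)) powr (p - 1)) = q - 1"
  proof -
    have "2 * (\<epsilon> * D) = ((q - 1) / (2 * C)) powr (1 / (p - 1))" using D by (simp add: \<epsilon>_def)
    then have "(2 * (\<epsilon> * D)) powr (p - 1) = (q - 1) / (2 * C)"
      using q cC p1 by (simp add: powr_powr)
    then show ?thesis using cC by simp
  qed
  show ?thesis
  proof (intro exI[of _ \<epsilon>] conjI \<epsilon> allI impI)
    fix u0 :: "real ^ 'n \<Rightarrow> real"
    assume "continuous_on UNIV u0 \<and> (\<forall>x. 0 \<le> u0 x) \<and>
      weighted_Lnorm 1 (\<sigma> / (p - 1)) u0 + weighted_Lnorm \<infinity> (\<sigma> / (p - 1)) u0 \<le> ennreal \<epsilon>"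
    then have u0: "continuous_on UNIV u0" "\<And>x. 0 \<le> u0 x" "weighted_Lnorm 1 b u0 + weighted_Lnorm \<infinity> b u0 \<le> ennreal \<epsilon>"
      by (simp_all add: b)
    have sup: "weight b x * ennreal (u0 x) \<le> ennreal \<epsilon>" for x
    proof -
      have "weight b x * ennreal (u0 x) \<le> weighted_Lnorm \<infinity> b u0"
        using le_weighted_Lnorm_inf[OF u0(1), of b x] u0(2) by simp
      also have "\<dots> \<le> weighted_Lnorm 1 b u0 + weighted_Lnorm \<infinity> b u0" by simp
      finally show ?thesis using u0(3) by (rule order_trans)
    qed
    have int: "(\<integral>\<^sup>+ x. weight b x * ennreal (u0 x) \<partial>lborel) \<le> ennreal \<epsilon>"
    proof -
      have "(\<integral>\<^sup>+ x. weight b x * ennreal (u0 x) \<partial>lborel) = weighted_Lnorm 1 b u0"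
        using u0(2) by (simp add: weighted_Lnorm_1)
      also have "\<dots> \<le> weighted_Lnorm 1 b u0 + weighted_Lnorm \<infinity> b u0" by simp
      finally show ?thesis using u0(3) by (rule order_trans)
    qed
    have u0_borel [measurable]: "u0 \<in> borel_measurable borel"
      using u0(1) by (rule borel_measurable_continuous_onI)
    \<comment> \<open>\<open>max 0 t\<close> keeps K bounded by \<epsilon> D at negative times too,
      since the locale asks for this bound at all real t.\<close>
    define K where "K t = \<epsilon> * D * (1 + max 0 t) powr - \<theta>" for t :: real
    have K0: "0 \<le> K t" for t using \<epsilon> D by (simp add: K_def)
    interpret small_data j A \<sigma> p C u0 K "\<epsilon> * D" \<epsilon>
    proof
      show "weight b x * green_op t (\<lambda>x. ennreal (u0 x)) x \<le> ennreal (K t)" if "0 \<le> t" for t x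
      proof -
        have "weight b x * green_op t (\<lambda>x. ennreal (u0 x)) x \<le> ennreal \<epsilon> * ennreal (D * (1 + t) powr - \<theta>)"
          using that by (intro D sup int) measurable
        also have "\<dots> = ennreal (K t)"
          using that \<epsilon> D by (simp add: K_def ennreal_mult'[symmetric] mult.assoc)
        finally show ?thesis .
      qed
      show "K t \<le> \<epsilon> * D" for t
      proof -
        have "(1 + max 0 t) powr - \<theta> \<le> 1"
          using \<theta>0 powr_mono[of "- \<theta>" 0 "1 + max 0 t"] by (simp split: if_splits)
        then have "\<epsilon> * D * (1 + max 0 t) powr - \<theta> \<le> \<epsilon> * D * 1"
          using \<epsilon> D by (intro mult_left_mono) auto
        then show ?thesis by (simp add: K_def)
      qed
      show "K \<in> borel_measurable borel" unfolding K_def by measurable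
      have eq: "2 * (C * (2 * K t) powr (p - 1)) = (q - 1) * (1 + max 0 t) powr - q" for t
      proof -
        have "2 * K t = 2 * (\<epsilon> * D) * (1 + max 0 t) powr - \<theta>" by (simp add: K_def)
        then have "(2 * K t) powr (p - 1) = (2 * (\<epsilon> * D)) powr (p - 1) * ((1 + max 0 t) powr - \<theta>) powr (p - 1)"
          by (simp only: powr_mult)
        also have "((1 + max 0 t) powr - \<theta>) powr (p - 1) = (1 + max 0 t) powr - q"
          by (simp add: powr_powr q_def)
        finally show ?thesis using \<epsilon>_eq by (simp add: mult.assoc[symmetric])
      qed
      have "(\<integral>\<^sup>+ t. indicator {0..} t * ennreal (2 * (C * (2 * K t) powr (p - 1))) \<partial>lebesgue)
          = (\<integral>\<^sup>+ t. ennreal (q - 1) * (indicator {0..} t * ennreal ((1 + max 0 t) powr - q)) \<partial>lborel)"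
        unfolding eq nn_integral_completion using q by (simp add: ennreal_mult mult.left_commute)
      also have "\<dots> = ennreal (q - 1) * (\<integral>\<^sup>+ t. indicator {0..} t * ennreal ((1 + max 0 t) powr - q) \<partial>lborel)"
        by (rule nn_integral_cmult) measurable
      also have "\<dots> = ennreal (q - 1) * ennreal (1 / (q - 1))"
        using nn_integral_powr_tail[OF q] by (simp add: nn_integral_completion)
      also have "\<dots> = 1" using q by (simp add: ennreal_mult[symmetric])
      finally show "(\<integral>\<^sup>+ t. indicator {0..} t * ennreal (2 * (C * (2 * K t) powr (p - 1))) \<partial>lebesgue) \<le> 1" by simp
    qed (use u0 sup int \<epsilon> K0 in auto)
    show "\<exists>u. u \<in> solution_class (\<sigma> / (p - 1)) \<and> mild_solution J a p u0 u \<and>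
      (\<forall>v. v \<in> solution_class (\<sigma> / (p - 1)) \<and> mild_solution J a p u0 v \<longrightarrow> (\<forall>t\<ge>0. \<forall>x. v t x = u t x))"
      unfolding b[symmetric]
    proof (rule unique_mild_solution[OF J_leb Jk total_mass k(1,2)])
      show "j = (\<lambda>z. ennreal (k z))" by (simp add: j_def fun_eq_iff)
      show "A t y = a y t" if "0 < t" for t y using that by (simp add: A_def)
    qed
  qed
qed

end
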